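(* Let $k\geq 2$, $\Gamma=J(2k,k)$ and $G\leqslant\mathrm{Aut}(\Gamma)=S_{2k}\times\langle\tau\rangle$ such that both $G$ and $G\cap S_{2k}$ are arc-transitive on $\Gamma$. If $(\Gamma,\mathcal{P})$ is a $G$-primitive decomposition, then $(\Gamma,\mathcal{P})$ is also a $(G\cap S_{2k})$-primitive decomposition.
   Context: $J(2k,k)$ has vertices the $k$-subsets of $X=\{1,\dots,2k\}$, adjacent when they share $k-1$ points; $S_{2k}$ acts naturally and $\tau$ maps each $k$-subset to its complement. A decomposition is a partition of the edge set into at least two parts (divisors); for a group $L$ of automorphisms it is $L$-transitive if $L$ preserves it and is transitive on parts, and $L$-primitive if moreover $L$ acts primitively on the parts. *)

theory Defs
  imports
    "HOL-Algebra.Group_Action"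
    "HOL-Library.Disjoint_Sets"
    "HOL-Combinatorics.Permutations"
begin

text \<open>A simple graph is a pair of a vertex set and a set of two-element sets of vertices.\<close>

type_synonym 'a graph = "'a set \<times> 'a set set"

abbreviation verts :: "'a graph \<Rightarrow> 'a set" where
  "verts \<Gamma> \<equiv> fst \<Gamma>"

abbreviation edges :: "'a graph \<Rightarrow> 'a set set" where
  "edges \<Gamma> \<equiv> snd \<Gamma>"

definition arcs :: "'a graph \<Rightarrow> ('a \<times> 'a) set" where
  "arcs \<Gamma> = {(u, v). u \<in> verts \<Gamma> \<and> v \<in> verts \<Gamma> \<and> u \<noteq> v \<and> {u, v} \<in> edges \<Gamma>}"

text \<open>Automorphisms are extensional functions (\<^const>\<open>undefined\<close> off the vertex set), as in
  \<^const>\<open>BijGroup\<close>; this makes them correspond one-to-one to permutations of the vertex set.\<close>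

definition automorphisms :: "'a graph \<Rightarrow> ('a \<Rightarrow> 'a) set" where
  "automorphisms \<Gamma> = {f \<in> Bij (verts \<Gamma>).
     \<forall>u \<in> verts \<Gamma>. \<forall>v \<in> verts \<Gamma>. {u, v} \<in> edges \<Gamma> \<longleftrightarrow> {f u, f v} \<in> edges \<Gamma>}"

definition aut_group :: "'a graph \<Rightarrow> ('a \<Rightarrow> 'a) monoid" where
  "aut_group \<Gamma> = (BijGroup (verts \<Gamma>))\<lparr>carrier := automorphisms \<Gamma>\<rparr>"

definition aut_subgroup :: "'a graph \<Rightarrow> ('a \<Rightarrow> 'a) set \<Rightarrow> ('a \<Rightarrow> 'a) monoid" where
  "aut_subgroup \<Gamma> L = (aut_group \<Gamma>)\<lparr>carrier := L\<rparr>"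

definition arc_transitive :: "'a graph \<Rightarrow> ('a \<Rightarrow> 'a) set \<Rightarrow> bool" where
  "arc_transitive \<Gamma> L \<longleftrightarrow>
     transitive_action (aut_subgroup \<Gamma> L) (arcs \<Gamma>) (\<lambda>g. \<lambda>a\<in>arcs \<Gamma>. map_prod g g a)"

definition primitive_action :: "('g, 'm) monoid_scheme \<Rightarrow> 'b set \<Rightarrow> ('g \<Rightarrow> 'b \<Rightarrow> 'b) \<Rightarrow> bool" where
  "primitive_action H E \<phi> \<longleftrightarrow> transitive_action H E \<phi> \<and>
     (\<forall>R. partition_on E R \<and> (\<forall>h \<in> carrier H. \<forall>B \<in> R. \<phi> h ` B \<in> R) \<longrightarrow>
          R = {E} \<or> R = (\<lambda>x. {x}) ` E)"

definition decomposition :: "'a graph \<Rightarrow> 'a set set set \<Rightarrow> bool" where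
  "decomposition \<Gamma> \<P> \<longleftrightarrow> partition_on (edges \<Gamma>) \<P> \<and> (\<exists>p \<in> \<P>. \<exists>q \<in> \<P>. p \<noteq> q)"

text \<open>An automorphism \<open>g\<close> sends the edge \<open>e\<close> to \<open>g ` e\<close>, hence the part \<open>p\<close> to \<open>(`) g ` p\<close>.\<close>

definition part_action :: "'a set set set \<Rightarrow> ('a \<Rightarrow> 'a) \<Rightarrow> 'a set set \<Rightarrow> 'a set set" where
  "part_action \<P> g = (\<lambda>p\<in>\<P>. (`) g ` p)"

definition preserves_decomposition :: "('a \<Rightarrow> 'a) set \<Rightarrow> 'a set set set \<Rightarrow> bool" where
  "preserves_decomposition L \<P> \<longleftrightarrow> (\<forall>g \<in> L. \<forall>p \<in> \<P>. part_action \<P> g p \<in> \<P>)"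

definition transitive_decomposition ::
    "'a graph \<Rightarrow> ('a \<Rightarrow> 'a) set \<Rightarrow> 'a set set set \<Rightarrow> bool" where
  "transitive_decomposition \<Gamma> L \<P> \<longleftrightarrow> decomposition \<Gamma> \<P> \<and> preserves_decomposition L \<P> \<and>
     transitive_action (aut_subgroup \<Gamma> L) \<P> (part_action \<P>)"

definition primitive_decomposition ::
    "'a graph \<Rightarrow> ('a \<Rightarrow> 'a) set \<Rightarrow> 'a set set set \<Rightarrow> bool" where
  "primitive_decomposition \<Gamma> L \<P> \<longleftrightarrow> transitive_decomposition \<Gamma> L \<P> \<and>
     primitive_action (aut_subgroup \<Gamma> L) \<P> (part_action \<P>)"

definition johnson_verts :: "nat \<Rightarrow> nat \<Rightarrow> nat set set" where
  "johnson_verts n k = {A. A \<subseteq> {1..n} \<and> card A = k}"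

text \<open>Writing \<open>Suc (card (A \<inter> B)) = k\<close> avoids truncated subtraction and forces \<open>A \<noteq> B\<close>.\<close>

definition johnson :: "nat \<Rightarrow> nat \<Rightarrow> nat set graph" where
  "johnson n k = (johnson_verts n k,
     {{A, B} | A B. A \<in> johnson_verts n k \<and> B \<in> johnson_verts n k \<and> Suc (card (A \<inter> B)) = k})"

text \<open>The symmetric group of degree \<open>n\<close>, identified with the permutations that it induces on the
  vertices, so that it can be intersected with subgroups of \<^const>\<open>aut_group\<close>.\<close>

definition johnson_sym :: "nat \<Rightarrow> nat \<Rightarrow> (nat set \<Rightarrow> nat set) set" where
  "johnson_sym n k = {\<lambda>A\<in>johnson_verts n k. \<sigma> ` A | \<sigma>. \<sigma> permutes {1..n}}"

end

theory Submission
  imports Defs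
begin

text \<open>
  Put \<open>X = {1..2k}\<close>. An arc of \<open>J(2k,k)\<close> is a triple of a \<open>(k-1)\<close>-set \<open>C\<close> and two points \<open>a \<noteq> b\<close>
  outside \<open>C\<close>. If a permutation group on \<open>X\<close> is transitive on these triples, the Livingstone-Wagner
  argument gives transitivity on the triples with smaller sets \<open>C\<close> as well. If moreover all its
  nonidentity elements moved more than \<open>k\<close> points, the pointwise stabilizer of a largest set \<open>J\<close>
  fixed by a nonidentity element would be regular on \<open>X - J\<close>, and involutions transposing two
  points of \<open>J\<close> would act on it with at most two fixed points; this is impossible. So some nonidentity
  element moves at most \<open>k\<close> points, a commutator of two conjugates of it is a 3-cycle, and the
  group contains the alternating group.

  Now \<open>G \<inter> S\<^bsub>2k\<^esub>\<close> has index at most 2 in \<open>G\<close>. If \<open>\<tau>\<close> lies in \<open>G\<close>, its orbits on the parts form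
  a \<open>G\<close>-invariant partition, so \<open>\<tau>\<close> acts trivially on the parts or there are just two parts. Otherwise
  \<open>G\<close> consists of the even permutations and of the products of \<open>\<tau>\<close> with odd ones, so that \<open>S\<^bsub>2k\<^esub>\<close>
  acts primitively on the parts. The stabilizer of a part contains the stabilizer of an edge
  \<open>{C \<union> {a}, C \<union> {b}}\<close>, and for such a maximal subgroup \<open>M\<close> of \<open>S\<^bsub>2k\<^esub>\<close> the group
  \<open>M \<inter> A\<^bsub>2k\<^esub>\<close> is maximal in \<open>A\<^bsub>2k\<^esub>\<close>: for \<open>k \<ge> 4\<close> the group \<open>M\<close> contains 3-cycles and is the
  stabilizer of \<open>{a, b}\<close>, while for \<open>k = 3\<close> it is this stabilizer, or that of a partition of \<open>X\<close>
  into three pairs, or transitive on pairs. For \<open>k = 2\<close> the case does not occur, because \<open>A\<^sub>4\<close> is not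
  arc-transitive on \<open>J(4,2)\<close>.
\<close>

text \<open>The obstacle is that primitivity of an action of a symmetric group need not pass to the
  alternating group: a maximal subgroup \<open>M\<close> of Sym(X) may meet Alt(X) in a subgroup
  that is not maximal there. What a part stabilizer contains therefore has to be used. In the
  twisted case an odd permutation acts on parts only together with complementation. Put D = X - C -
  {a, b} for an edge with ends C + a and C + b. An even permutation fixes this edge if it preserves
  C, D and {a, b}; an odd one does so if it preserves {a, b} and exchanges C with D, because the
  complement of D + a is C + b. These two conditions are all that the group-theoretic part knows
  about the graph.

  The bound \<open>k\<close> on the number of moved points comes from card X = 2k: a
  \<open>k\<close>-set containing the support then has an image that meets it in a single point, and
  the commutator needs exactly this. Below the bound, an element with the most fixed points fixes
  fewer than \<open>k\<close> of them, so that transitivity on flags applies to its set of fixed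
  points.\<close>

abbreviation inv' :: "('a \<Rightarrow> 'b) \<Rightarrow> 'b \<Rightarrow> 'a" where
  "inv' f \<equiv> Hilbert_Choice.inv f"

section \<open>Homogeneity\<close>

text \<open>Subgroups of Sym(X) are plain sets of total functions that fix every point off
  \<open>X\<close>. Conjugates and commutators are then ordinary compositions, and the records of
  HOL-Algebra enter only with the decompositions.\<close>

definition perm_group :: "'a set \<Rightarrow> ('a \<Rightarrow> 'a) set \<Rightarrow> bool" where
  "perm_group X K \<longleftrightarrow> (\<forall>g\<in>K. g permutes X) \<and> id \<in> K \<and>
     (\<forall>g\<in>K. \<forall>h\<in>K. g \<circ> h \<in> K) \<and> (\<forall>g\<in>K. inv' g \<in> K)"

lemma perm_groupD:
  assumes "perm_group X K"
  shows "g \<in> K \<Longrightarrow> g permutes X" "id \<in> K" "g \<in> K \<Longrightarrow> h \<in> K \<Longrightarrow> g \<circ> h \<in> K"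
    "g \<in> K \<Longrightarrow> inv' g \<in> K"
  using assms unfolding perm_group_def by blast+

lemma perm_groupI:
  assumes "\<And>g. g \<in> K \<Longrightarrow> g permutes X" "id \<in> K"
    "\<And>g h. g \<in> K \<Longrightarrow> h \<in> K \<Longrightarrow> g \<circ> h \<in> K" "\<And>g. g \<in> K \<Longrightarrow> inv' g \<in> K"
  shows "perm_group X K"
  using assms unfolding perm_group_def by blast

lemma perm_group_conj:
  assumes "perm_group X K" "g \<in> K" "h \<in> K"
  shows "h \<circ> g \<circ> inv' h \<in> K"
  using assms perm_groupD by metis

lemma perm_group_stab:
  assumes "perm_group X K"
    and "F id" "\<And>g h. g \<in> K \<Longrightarrow> h \<in> K \<Longrightarrow> F g \<Longrightarrow> F h \<Longrightarrow> F (g \<circ> h)"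
    and "\<And>g. g \<in> K \<Longrightarrow> F g \<Longrightarrow> F (inv' g)"
  shows "perm_group X {g \<in> K. F g}"
  using assms perm_groupD[OF assms(1)] by (intro perm_groupI) auto

lemma sum_alternating_Pow:
  assumes "finite A"
  shows "(\<Sum>R\<in>Pow A. (-1) ^ card R) = (if A = {} then 1 else (0 :: int))"
  using assms
proof (induction A)
  case empty
  then show ?case by simp
next
  case (insert x A)
  have inj: "inj_on (insert x) (Pow A)"
    using insert.hyps by (intro inj_onI) (metis Diff_insert_absorb PowD subsetD)
  have "(\<Sum>R\<in>insert x ` Pow A. (-1) ^ card R) = (\<Sum>R\<in>Pow A. (-1) ^ card (insert x R) :: int)"
    by (simp add: sum.reindex[OF inj])
  also have "\<dots> = (\<Sum>R\<in>Pow A. - ((-1) ^ card R))"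
  proof (rule sum.cong[OF refl])
    fix R assume "R \<in> Pow A"
    then have "finite R" "x \<notin> R" using insert.hyps finite_subset by auto
    then show "(-1) ^ card (insert x R) = (- ((-1) ^ card R) :: int)" by simp
  qed
  also have "\<dots> = - (\<Sum>R\<in>Pow A. (-1) ^ card R)" by (simp add: sum_negf)
  finally have "(\<Sum>R\<in>insert x ` Pow A. (-1) ^ card R) = - (\<Sum>R\<in>Pow A. (-1) ^ card R :: int)" .
  moreover have "Pow A \<inter> insert x ` Pow A = {}" using insert.hyps by auto
  ultimately show ?case
    using insert.hyps by (simp add: Pow_insert sum.union_disjoint)
qed

text \<open>By inclusion-exclusion over the subsets \<open>R\<close> of an \<open>s\<close>-set \<open>S\<close>, membership of \<open>S\<close> in \<open>\<O>\<close> is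
  an alternating sum of the numbers of members of \<open>\<O>\<close> inside \<open>Y - R\<close>, and these depend on \<open>card R\<close>
  only.\<close>

lemma uniform_family_trivial:
  fixes Y :: "'a set"
  assumes Y: "finite Y" and \<O>: "\<O> \<subseteq> {S. S \<subseteq> Y \<and> card S = s}"
    and const: "\<And>T. T \<subseteq> Y \<Longrightarrow> card T = k \<Longrightarrow> card {S \<in> \<O>. S \<subseteq> T} = c"
    and sk: "s \<le> k" "s + k \<le> card Y"
    and S: "S0 \<in> \<O>" "S1 \<subseteq> Y" "card S1 = s"
  shows "S1 \<in> \<O>"
proof -
  have finO: "finite \<O>" using Y \<O> by (auto intro: finite_subset[of _ "Pow Y"])
  define cnt where "cnt U = card {S \<in> \<O>. S \<subseteq> U}" for U
  \<comment> \<open>Double counting of the pairs of a member \<open>S\<close> of \<open>\<O>\<close>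
    and a \<open>k\<close>-set \<open>T\<close> with \<open>S\<close> inside \<open>T\<close> inside
    \<open>U\<close>.\<close>
  have cnt: "cnt U * ((card U - s) choose (k - s)) = (card U choose k) * c"
    if U: "U \<subseteq> Y" "k \<le> card U" for U
  proof -
    have finU: "finite U" using U Y finite_subset by auto
    let ?T = "{T. T \<subseteq> U \<and> card T = k}"
    have finT: "finite ?T" using finU by auto
    have "(card U choose k) * c = (\<Sum>T\<in>?T. card {S \<in> \<O>. S \<subseteq> T})"
    proof -
      have "(\<Sum>T\<in>?T. card {S \<in> \<O>. S \<subseteq> T}) = (\<Sum>T\<in>?T. c)"
        using U by (intro sum.cong refl const) auto
      then show ?thesis using n_subsets[OF finU] by simp
    qed
    also have "\<dots> = (\<Sum>S\<in>{S\<in>\<O>. S \<subseteq> U}. card {T \<in> ?T. S \<subseteq> T})"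
    proof -
      have "(\<Sum>T\<in>?T. card {S \<in> \<O>. S \<subseteq> T}) = (\<Sum>T\<in>?T. card {S \<in> {S\<in>\<O>. S \<subseteq> U}. S \<subseteq> T})"
        by (intro sum.cong refl arg_cong[where f = card]) auto
      also have "\<dots> = (\<Sum>S\<in>{S\<in>\<O>. S \<subseteq> U}. card {T \<in> ?T. S \<subseteq> T})"
        using sum.swap_restrict[of "?T" "{S\<in>\<O>. S \<subseteq> U}" "\<lambda>_ _. 1::nat" "\<lambda>T S. S \<subseteq> T"] finT finO
        by simp
      finally show ?thesis .
    qed
    also have "\<dots> = (\<Sum>S\<in>{S\<in>\<O>. S \<subseteq> U}. (card U - s) choose (k - s))"
    proof (rule sum.cong[OF refl])
      fix S assume "S \<in> {S\<in>\<O>. S \<subseteq> U}"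
      then have S: "S \<subseteq> U" "card S = s" using \<O> by auto
      have finS: "finite S" using S finU finite_subset by auto
      have "bij_betw (\<lambda>B. B \<union> S) {B. B \<subseteq> U - S \<and> card B = k - s} {T \<in> ?T. S \<subseteq> T}"
      proof (rule bij_betw_byWitness[where f' = "\<lambda>T. T - S"])
        show "(\<lambda>B. B \<union> S) ` {B. B \<subseteq> U - S \<and> card B = k - s} \<subseteq> {T \<in> ?T. S \<subseteq> T}"
        proof safe
          fix B assume B: "B \<subseteq> U - S" "card B = k - s"
          have "card (B \<union> S) = card B + card S"
            using B finS finU finite_subset by (intro card_Un_disjoint) auto
          then show "card (B \<union> S) = k" using B S sk by simp
        qed (use S in auto)
        show "(\<lambda>T. T - S) ` {T \<in> ?T. S \<subseteq> T} \<subseteq> {B. B \<subseteq> U - S \<and> card B = k - s}"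
        proof safe
          fix T assume "S \<subseteq> T" "k = card T"
          then show "card (T - S) = card T - s" using S finS by (simp add: card_Diff_subset)
        qed blast
        show "\<forall>B\<in>{B. B \<subseteq> U - S \<and> card B = k - s}. (B \<union> S) - S = B" by blast
        show "\<forall>T\<in>{T \<in> ?T. S \<subseteq> T}. (T - S) \<union> S = T" by blast
      qed
      then have "card {T \<in> ?T. S \<subseteq> T} = card (U - S) choose (k - s)"
        using bij_betw_same_card n_subsets[of "U - S" "k - s"] finU by fastforce
      then show "card {T \<in> ?T. S \<subseteq> T} = (card U - s) choose (k - s)"
        using S finS by (simp add: card_Diff_subset)
    qed
    also have "\<dots> = cnt U * ((card U - s) choose (k - s))" by (simp add: cnt_def)
    finally show ?thesis by simp
  qed
  \<comment> \<open>After the sums are exchanged, each \<open>U\<close> in \<open>\<O>\<close>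
    contributes the alternating sum over the subsets of \<open>S - U\<close>. It vanishes unless
    \<open>S - U\<close> is empty, and then \<open>U = S\<close> because both have \<open>s\<close>
    elements.\<close>
  have ind: "(\<Sum>R\<in>Pow S. (-1) ^ card R * int (cnt (Y - R))) = (if S \<in> \<O> then 1 else 0)"
    if S: "S \<subseteq> Y" "card S = s" for S
  proof -
    have finS: "finite S" using S Y finite_subset by auto
    have "(\<Sum>R\<in>Pow S. (-1) ^ card R * int (cnt (Y - R))) =
      (\<Sum>R\<in>Pow S. \<Sum>U\<in>{U \<in> \<O>. U \<inter> R = {}}. (-1) ^ card R)"
    proof (rule sum.cong[OF refl])
      fix R
      have "{U \<in> \<O>. U \<subseteq> Y - R} = {U \<in> \<O>. U \<inter> R = {}}" using \<O> by auto
      then show "(-1) ^ card R * int (cnt (Y - R)) = (\<Sum>U\<in>{U \<in> \<O>. U \<inter> R = {}}. (-1) ^ card R)"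
        by (simp add: cnt_def)
    qed
    also have "\<dots> = (\<Sum>U\<in>\<O>. \<Sum>R\<in>{R \<in> Pow S. U \<inter> R = {}}. (-1) ^ card R)"
      using finS finO by (intro sum.swap_restrict) auto
    also have "\<dots> = (\<Sum>U\<in>\<O>. if S = U then 1 else 0)"
    proof (rule sum.cong[OF refl])
      fix U assume "U \<in> \<O>"
      then have U: "U \<subseteq> Y" "card U = s" using \<O> by auto
      have "{R \<in> Pow S. U \<inter> R = {}} = Pow (S - U)" by auto
      moreover have "S - U = {} \<longleftrightarrow> S = U"
        using S U Y finite_subset by (metis Diff_cancel Diff_eq_empty_iff card_subset_eq)
      ultimately show "(\<Sum>R\<in>{R \<in> Pow S. U \<inter> R = {}}. (-1) ^ card R) = (if S = U then 1 else (0::int))"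
        using sum_alternating_Pow[of "S - U"] finS by simp
    qed
    also have "\<dots> = (if S \<in> \<O> then 1 else 0)" using finO by simp
    finally show ?thesis .
  qed
  have S0: "S0 \<subseteq> Y" "card S0 = s" using S \<O> by auto
  have fin01: "finite S0" "finite S1" using S S0 Y finite_subset by auto
  obtain p where p: "bij_betw p S0 S1"
    using finite_same_card_bij[OF fin01] S S0 by auto
  have "bij_betw ((`) p) (Pow S0) (Pow S1)" using p by (rule bij_betw_Pow)
  then have "(\<Sum>R\<in>Pow S1. (-1) ^ card R * int (cnt (Y - R))) =
     (\<Sum>R\<in>Pow S0. (-1) ^ card (p ` R) * int (cnt (Y - p ` R)))"
    by (subst sum.reindex_bij_betw[symmetric]) auto
  also have "\<dots> = (\<Sum>R\<in>Pow S0. (-1) ^ card R * int (cnt (Y - R)))"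
  proof (rule sum.cong[OF refl])
    fix R assume "R \<in> Pow S0"
    then have R: "R \<subseteq> S0" by simp
    have cR: "card (p ` R) = card R" using p R
      by (meson bij_betw_imp_inj_on card_image inj_on_subset)
    have pR: "p ` R \<subseteq> Y" using p R S by (auto simp: bij_betw_def)
    have "card R \<le> s" using R S0 fin01 card_mono by blast
    moreover have fR: "finite R" using R fin01 finite_subset by auto
    ultimately have c1: "card (Y - R) = card Y - card R" "card (Y - p ` R) = card Y - card R"
      using R S0 pR cR by (auto simp: card_Diff_subset)
    \<comment> \<open>Here \<open>s + k \<le> card Y\<close> enters: \<open>Y - R\<close> still has
      at least \<open>k\<close> points, and the binomial factor is positive and can be
      cancelled.\<close>
    have big: "k \<le> card Y - card R" using \<open>card R \<le> s\<close> sk by simp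
    have "cnt (Y - R) * ((card Y - card R - s) choose (k - s)) =
      cnt (Y - p ` R) * ((card Y - card R - s) choose (k - s))"
      using cnt[of "Y - R"] cnt[of "Y - p ` R"] big c1 by simp
    moreover have "(card Y - card R - s) choose (k - s) > 0" using big by (simp add: zero_less_binomial_iff)
    ultimately have "cnt (Y - R) = cnt (Y - p ` R)" by simp
    then show "(-1) ^ card (p ` R) * int (cnt (Y - p ` R)) = (-1) ^ card R * int (cnt (Y - R))"
      using cR by simp
  qed
  finally show ?thesis using ind[of S0] ind[of S1] S S0 by (auto split: if_splits)
qed

text \<open>Apply \<open>uniform_family_trivial\<close> to the orbit of \<open>S\<close> under
  \<open>K\<close>: since \<open>K\<close> is transitive on \<open>k\<close>-sets, each of them
  contains equally many members of the orbit.\<close>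

lemma homogeneous_descends:
  fixes Y :: "'a set"
  assumes Y: "finite Y"
    and bij: "\<And>g. g \<in> K \<Longrightarrow> bij_betw g Y Y"
    and comp: "\<And>g h. g \<in> K \<Longrightarrow> h \<in> K \<Longrightarrow> g \<circ> h \<in> K"
    and inv: "\<And>g. g \<in> K \<Longrightarrow> \<exists>h\<in>K. \<forall>x\<in>Y. h (g x) = x"
    and hom: "\<And>T T'. T \<subseteq> Y \<Longrightarrow> T' \<subseteq> Y \<Longrightarrow> card T = k \<Longrightarrow> card T' = k \<Longrightarrow> \<exists>g\<in>K. g ` T = T'"
    and sk: "s \<le> k" "s + k \<le> card Y"
    and S: "S \<subseteq> Y" "S' \<subseteq> Y" "card S = s" "card S' = s"
  shows "\<exists>g\<in>K. g ` S = S'"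
proof -
  define \<O> where "\<O> = {g ` S | g. g \<in> K}"
  have cardim: "card (g ` T) = card T" if "g \<in> K" "T \<subseteq> Y" for g T
    using bij[OF that(1)] that(2) by (meson bij_betw_imp_inj_on card_image inj_on_subset)
  have subim: "g ` T \<subseteq> Y" if "g \<in> K" "T \<subseteq> Y" for g T
    using bij[OF that(1)] that(2) by (auto simp: bij_betw_def)
  have \<O>: "\<O> \<subseteq> {S. S \<subseteq> Y \<and> card S = s}"
    using S cardim subim unfolding \<O>_def by blast
  have OK: "g ` U \<in> \<O>" if "g \<in> K" "U \<in> \<O>" for g U
  proof -
    obtain h where h: "h \<in> K" "U = h ` S" using \<open>U \<in> \<O>\<close> unfolding \<O>_def by auto
    then have "g ` U = (g \<circ> h) ` S" by (simp add: image_comp)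
    then show ?thesis using comp[OF that(1) h(1)] unfolding \<O>_def by blast
  qed
  have finO: "finite \<O>" using Y \<O> by (auto intro: finite_subset[of _ "Pow Y"])
  have le: "card {U \<in> \<O>. U \<subseteq> T} \<le> card {U \<in> \<O>. U \<subseteq> T'}"
    if T: "T \<subseteq> Y" "T' \<subseteq> Y" "card T = k" "card T' = k" for T T'
  proof -
    obtain g where g: "g \<in> K" "g ` T = T'" using hom T by blast
    have inj: "inj_on ((`) g) {U \<in> \<O>. U \<subseteq> T}"
    proof -
      have "inj_on ((`) g) (Pow Y)"
        using bij[OF g(1)] by (simp add: bij_betw_imp_inj_on inj_on_image_Pow)
      then show ?thesis by (rule inj_on_subset) (use \<O> in auto)
    qed
    have "(`) g ` {U \<in> \<O>. U \<subseteq> T} \<subseteq> {U \<in> \<O>. U \<subseteq> T'}" using g OK by auto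
    then show ?thesis using inj finO card_inj_on_le[of "(`) g"] by auto
  qed
  obtain T0 where T0: "T0 \<subseteq> Y" "card T0 = k"
    using obtain_subset_with_card_n[of k Y] sk by auto
  have KS: "K \<noteq> {}" using hom[OF T0(1) T0(1) T0(2) T0(2)] by auto
  then obtain g where g: "g \<in> K" by auto
  then obtain h where h: "h \<in> K" "\<forall>x\<in>Y. h (g x) = x" using inv by blast
  then have "(h \<circ> g) ` S = S" using S by force
  then have "S \<in> \<O>" using g h comp unfolding \<O>_def by (metis (mono_tags, lifting) mem_Collect_eq)
  have "card {U \<in> \<O>. U \<subseteq> T} = card {U \<in> \<O>. U \<subseteq> T0}" if "T \<subseteq> Y" "card T = k" for T
    using le[OF that(1) T0(1) that(2) T0(2)] le[OF T0(1) that(1) T0(2) that(2)] by simp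
  then have "S' \<in> \<O>"
    using uniform_family_trivial[OF Y \<O> _ sk \<open>S \<in> \<O>\<close> S(2) S(4)] by blast
  then show ?thesis unfolding \<O>_def by auto
qed

section \<open>Arc-transitive groups contain all 3-cycles\<close>

definition cyc3 :: "'a \<Rightarrow> 'a \<Rightarrow> 'a \<Rightarrow> 'a \<Rightarrow> 'a" where
  "cyc3 x y z = transpose x y \<circ> transpose y z"

lemma perm_group_simps:
  assumes "perm_group X K" "g \<in> K"
  shows "g (inv' g x) = x" "inv' g (g x) = x" "g x = g y \<longleftrightarrow> x = y" "g x \<in> X \<longleftrightarrow> x \<in> X"
    "inv' g x \<in> X \<longleftrightarrow> x \<in> X"
proof -
  have p: "g permutes X" using assms perm_groupD by blast
  show "g (inv' g x) = x" "inv' g (g x) = x" using p by (simp_all add: permutes_inverses)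
  show "g x = g y \<longleftrightarrow> x = y" using p by (metis permutes_inverses(2))
  show "g x \<in> X \<longleftrightarrow> x \<in> X" using p by (rule permutes_in_image)
  show "inv' g x \<in> X \<longleftrightarrow> x \<in> X" using permutes_inv[OF p] by (rule permutes_in_image)
qed

lemma cyc3_conj:
  assumes "bij h"
  shows "h \<circ> cyc3 x y z \<circ> inv' h = cyc3 (h x) (h y) (h z)"
proof
  fix p
  obtain q where "p = h q" using assms by (metis bij_pointE)
  then show "(h \<circ> cyc3 x y z \<circ> inv' h) p = cyc3 (h x) (h y) (h z) p"
    using assms by (simp add: cyc3_def transpose_def bij_is_inj inj_eq)
qed

locale arc_transitive_perms =
  fixes X :: "'a set" and k :: nat and H :: "('a \<Rightarrow> 'a) set"
  assumes finite_X: "finite X" and card_X: "card X = 2 * k" and k_ge_2: "k \<ge> 2"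
    and perm_group_H: "perm_group X H"
    and arc: "\<lbrakk>C \<subseteq> X; C' \<subseteq> X; card C = k - 1; card C' = k - 1; a \<in> X - C; b \<in> X - C; a \<noteq> b;
       a' \<in> X - C'; b' \<in> X - C'; a' \<noteq> b'\<rbrakk> \<Longrightarrow> \<exists>h\<in>H. h ` C = C' \<and> h a = a' \<and> h b = b'"
begin

lemmas H_simps = perm_group_simps[OF perm_group_H]
lemmas H_inv [simp] = H_simps(1,2)
lemmas H_closed = perm_groupD[OF perm_group_H]

lemma H_inj: "h \<in> H \<Longrightarrow> inj h"
  using H_closed(1) permutes_inj by blast

lemma card_image_H: "h \<in> H \<Longrightarrow> card (h ` E) = card E"
  using H_inj by (metis card_image inj_on_subset subset_UNIV)

lemma finite_subset_X: "E \<subseteq> X \<Longrightarrow> finite E"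
  using finite_X finite_subset by blast

text \<open>Arbitrary \<open>(k - 1)\<close>-sets avoiding the points serve to align the points.
  Then the stabilizer of \<open>a'\<close> and \<open>b'\<close> is homogeneous on the
  \<open>(k - 1)\<close>-sets of the other \<open>2 * k - 2\<close> points, and twice
  \<open>k - 1\<close> is just enough for homogeneity to descend to all smaller sizes.\<close>

lemma flag_transitive:
  assumes E: "E \<subseteq> X" "E' \<subseteq> X" "card E = card E'" "card E \<le> k - 1"
    and ab: "a \<in> X - E" "b \<in> X - E" "a \<noteq> b" "a' \<in> X - E'" "b' \<in> X - E'" "a' \<noteq> b'"
  shows "\<exists>h\<in>H. h ` E = E' \<and> h a = a' \<and> h b = b'"
proof -
  have sub: "\<exists>C \<subseteq> X - {x, y}. card C = k - 1" if "x \<in> X" "y \<in> X" "x \<noteq> y" for x y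
  proof -
    have "card (X - {x, y}) = 2 * k - 2" using that finite_X card_X by (simp add: card_Diff_subset)
    then have "k - 1 \<le> card (X - {x, y})" using k_ge_2 by simp
    then obtain C where "C \<subseteq> X - {x, y}" "card C = k - 1" by (rule obtain_subset_with_card_n)
    then show ?thesis by blast
  qed
  obtain C where C: "C \<subseteq> X - {a, b}" "card C = k - 1" using sub[of a b] ab by auto
  obtain C' where C': "C' \<subseteq> X - {a', b'}" "card C' = k - 1" using sub[of a' b'] ab by auto
  obtain h0 where h0: "h0 \<in> H" "h0 a = a'" "h0 b = b'"
    using arc[of C C' a b a' b'] C C' ab by blast
  let ?Y = "X - {a', b'}"
  let ?K = "{h \<in> H. h a' = a' \<and> h b' = b'}"
  have "\<exists>g\<in>?K. g ` (h0 ` E) = E'"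
  proof (rule homogeneous_descends[where Y = ?Y and k = "k - 1" and s = "card E'"])
    show "finite ?Y" using finite_X by simp
    show "bij_betw g ?Y ?Y" if "g \<in> ?K" for g
    proof -
      have g: "g \<in> H" "g a' = a'" "g b' = b'" using that by auto
      have "inj_on g ?Y" using H_inj[OF g(1)] inj_on_subset by blast
      moreover have "g ` ?Y \<subseteq> ?Y"
        using g(2,3) H_simps(4)[OF g(1)] H_simps(3)[OF g(1), of _ a'] H_simps(3)[OF g(1), of _ b']
        by auto
      ultimately show ?thesis using finite_X by (simp add: bij_betw_def endo_inj_surj)
    qed
    show "g \<circ> h \<in> ?K" if "g \<in> ?K" "h \<in> ?K" for g h using that H_closed by auto
    show "\<exists>h\<in>?K. \<forall>x\<in>?Y. h (g x) = x" if "g \<in> ?K" for g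
    proof
      have g: "g \<in> H" "g a' = a'" "g b' = b'" using that by auto
      then show "inv' g \<in> ?K"
        using H_closed(4) H_simps(2)[OF g(1), of a'] H_simps(2)[OF g(1), of b'] by simp
      show "\<forall>x\<in>?Y. inv' g (g x) = x" using g(1) by simp
    qed
    show "\<exists>g\<in>?K. g ` T = T'" if "T \<subseteq> ?Y" "T' \<subseteq> ?Y" "card T = k - 1" "card T' = k - 1" for T T'
    proof -
      have "\<exists>h\<in>H. h ` T = T' \<and> h a' = a' \<and> h b' = b'"
        by (rule arc) (use that ab in auto)
      then show ?thesis by auto
    qed
    show "card E' \<le> k - 1" using E by simp
    show "card E' + (k - 1) \<le> card ?Y" using ab E finite_X card_X by (simp add: card_Diff_subset)
    show "h0 ` E \<subseteq> ?Y"
    proof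
      fix y assume "y \<in> h0 ` E"
      then obtain e where e: "e \<in> E" "y = h0 e" by auto
      then have "h0 e \<noteq> h0 a" "h0 e \<noteq> h0 b" using H_simps(3)[OF h0(1)] ab by auto
      then show "y \<in> ?Y" using e E h0 H_simps(4)[OF h0(1), of e] by auto
    qed
    show "card (h0 ` E) = card E'" using card_image_H[OF h0(1)] E by simp
  qed (use ab E in auto)
  then obtain g where g: "g \<in> ?K" "g ` (h0 ` E) = E'" by blast
  then have "g \<circ> h0 \<in> H \<and> (g \<circ> h0) ` E = E' \<and> (g \<circ> h0) a = a' \<and> (g \<circ> h0) b = b'"
    using h0 H_closed by (auto simp: image_comp)
  then show ?thesis by blast
qed

lemma three_transitive:
  assumes "x \<in> X" "y \<in> X" "z \<in> X" "distinct [x, y, z]"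
    "x' \<in> X" "y' \<in> X" "z' \<in> X" "distinct [x', y', z']"
  shows "\<exists>h\<in>H. h x = x' \<and> h y = y' \<and> h z = z'"
  using flag_transitive[of "{x}" "{x'}" y z y' z'] assms k_ge_2 by auto

end

text \<open>Here \<open>J\<close> is a largest set fixed pointwise by a nonidentity element; the assumption \<open>j < k\<close>
  is to be refuted.\<close>

locale max_fixed_points = arc_transitive_perms +
  fixes j :: nat and g0 :: "'a \<Rightarrow> 'a" and J :: "'a set"
  assumes g0: "g0 \<in> H" and J_def: "J = {x \<in> X. g0 x = x}" and card_J: "card J = j"
    and j_less: "j < k"
    and max_fix: "\<lbrakk>h \<in> H; h \<noteq> id\<rbrakk> \<Longrightarrow> card {x \<in> X. h x = x} \<le> j"
begin

lemma fixes_eq_id: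
  assumes "h \<in> H" "E \<subseteq> X" "\<And>x. x \<in> E \<Longrightarrow> h x = x" "j < card E"
  shows "h = id"
proof (rule ccontr)
  assume "h \<noteq> id"
  then have "card {x \<in> X. h x = x} \<le> j" using max_fix assms by blast
  moreover have "card E \<le> card {x \<in> X. h x = x}" using finite_X assms by (intro card_mono) auto
  ultimately show False using assms by simp
qed

lemma J_sub: "J \<subseteq> X" by (auto simp: J_def)

lemma card_J_le: "card J \<le> k - 1" using card_J j_less by simp

lemma finite_J: "finite J" using J_sub by (rule finite_subset_X)

lemma exists_outside: "card E < 2 * k \<Longrightarrow> finite E \<Longrightarrow> \<exists>x. x \<in> X - E"
  using finite_X card_X by (metis card_mono ex_in_conv Diff_eq_empty_iff not_less)

text \<open>The element is a conjugate of \<open>g0\<close>: flags being transitive,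
  \<open>J\<close> together with a point \<open>p\<close> moved by \<open>g0\<close> and its image
  can be carried to \<open>E\<close>, \<open>x\<close> and \<open>y\<close>.\<close>

lemma pointwise_stabilizer_transitive:
  assumes E: "E \<subseteq> X" "card E = j" and xy: "x \<in> X - E" "y \<in> X - E"
  shows "\<exists>l\<in>H. (\<forall>e\<in>E. l e = e) \<and> l x = y"
proof (cases "x = y")
  case True
  then show ?thesis using H_closed(2) by (intro bexI[of _ id]) auto
next
  case False
  obtain p where p: "p \<in> X - J" using exists_outside[of J] card_J j_less finite_J by auto
  have q: "g0 p \<in> X - J" "g0 p \<noteq> p"
    using p H_simps(3,4)[OF g0] by (auto simp: J_def)
  obtain h where h: "h \<in> H" "h ` J = E" "h p = x" "h (g0 p) = y"
    using flag_transitive[of J E p "g0 p" x y] J_sub E card_J j_less xy p q False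
    by (metis Diff_iff Suc_diff_1 bot_nat_0.not_eq_extremum less_Suc_eq_le less_nat_zero_code)
  let ?l = "h \<circ> g0 \<circ> inv' h"
  have "?l \<in> H" using perm_group_conj[OF perm_group_H g0 h(1)] .
  moreover have "?l e = e" if e: "e \<in> E" for e
  proof -
    obtain c where "c \<in> J" "e = h c" using e h(2) by auto
    then show ?thesis using h(1) by (simp add: J_def)
  qed
  moreover have "?l x = y" using h by auto
  ultimately show ?thesis by blast
qed

text \<open>Two elements fixing \<open>j\<close> points each are composed. The first fixes
  \<open>E\<close> and an auxiliary \<open>z\<close> and takes \<open>u\<close> to \<open>v\<close>;
  the second fixes \<open>E\<close> and \<open>v\<close> and brings the image of \<open>v\<close>
  back to \<open>u\<close>.\<close>

lemma transposing_element:
  assumes E: "E \<subseteq> X" "Suc (card E) = j" and uv: "u \<in> X - E" "v \<in> X - E" "u \<noteq> v"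
  shows "\<exists>s\<in>H. (\<forall>e\<in>E. s e = e) \<and> s u = v \<and> s v = u"
proof -
  have finE: "finite E" using E finite_subset_X by auto
  have "card (E \<union> {u, v}) = Suc j" using E uv finE by simp
  then obtain z where z: "z \<in> X" "z \<notin> E" "z \<noteq> u" "z \<noteq> v"
    using exists_outside[of "E \<union> {u, v}"] finE j_less k_ge_2 by auto
  obtain s1 where s1: "s1 \<in> H" "\<forall>e\<in>insert z E. s1 e = e" "s1 u = v"
    using pointwise_stabilizer_transitive[of "insert z E" u v] z E uv finE by auto
  have w: "s1 v \<in> X - insert v E"
  proof -
    have "s1 v \<noteq> v" using s1 uv H_simps(3)[OF s1(1), of u v] by simp
    moreover have "s1 v \<notin> E" using s1 uv H_simps(3)[OF s1(1), of "s1 v" v] by auto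
    ultimately show ?thesis using H_simps(4)[OF s1(1), of v] uv by simp
  qed
  obtain s2 where s2: "s2 \<in> H" "\<forall>e\<in>insert v E. s2 e = e" "s2 (s1 v) = u"
    using pointwise_stabilizer_transitive[of "insert v E" "s1 v" u] w E uv finE by auto
  have "s2 \<circ> s1 \<in> H" using s1 s2 H_closed by blast
  moreover have "\<forall>e\<in>E. (s2 \<circ> s1) e = e" "(s2 \<circ> s1) u = v" "(s2 \<circ> s1) v = u"
    using s1 s2 by auto
  ultimately show ?thesis by blast
qed

definition "L = {l \<in> H. \<forall>e\<in>J. l e = e}"

lemma L_H: "l \<in> L \<Longrightarrow> l \<in> H" by (simp add: L_def)

lemma perm_group_L: "perm_group X L"
proof -
  have "inv' l e = e" if "l \<in> H" "l e = e" for l e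
    using H_simps(2)[OF that(1), of e] that(2) by simp
  then show ?thesis
    unfolding L_def by (intro perm_group_stab[OF perm_group_H]) auto
qed

lemmas L_closed = perm_groupD[OF perm_group_L]

lemma finite_L: "finite L"
  by (rule finite_subset[OF _ finite_permutations[OF finite_X]]) (use L_closed(1) in auto)

lemma L_transitive: "x \<in> X - J \<Longrightarrow> y \<in> X - J \<Longrightarrow> \<exists>l\<in>L. l x = y"
  using pointwise_stabilizer_transitive[OF J_sub card_J] unfolding L_def by blast

lemma L_outside:
  assumes "l \<in> L" "x \<in> X - J"
  shows "l x \<in> X - J"
  using assms(2) H_simps(3)[OF L_H[OF assms(1)], of "l x" x] H_simps(4)[OF L_H[OF assms(1)]] assms(1)
  by (auto simp: L_def)

text \<open>Agreement on \<open>J\<close> and at one more point is agreement on \<open>j + 1\<close>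
  points. With \<open>L_transitive\<close> this makes \<open>L\<close> regular on
  \<open>X - J\<close>.\<close>

lemma L_eqI:
  assumes "l \<in> L" "m \<in> L" "x \<in> X - J" "l x = m x"
  shows "l = m"
proof -
  have "inv' m \<circ> l = id"
  proof (rule fixes_eq_id)
    show "inv' m \<circ> l \<in> H" by (rule L_H[OF L_closed(3)[OF L_closed(4)[OF assms(2)] assms(1)]])
    show "insert x J \<subseteq> X" using assms J_sub by auto
    show "(inv' m \<circ> l) y = y" if "y \<in> insert x J" for y
      using that assms L_closed(4)[OF assms(2)] by (auto simp: L_def)
    show "j < card (insert x J)" using assms finite_J card_J by simp
  qed
  then have "inv' m (l y) = y" for y by (simp add: fun_eq_iff)
  then have "l y = m y" for y using H_simps(1)[OF L_H[OF assms(2)], of "l y"] by simp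
  then show ?thesis by blast
qed

lemma L_id: "l \<in> L \<Longrightarrow> x \<in> X - J \<Longrightarrow> l x = x \<Longrightarrow> l = id"
  using L_eqI[of l id x] L_closed(2) by simp

lemma L_normal:
  assumes "l \<in> L" "h \<in> H" "h ` J = J"
  shows "h \<circ> l \<circ> inv' h \<in> L"
proof -
  have "(h \<circ> l \<circ> inv' h) e = e" if e: "e \<in> J" for e
  proof -
    obtain c where "c \<in> J" "e = h c" using e assms(3) imageE[of e h J] by auto
    then show ?thesis using assms by (simp add: L_def)
  qed
  then show ?thesis using assms perm_group_conj[OF perm_group_H L_H] by (simp add: L_def)
qed

lemma L_normal_involution:
  assumes "l \<in> L" "s \<in> H" "s ` J = J" "s \<circ> s = id"
  shows "s \<circ> l \<circ> s \<in> L"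
  using L_normal[OF assms(1-3)] inv_unique_comp[OF assms(4,4)] by simp

text \<open>The map \<open>m \<mapsto> m\<^sup>-\<^sup>1 s m s\<close> on \<open>L\<close> is injective, hence onto, and \<open>s\<close> inverts its values.\<close>

lemma involution_inverts:
  assumes s: "s \<in> H" "s ` J = J" "s \<circ> s = id" and x: "x \<in> X - J" "s x = x"
    and only: "\<And>y. y \<in> X - J \<Longrightarrow> s y = y \<Longrightarrow> y = x"
    and l: "l \<in> L"
  shows "s \<circ> l \<circ> s = inv' l"
proof -
  have ss: "s (s y) = y" for y using s(3) by (metis comp_apply id_apply)
  define \<phi> where "\<phi> m = inv' m \<circ> (s \<circ> m \<circ> s)" for m
  have L1: "\<phi> m \<in> L" if "m \<in> L" for m
    unfolding \<phi>_def by (rule L_closed(3)[OF L_closed(4)[OF that] L_normal_involution[OF that s]])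
  have "inj_on \<phi> L"
  proof (rule inj_onI)
    fix m n assume m: "m \<in> L" and n: "n \<in> L" and eq: "\<phi> m = \<phi> n"
    have mH: "m \<in> H" and nH: "n \<in> H" using L_H m n by auto
    let ?d = "n \<circ> inv' m"
    have d: "?d \<in> L" by (rule L_closed(3)[OF n L_closed(4)[OF m]])
    \<comment> \<open>Equality of \<open>\<phi> m\<close> and \<open>\<phi> n\<close> means that
      \<open>?d\<close> commutes with \<open>s\<close>. So \<open>s\<close> fixes
      \<open>?d x\<close>, and \<open>x\<close> is its only fixed point outside
      \<open>J\<close>.\<close>
    have "s (n (inv' m x)) = n (inv' m x)"
    proof -
      have "\<phi> m (s (inv' m (s (s x)))) = \<phi> n (s (inv' m (s (s x))))" using eq by simp
      then have "inv' m x = inv' n (s (n (inv' m x)))"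
        using mH nH by (simp add: \<phi>_def ss x(2))
      then show ?thesis using H_simps(1)[OF nH, of "s (n (inv' m x))"] by simp
    qed
    then have "?d x = x" using only[of "?d x"] L_outside[OF d x(1)] by simp
    then have "n (inv' m x) = m (inv' m x)" using mH by simp
    moreover have "inv' m x \<in> X - J" using L_outside[OF L_closed(4)[OF m] x(1)] .
    ultimately show "m = n" using L_eqI[OF m n] by metis
  qed
  then have "\<phi> ` L = L" using finite_L L1 by (simp add: endo_inj_surj image_subsetI)
  then obtain m where m: "m \<in> L" "l = \<phi> m" using l by auto
  have mH: "m \<in> H" using L_H m by auto
  have sls: "(s \<circ> l \<circ> s) \<circ> l = id"
    using mH by (intro ext) (simp add: m(2) \<phi>_def ss)
  have "l \<circ> (s \<circ> l \<circ> s) = id"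
  proof
    fix y
    let ?f = "s \<circ> l \<circ> s"
    have f: "?f \<in> H" using L_H L_normal_involution[OF l s] by blast
    have "?f (l (?f y)) = ?f y" using fun_cong[OF sls, of "?f y"] by simp
    then show "(l \<circ> ?f) y = id y" using H_simps(3)[OF f, of "l (?f y)" y] by simp
  qed
  then show ?thesis using sls inv_unique_comp[of l "s \<circ> l \<circ> s"] by simp
qed

lemma card_outside_le_L:
  assumes "x \<in> X - J"
  shows "card (X - J) \<le> card L"
proof -
  have "X - J \<subseteq> (\<lambda>m. m x) ` L" using L_transitive[OF assms] by force
  then show ?thesis using finite_L by (meson card_image_le card_mono finite_imageI le_trans)
qed

text \<open>The centralizer of \<open>s\<close> in \<open>L\<close> is \<open>{id, l}\<close>, where \<open>l\<close> is an involution. As all nonidentity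
  elements of \<open>L\<close> are conjugate to \<open>l\<close>, the group \<open>L\<close> is elementary abelian, and \<open>m \<mapsto> m s m s\<close>
  maps it to that centralizer with fibres of size at most 2.\<close>

lemma involution_two_fixed_points:
  assumes s: "s \<in> H" "s ` J = J" "s \<circ> s = id" and x: "x \<in> X - J" "s x = x"
    and y: "y \<in> X - J" "s y = y" "y \<noteq> x"
    and only: "\<And>z. z \<in> X - J \<Longrightarrow> s z = z \<Longrightarrow> z = x \<or> z = y"
  shows "card (X - J) \<le> 4"
proof -
  have ss: "s (s z) = z" for z using s(3) by (simp add: fun_eq_iff)
  have conj: "s \<circ> m \<circ> s \<in> L" if "m \<in> L" for m by (rule L_normal_involution[OF that s])
  obtain l where l: "l \<in> L" "l x = y" using L_transitive x y by blast
  \<comment> \<open>By regularity \<open>m\<close> is determined by \<open>m x\<close>, which is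
    here one of the two fixed points of \<open>s\<close>.\<close>
  have dich: "m = id \<or> m = l" if m: "m \<in> L" "s (m x) = m x" for m
  proof -
    have "m x = x \<or> m x = y" using only L_outside[OF m(1) x(1)] m(2) by blast
    then show ?thesis using L_id[OF m(1) x(1)] L_eqI[OF m(1) l(1) x(1)] l(2) by auto
  qed
  have "s \<circ> l \<circ> s = l"
    by (rule L_eqI[OF conj[OF l(1)] l(1) x(1)]) (use x y l in simp)
  then have sl: "s (l (s z)) = l z" for z by (simp add: fun_eq_iff)
  have sl': "s (l z) = l (s z)" for z using sl[of "s z"] ss by simp
  have lx: "l (l x) \<noteq> l x" using H_simps(3)[OF L_H[OF l(1)], of "l x" x] l(2) y(3) by simp
  have "l \<circ> l = id"
    using dich[OF L_closed(3)[OF l(1) l(1)]] sl' x(2) lx by (auto simp: fun_eq_iff)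
  then have ll: "l (l z) = z" for z by (simp add: fun_eq_iff)
  have invol: "m (m z) = z" if m: "m \<in> L" for m z
  proof (cases "m x = x")
    case True
    then show ?thesis using L_id[OF m x(1)] by simp
  next
    case False
    \<comment> \<open>As \<open>l\<close> takes \<open>x\<close> to \<open>y\<close>, its conjugate
      by \<open>h\<close> takes \<open>x\<close> to \<open>m x\<close>, and by regularity this
      conjugate is \<open>m\<close>.\<close>
    obtain h where h: "h \<in> H" "h ` J = J" "h x = x" "h y = m x"
      using flag_transitive[of J J x y x "m x"] J_sub card_J_le x y L_outside[OF m x(1)] False
      by auto
    have "h \<circ> l \<circ> inv' h = m"
      using H_simps(2)[OF h(1), of x] h l
      by (intro L_eqI[OF L_normal[OF l(1) h(1,2)] m x(1)]) simp
    then have "m = h \<circ> l \<circ> inv' h" by simp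
    then show ?thesis using h(1) ll by simp
  qed
  have comm: "m (n z) = n (m z)" if m: "m \<in> L" and n: "n \<in> L" for m n z
  proof -
    have "m (n (m (n z))) = z" using invol[OF L_closed(3)[OF m n]] by simp
    then have "n (m (n z)) = m z" using invol[OF m] by metis
    then show ?thesis using invol[OF n] by metis
  qed
  \<comment> \<open>The product of \<open>m\<close> with its conjugate by \<open>s\<close> commutes
    with \<open>s\<close>, so it is \<open>id\<close> or \<open>l\<close>. It is not
    \<open>id\<close>, since \<open>m\<close> does not commute with \<open>s\<close>.\<close>
  have ml: "s (m (s z)) = m (l z)" if m: "m \<in> L" "m \<noteq> id" "m \<noteq> l" for m z
  proof -
    let ?c = "m \<circ> (s \<circ> m \<circ> s)"
    have c: "?c \<in> L" by (rule L_closed(3)[OF m(1) conj[OF m(1)]])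
    have "s (m (s (m x))) = m (s (m (s x)))"
      using comm[OF conj[OF m(1)] m(1), of x] by simp
    then have "?c = id \<or> ?c = l" using dich[OF c] x(2) by simp
    moreover have "?c \<noteq> id"
    proof
      assume "?c = id"
      then have "m (s (m x)) = x" using x(2) by (metis comp_apply id_apply)
      then have "s (m x) = m x" using invol[OF m(1)] by metis
      then show False using dich[OF m(1)] m by blast
    qed
    ultimately have "m (s (m (s z))) = l z" by (metis comp_apply)
    then show ?thesis using invol[OF m(1)] by metis
  qed
  \<comment> \<open>Conjugation by \<open>s\<close> multiplies both \<open>m\<close> and
    \<open>n\<close> by \<open>l\<close>, so it fixes \<open>m \<circ> n\<close>, which is therefore
    \<open>id\<close> or \<open>l\<close>.\<close>
  have pair: "m = n \<or> m = l \<circ> n"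
    if m: "m \<in> L" "m \<noteq> id" "m \<noteq> l" and n: "n \<in> L" "n \<noteq> id" "n \<noteq> l" for m n
  proof -
    have "s (m (n x)) = s (m (s (s (n (s x)))))" using ss x(2) by simp
    also have "\<dots> = m (l (n (l x)))" using ml[OF m] ml[OF n] by simp
    also have "\<dots> = m (n x)" using comm[OF l(1) n(1)] ll by simp
    finally have "m \<circ> n = id \<or> m \<circ> n = l" using dich[OF L_closed(3)[OF m(1) n(1)]] by simp
    then show ?thesis
    proof
      assume "m \<circ> n = id"
      then have "m z = n z" for z using invol[OF n(1), of z] by (metis comp_apply id_apply)
      then show ?thesis by blast
    next
      assume "m \<circ> n = l"
      then have "m z = l (n z)" for z using invol[OF n(1), of z] by (metis comp_apply)
      then show ?thesis by auto
    qed
  qed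
  have "\<exists>n. L \<subseteq> {id, l, n, l \<circ> n}"
  proof (cases "L \<subseteq> {id, l}")
    case True
    then show ?thesis by auto
  next
    case False
    then obtain n where "n \<in> L" "n \<noteq> id" "n \<noteq> l" by auto
    then show ?thesis using pair by blast
  qed
  then obtain n where "L \<subseteq> {id, l, n, l \<circ> n}" by blast
  then have "card L \<le> card {id, l, n, l \<circ> n}" by (intro card_mono) auto
  also have "\<dots> \<le> 4" by (simp add: card_insert_if)
  finally show ?thesis using card_outside_le_L[OF x(1)] by simp
qed

lemma card_outside: "card (X - J) = 2 * k - j"
  using J_sub finite_J card_X card_J by (simp add: card_Diff_subset)

text \<open>Let \<open>s\<close> exchange \<open>u\<close> with \<open>v\<close> and
  \<open>t\<close> exchange \<open>u\<close> with \<open>w\<close>, both fixing the rest of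
  \<open>J\<close> and a point \<open>x\<close> outside. Since \<open>card (X - J)\<close> exceeds
  4, \<open>x\<close> is the only fixed point outside \<open>J\<close> of either, and both invert
  \<open>L\<close>. Their product centralizes \<open>L\<close> and fixes \<open>x\<close>, so it
  fixes the orbit \<open>X - J\<close> pointwise. That is more than \<open>j\<close> points, yet the
  product is not the identity.\<close>

lemma j_lt_3: "j < 3"
proof (rule ccontr)
  assume "\<not> j < 3"
  then have j3: "j \<ge> 3" by simp
  have big: "card (X - J) > 4" "card (X - J) > j" using card_outside j3 j_less by simp_all
  obtain T where T: "T \<subseteq> J" "card T = 3" using obtain_subset_with_card_n[of 3 J] j3 card_J by auto
  then obtain u v w where uvw: "u \<in> J" "v \<in> J" "w \<in> J" "distinct [u, v, w]"
    by (auto simp: card_3_iff)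
  obtain x where x: "x \<in> X - J" using exists_outside[of J] card_J j_less finite_J by auto
  have swap: "\<exists>s\<in>H. s ` J = J \<and> s \<circ> s = id \<and> s p = q \<and> (\<forall>e\<in>insert x (J - {p, q}). s e = e) \<and>
      (\<forall>l\<in>L. s \<circ> l \<circ> s = inv' l)"
    if pq: "p \<in> J" "q \<in> J" "p \<noteq> q" for p q
  proof -
    let ?E = "insert x (J - {p, q})"
    have cE: "card (J - {p, q}) = j - 2"
      using pq card_J finite_J by (simp add: card_Diff_subset)
    then have E: "?E \<subseteq> X" "Suc (card ?E) = j" "p \<in> X - ?E" "q \<in> X - ?E"
      using pq x J_sub finite_J j3 by auto
    obtain s where s: "s \<in> H" "\<forall>e\<in>?E. s e = e" "s p = q" "s q = p"
      using transposing_element[OF E pq(3)] by blast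
    have Jim: "s ` J = J"
    proof -
      have "s ` (J - {p, q}) = J - {p, q}" using s(2) by force
      then have "s ` ({p, q} \<union> (J - {p, q})) = {q, p} \<union> (J - {p, q})"
        by (simp only: image_Un image_insert image_empty s(3,4))
      moreover have "{p, q} \<union> (J - {p, q}) = J" "{q, p} \<union> (J - {p, q}) = J" using pq by auto
      ultimately show ?thesis by (simp only:)
    qed
    have inv: "s \<circ> s = id"
    proof (rule fixes_eq_id)
      show "s \<circ> s \<in> H" using s(1) H_closed by blast
      show "insert x J \<subseteq> X" using x J_sub by auto
      show "(s \<circ> s) e = e" if "e \<in> insert x J" for e
        using that s by (cases "e = p"; cases "e = q") auto
      show "j < card (insert x J)" using x finite_J card_J by simp
    qed
    \<comment> \<open>Three fixed points outside \<open>J\<close> and the \<open>j - 2\<close>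
      inside would be \<open>j + 1\<close>, too many for \<open>s\<close>, which is not
      \<open>id\<close>.\<close>
    have two: "y = z" if y: "y \<in> X - J" "s y = y" "y \<noteq> x" and z: "z \<in> X - J" "s z = z" "z \<noteq> x" for y z
    proof (rule ccontr)
      assume "y \<noteq> z"
      have "s = id"
      proof (rule fixes_eq_id[OF s(1)])
        show "{x, y, z} \<union> (J - {p, q}) \<subseteq> X" using x y z J_sub by auto
        show "s e = e" if "e \<in> {x, y, z} \<union> (J - {p, q})" for e using that s(2) y z by auto
        have "card ({x, y, z} \<union> (J - {p, q})) = 3 + (j - 2)"
          using x y z \<open>y \<noteq> z\<close> cE finite_J by (subst card_Un_disjoint) auto
        then show "j < card ({x, y, z} \<union> (J - {p, q}))" by simp
      qed
      then show False using s(3) pq(3) by simp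
    qed
    have "s x = x" using s(2) by simp
    have "y = x" if y: "y \<in> X - J" "s y = y" for y
    proof (rule ccontr)
      assume "y \<noteq> x"
      then have "card (X - J) \<le> 4"
        using involution_two_fixed_points[OF s(1) Jim inv x \<open>s x = x\<close> y] two y by blast
      then show False using big by simp
    qed
    then have "\<forall>l\<in>L. s \<circ> l \<circ> s = inv' l"
      using involution_inverts[OF s(1) Jim inv x \<open>s x = x\<close>] by blast
    then show ?thesis using s Jim inv by blast
  qed
  obtain s where s: "s \<in> H" "s \<circ> s = id" "s u = v" "\<forall>e\<in>insert x (J - {u, v}). s e = e"
    "\<forall>l\<in>L. s \<circ> l \<circ> s = inv' l"
    using swap[of u v] uvw by auto
  obtain t where t: "t \<in> H" "t \<circ> t = id" "t u = w" "\<forall>e\<in>insert x (J - {u, w}). t e = e"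
    "\<forall>l\<in>L. t \<circ> l \<circ> t = inv' l"
    using swap[of u w] uvw by auto
  have "s \<circ> t = id"
  proof (rule fixes_eq_id[where E = "X - J"])
    show "s \<circ> t \<in> H" using s t H_closed by blast
    show "(s \<circ> t) y = y" if y: "y \<in> X - J" for y
    proof -
      obtain l where l: "l \<in> L" "l x = y" using L_transitive x y by blast
      have 1: "s (inv' l (s z)) = l z" for z
      proof -
        have "s \<circ> inv' l \<circ> s = inv' (inv' l)" using s(5) L_closed(4)[OF l(1)] by blast
        then show ?thesis
          using H_closed(1)[OF L_H[OF l(1)]] by (simp add: permutes_inv_inv fun_eq_iff)
      qed
      have 2: "t (l (t z)) = inv' l z" for z using t(5) l(1) by (metis comp_apply)
      have "s x = x" "t x = x" using s(4) t(4) by auto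
      then show ?thesis using 1[of x] 2[of x] l(2) by simp
    qed
  qed (use big in auto)
  then have "s w = u" using t(3) by (auto simp: fun_eq_iff)
  moreover have "s w = w" using s(4) uvw by (metis DiffI distinct_length_2_or_more insertCI insertE singletonD)
  ultimately show False using uvw by simp
qed

text \<open>The stabilizer of the set \<open>J\<close> and of \<open>x\<close> is transitive on the
  remaining points. For \<open>j \<le> 1\<close> it fixes \<open>J\<close> pointwise and is trivial,
  although at least two points remain. For \<open>j = 2\<close> its nonidentity elements exchange
  the points of \<open>J\<close>. Three points remain, so two such elements take \<open>p\<close> to
  different images, while their quotient fixes \<open>J\<close> and \<open>x\<close>.\<close>

lemma no_max_fixed_points: False
proof -
  obtain x where x: "x \<in> X - J" using exists_outside[of J] card_J j_less finite_J by auto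
  have card': "card (X - J - {x}) = 2 * k - j - 1" using card_outside x finite_X by simp
  have mv: "\<exists>h\<in>H. h ` J = J \<and> h x = x \<and> h y = z" if "y \<in> X - J - {x}" "z \<in> X - J - {x}" for y z
    using flag_transitive[of J J x y x z] J_sub card_J_le x that by auto
  have idI: "h = id" if h: "h \<in> H" "\<And>e. e \<in> J \<Longrightarrow> h e = e" "h x = x" for h
  proof (rule fixes_eq_id[OF h(1)])
    show "insert x J \<subseteq> X" using x J_sub by auto
    show "h e = e" if "e \<in> insert x J" for e using that h by auto
    show "j < card (insert x J)" using x finite_J card_J by simp
  qed
  consider "j \<le> 1" | "j = 2" using j_lt_3 by linarith
  then show False
  proof cases
    case 1
    have "2 \<le> card (X - J - {x})" using card' 1 k_ge_2 by simp
    then obtain T where "T \<subseteq> X - J - {x}" "card T = 2" using obtain_subset_with_card_n by metis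
    then obtain y z where yz: "y \<in> X - J - {x}" "z \<in> X - J - {x}" "y \<noteq> z"
      by (auto simp: card_2_iff)
    obtain h where h: "h \<in> H" "h ` J = J" "h x = x" "h y = z" using mv yz by blast
    have "h e = e" if "e \<in> J" for e
    proof -
      have "card J = 1" using 1 card_J that finite_J by (metis One_nat_def card_gt_0_iff empty_iff le_antisym Suc_leI)
      then obtain c where "J = {c}" by (rule card_1_singletonE)
      then show ?thesis using h(2) that by auto
    qed
    then have "h = id" using idI h by blast
    then show False using h(4) yz(3) by simp
  next
    case 2
    then obtain u v where uv: "J = {u, v}" "u \<noteq> v" using card_J by (auto simp: card_2_iff)
    have "3 \<le> card (X - J - {x})" using card' 2 j_less by simp
    then obtain T where "T \<subseteq> X - J - {x}" "card T = 3" using obtain_subset_with_card_n by metis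
    then obtain p q r where pqr: "p \<in> X - J - {x}" "q \<in> X - J - {x}" "r \<in> X - J - {x}"
      "p \<noteq> q" "p \<noteq> r" "q \<noteq> r"
      by (auto simp: card_3_iff)
    have flip: "h u = v \<and> h v = u" if h: "h \<in> H" "h ` J = J" "h x = x" "h \<noteq> id" for h
    proof (rule ccontr)
      assume c: "\<not> ?thesis"
      have "h u \<noteq> h v" using H_simps(3)[OF h(1)] uv by simp
      then have "h u = u" "h v = v" using h(2) c uv by (auto simp: doubleton_eq_iff)
      then show False using idI[OF h(1) _ h(3)] h(4) uv by auto
    qed
    obtain g where g: "g \<in> H" "g ` J = J" "g x = x" "g p = q" using mv pqr by blast
    obtain h where h: "h \<in> H" "h ` J = J" "h x = x" "h p = r" using mv pqr by blast
    have "g \<noteq> id" "h \<noteq> id" using g(4) h(4) pqr by (metis id_apply)+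
    then have gf: "g u = v" "g v = u" and hf: "h u = v" "h v = u"
      using flip[OF g(1-3)] flip[OF h(1-3)] by auto
    have "inv' g \<circ> h = id"
    proof (rule idI)
      show "inv' g \<circ> h \<in> H" using g h H_closed by blast
      show "(inv' g \<circ> h) x = x" using H_simps(2)[OF g(1), of x] g h by simp
      show "(inv' g \<circ> h) e = e" if "e \<in> J" for e
        using H_simps(2)[OF g(1), of u] H_simps(2)[OF g(1), of v] gf hf that uv by auto
    qed
    then have "inv' g (h p) = p" by (simp add: fun_eq_iff)
    then have "h p = g p" using H_simps(1)[OF g(1), of "h p"] by simp
    then show False using g h pqr by simp
  qed
qed

end

section \<open>Elements of small support and 3-cycles\<close>

context arc_transitive_perms
begin

lemma exists_small_support: "\<exists>g\<in>H. g \<noteq> id \<and> card {x \<in> X. g x \<noteq> x} \<le> k"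
proof (rule ccontr)
  assume c: "\<not> ?thesis"
  have small: "card {x \<in> X. h x = x} < k" if "h \<in> H" "h \<noteq> id" for h
  proof -
    have "card X = card {x \<in> X. h x = x} + card {x \<in> X. h x \<noteq> x}"
      using finite_X by (subst card_Un_disjoint[symmetric]) (auto intro!: arg_cong[where f = card])
    then show ?thesis using c that card_X by fastforce
  qed
  obtain T where T: "T \<subseteq> X" "card T = 3" using obtain_subset_with_card_n[of 3 X] card_X k_ge_2 by auto
  then obtain x y z where xyz: "x \<in> X" "y \<in> X" "z \<in> X" "distinct [x, y, z]"
    by (auto simp: card_3_iff)
  then obtain h where "h \<in> H" "h x = y"
    using three_transitive[of x y z y x z] by auto
  then have "h \<in> H \<and> h \<noteq> id" using xyz by auto
  moreover have "\<forall>h. h \<in> H \<and> h \<noteq> id \<longrightarrow> card {x \<in> X. h x = x} < k"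
    using small by simp
  ultimately have "\<exists>g0. (g0 \<in> H \<and> g0 \<noteq> id) \<and>
      (\<forall>h. h \<in> H \<and> h \<noteq> id \<longrightarrow> card {x \<in> X. h x = x} \<le> card {x \<in> X. g0 x = x})"
    by (rule ex_has_greatest_nat[where P = "\<lambda>h. h \<in> H \<and> h \<noteq> id"])
  then obtain g0 where g0: "g0 \<in> H" "g0 \<noteq> id"
    and max: "\<And>h. h \<in> H \<and> h \<noteq> id \<Longrightarrow> card {x \<in> X. h x = x} \<le> card {x \<in> X. g0 x = x}"
    by blast
  interpret max_fixed_points X k H "card {x \<in> X. g0 x = x}" g0 "{x \<in> X. g0 x = x}"
    using g0 max small by unfold_locales auto
  show False by (rule no_max_fixed_points)
qed

text \<open>Take a \<open>k\<close>-set \<open>A\<close> containing the support of \<open>g\<close> and an \<open>h\<close> mapping \<open>A\<close> to a set that meets \<open>A\<close> only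
  in a point \<open>s\<close> moved by \<open>g\<close> and fixed by \<open>h\<close>. The supports of \<open>g\<close> and \<open>h g h\<^sup>-\<^sup>1\<close> share only \<open>s\<close>,
  so the commutator is a 3-cycle.\<close>

lemma exists_three_cycle:
  "\<exists>s u v. s \<in> X \<and> u \<in> X \<and> v \<in> X \<and> distinct [s, u, v] \<and> cyc3 s u v \<in> H"
proof -
  obtain g where g: "g \<in> H" "g \<noteq> id" "card {x \<in> X. g x \<noteq> x} \<le> k"
    using exists_small_support by blast
  let ?S = "{x \<in> X. g x \<noteq> x}"
  have gout: "g x = x" if "x \<notin> ?S" for x
    using that permutes_not_in[OF H_closed(1)[OF g(1)]] by blast
  obtain s where s: "s \<in> ?S" using g(2) gout by (metis ext id_apply)
  obtain A where A: "?S \<subseteq> A" "A \<subseteq> X" "card A = k"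
    using exists_subset_between[of ?S k X] g(3) card_X finite_X by auto
  have cAc: "card (X - A) = k"
    using A card_X finite_subset_X by (simp add: card_Diff_subset)
  then have "X - A \<noteq> {}" using k_ge_2 by (intro notI) simp
  then obtain b' where b': "b' \<in> X - A" by blast
  have fA: "finite A" using A finite_subset_X by blast
  \<comment> \<open>Both \<open>A - {s}\<close> and \<open>X - A - {b'}\<close> have
    \<open>k - 1\<close> points and avoid \<open>s\<close> and \<open>b'\<close>. One use of
    arc-transitivity fixes \<open>s\<close> and pushes the rest of \<open>A\<close> out of
    \<open>A\<close>.\<close>
  obtain h where h: "h \<in> H" "h ` (A - {s}) = X - A - {b'}" "h s = s"
  proof -
    have "card (A - {s}) = k - 1" using s A fA by (subst card_Diff_singleton) auto
    moreover have "card (X - A - {b'}) = k - 1" using b' cAc finite_X by simp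
    moreover have "s \<in> X - (A - {s})" "b' \<in> X - (A - {s})" "s \<noteq> b'"
      "s \<in> X - (X - A - {b'})" "b' \<in> X - (X - A - {b'})"
      using s b' A by auto
    ultimately have "\<exists>h\<in>H. h ` (A - {s}) = X - A - {b'} \<and> h s = s \<and> h b' = b'"
      using A by (intro arc) auto
    then show ?thesis using that by blast
  qed
  define g' where "g' = h \<circ> g \<circ> inv' h"
  have g'H: "g' \<in> H" unfolding g'_def by (rule perm_group_conj[OF perm_group_H g(1) h(1)])
  have gout': "g' x = x" if x: "x \<in> A" "x \<noteq> s" for x
  proof -
    have "inv' h x \<notin> A"
    proof
      assume i: "inv' h x \<in> A"
      then have "inv' h x \<noteq> s" using x(2) h(3) H_simps(1)[OF h(1), of x] by auto
      then have "h (inv' h x) \<in> h ` (A - {s})" using i by (intro imageI) simp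
      then have "x \<in> X - A - {b'}" using h(2) H_simps(1)[OF h(1), of x] by simp
      then show False using x by simp
    qed
    then have "g (inv' h x) = inv' h x" using gout A(1) by blast
    then show ?thesis using h(1) by (simp add: g'_def)
  qed
  have g's: "g' s \<notin> A"
  proof -
    have "inv' h s = s" using H_simps(2)[OF h(1), of s] h(3) by simp
    then have e: "g' s = h (g s)" by (simp add: g'_def)
    have "g s \<in> A"
    proof -
      have "g (g s) \<noteq> g s" using s H_simps(3)[OF g(1), of "g s" s] by simp
      then show ?thesis using gout A(1) by blast
    qed
    moreover have "g s \<noteq> s" using s by simp
    ultimately have "h (g s) \<in> h ` (A - {s})" by (intro imageI) simp
    then show ?thesis using e h(2) by auto
  qed
  let ?c = "g \<circ> g' \<circ> inv' g \<circ> inv' g'"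
  let ?u = "g s" let ?v = "g' s"
  have gA: "g x = x" if "x \<notin> A" for x using gout A(1) that by blast
  have igA: "inv' g x = x" if x: "x \<notin> A" for x using gA[OF x] H_simps(2)[OF g(1), of x] by simp
  have igA_in: "inv' g x \<in> A" if x: "x \<in> A" for x
  proof (rule ccontr)
    assume n: "inv' g x \<notin> A"
    then have "x = inv' g x" using gA[OF n] H_simps(1)[OF g(1), of x] by simp
    then show False using n x by simp
  qed
  have igA': "inv' g' x = x" if x: "x \<in> A" "x \<noteq> s" for x
    using gout'[OF x] H_simps(2)[OF g'H, of x] by simp
  have u: "?u \<in> A" "?u \<noteq> s"
  proof -
    have "g (g s) \<noteq> g s" using s H_simps(3)[OF g(1), of "g s" s] by simp
    then show "?u \<in> A" "?u \<noteq> s" using gA s by auto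
  qed
  have sA: "s \<in> A" "s \<in> X" using s A by auto
  have v: "?v \<in> X" "?v \<notin> A" using g's H_simps(4)[OF g'H, of s] sA by auto
  \<comment> \<open>\<open>g\<close> moves only points of \<open>A\<close>, and among these
    \<open>g'\<close> moves only \<open>s\<close>. The commutator can thus move only
    \<open>s\<close>, \<open>g s\<close> and \<open>g' s\<close>.\<close>
  have "?c = cyc3 s ?u ?v"
  proof
    fix x
    consider "x = s" | "x = ?u" | "x = ?v" | "x \<in> A" "x \<noteq> s" "x \<noteq> ?u" | "x \<notin> A" "x \<noteq> ?v"
      by blast
    then show "?c x = cyc3 s ?u ?v x"
    proof cases
      case 1
      have "inv' g' s \<notin> A"
      proof
        assume i: "inv' g' s \<in> A"
        have "inv' g' s \<noteq> s" using H_simps(1)[OF g'H, of s] v sA by auto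
        then have "g' (inv' g' s) = inv' g' s" using gout' i by blast
        then show False using H_simps(1)[OF g'H, of s] \<open>inv' g' s \<noteq> s\<close> by simp
      qed
      then have "inv' g (inv' g' s) = inv' g' s" by (rule igA)
      then show ?thesis using 1 u v sA H_simps(1)[OF g'H, of s]
        by (auto simp: cyc3_def transpose_def)
    next
      case 2
      then show ?thesis using u v sA igA'[OF u] H_simps(2)[OF g(1), of s] gA[OF v(2)]
        by (auto simp: cyc3_def transpose_def)
    next
      case 3
      have "inv' g s \<noteq> s" using H_simps(1)[OF g(1), of s] u by auto
      moreover have "inv' g s \<in> A" using igA_in sA(1) by blast
      ultimately
      have "g' (inv' g s) = inv' g s" using gout' by blast
      then show ?thesis using 3 u v sA H_simps(2)[OF g'H, of s] H_simps(1)[OF g(1), of s]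
        by (auto simp: cyc3_def transpose_def)
    next
      case 4
      have "inv' g x \<noteq> s" using 4(3) H_simps(1)[OF g(1), of x] by auto
      moreover have "inv' g x \<in> A" using igA_in 4(1) by blast
      ultimately have "g' (inv' g x) = inv' g x" using gout' by blast
      then show ?thesis using 4 u v sA igA'[OF 4(1,2)] H_simps(1)[OF g(1), of x]
        by (auto simp: cyc3_def transpose_def)
    next
      case 5
      have "inv' g' x \<noteq> s" using 5(2) H_simps(1)[OF g'H, of x] by auto
      then have "inv' g' x \<notin> A"
        using gout'[of "inv' g' x"] H_simps(1)[OF g'H, of x] 5(1) by metis
      then have "inv' g (inv' g' x) = inv' g' x" by (rule igA)
      then show ?thesis using 5 u v sA gA[OF 5(1)] H_simps(1)[OF g'H, of x]
        by (auto simp: cyc3_def transpose_def)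
    qed
  qed
  moreover have "?c \<in> H"
    by (rule H_closed(3)[OF H_closed(3)[OF H_closed(3)[OF g(1) g'H] H_closed(4)[OF g(1)]]
          H_closed(4)[OF g'H]])
  ultimately have "cyc3 s ?u ?v \<in> H" by simp
  moreover have "distinct [s, ?u, ?v]" "?u \<in> X" using u v A sA by auto
  ultimately show ?thesis using sA v by blast
qed

theorem all_three_cycles:
  assumes "x \<in> X" "y \<in> X" "z \<in> X" "distinct [x, y, z]"
  shows "cyc3 x y z \<in> H"
proof -
  obtain s u v where s: "s \<in> X" "u \<in> X" "v \<in> X" "distinct [s, u, v]" "cyc3 s u v \<in> H"
    using exists_three_cycle by blast
  obtain h where h: "h \<in> H" "h s = x" "h u = y" "h v = z"
    using three_transitive[OF s(1-4) assms] by blast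
  have "h \<circ> cyc3 s u v \<circ> inv' h \<in> H" by (rule perm_group_conj[OF perm_group_H s(5) h(1)])
  then show ?thesis
    using cyc3_conj[OF permutes_bij[OF H_closed(1)[OF h(1)]], of s u v] h by simp
qed

end

section \<open>Generating 3-cycles\<close>

lemma perm_group_compose2:
  assumes "perm_group X N" "f \<in> N" "g \<in> N" shows "f \<circ> g \<in> N"
  using perm_groupD(3)[OF assms] .

lemma cyc3_apply:
  assumes "distinct [x, y, z]"
  shows "cyc3 x y z p = (if p = x then y else if p = y then z else if p = z then x else p)"
  using assms by (auto simp: cyc3_def transpose_def)

lemma cyc3_rotate: "distinct [x, y, z] \<Longrightarrow> cyc3 x y z = cyc3 y z x"
  by (rule ext) (auto simp: cyc3_def transpose_def)

lemma cyc3_inv: "distinct [x, y, z] \<Longrightarrow> inv' (cyc3 x y z) = cyc3 x z y"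
  by (rule inv_unique_comp) (rule ext, auto simp: cyc3_def transpose_def)+

lemma evenperm_cyc3: "distinct [x, y, z] \<Longrightarrow> evenperm (cyc3 x y z)"
  by (simp add: cyc3_def evenperm_comp permutation_swap_id evenperm_swap)

lemma cyc3_permutes: "{x, y, z} \<subseteq> X \<Longrightarrow> cyc3 x y z permutes X"
  by (simp add: cyc3_def permutes_compose permutes_swap_id)

definition dtr :: "'a \<Rightarrow> 'a \<Rightarrow> 'a \<Rightarrow> 'a \<Rightarrow> 'a \<Rightarrow> 'a" where
  "dtr u v w x = transpose u v \<circ> transpose w x"

lemma evenperm_dtr: "u \<noteq> v \<Longrightarrow> w \<noteq> x \<Longrightarrow> evenperm (dtr u v w x)"
  by (simp add: dtr_def evenperm_comp permutation_swap_id evenperm_swap)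

lemma dtr_permutes: "{u, v, w, x} \<subseteq> X \<Longrightarrow> dtr u v w x permutes X"
  by (simp add: dtr_def permutes_compose permutes_swap_id)

lemma dtr_apply:
  assumes "distinct [u, v, w, x]"
  shows "dtr u v w x p =
    (if p = u then v else if p = v then u else if p = w then x else if p = x then w else p)"
  using assms by (auto simp: dtr_def transpose_def)

lemma dtr_sym:
  shows "dtr v u w x = dtr u v w x" "dtr u v x w = dtr u v w x"
    "distinct [u, v, w, x] \<Longrightarrow> dtr w x u v = dtr u v w x"
  by (simp_all add: dtr_def transpose_commute) (rule ext, auto simp: transpose_def)

lemma dtr_conj:
  assumes "bij h"
  shows "h \<circ> dtr u v w x \<circ> inv' h = dtr (h u) (h v) (h w) (h x)"
proof
  fix p
  obtain q where "p = h q" using assms by (metis bij_pointE)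
  then show "(h \<circ> dtr u v w x \<circ> inv' h) p = dtr (h u) (h v) (h w) (h x) p"
    using assms by (simp add: dtr_def transpose_def bij_is_inj inj_eq)
qed

lemma perm_group_cyc3_conj:
  assumes "perm_group X N" "cyc3 x y z \<in> N" "h \<in> N"
  shows "cyc3 (h x) (h y) (h z) \<in> N"
  using perm_group_conj[OF assms]
  by (simp only: cyc3_conj[OF permutes_bij[OF perm_groupD(1)[OF assms(1,3)]]])

lemma perm_group_dtr_conj:
  assumes "perm_group X N" "dtr u v w x \<in> N" "h \<in> N"
  shows "dtr (h u) (h v) (h w) (h x) \<in> N"
  using perm_group_conj[OF assms]
  by (simp only: dtr_conj[OF permutes_bij[OF perm_groupD(1)[OF assms(1,3)]]])

lemma evenperm_mem_if_three_cycles: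
  assumes N: "perm_group X N" and X: "finite X"
    and three: "\<And>x y z. {x, y, z} \<subseteq> X \<Longrightarrow> distinct [x, y, z] \<Longrightarrow> cyc3 x y z \<in> N"
    and p: "p permutes X"
  shows "evenperm p \<Longrightarrow> p \<in> N"
proof -
  have two: "transpose c d \<circ> transpose a b \<in> N"
    if cd: "c \<in> X" "d \<in> X" "c \<noteq> d" and ab: "a \<in> X" "b \<in> X" "a \<noteq> b" for a b c d
  proof -
    consider "{c, d} = {a, b}" | "c = a" "d \<noteq> b" | "c = b" "d \<noteq> a" | "d = a" "c \<noteq> b" | "d = b" "c \<noteq> a"
      | "distinct [a, b, c, d]"
      using cd ab by auto
    then show ?thesis
    proof cases
      case 1
      then have "transpose c d = transpose a b"
        by (auto simp: doubleton_eq_iff transpose_commute)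
      then show ?thesis using perm_groupD(2)[OF N] transpose_comp_involutory[of a b] by metis
    next
      case 2
      then have "transpose c d \<circ> transpose a b = cyc3 d a b" by (simp add: cyc3_def transpose_commute)
      then show ?thesis using three[of d a b] 2 cd ab by simp
    next
      case 3
      then have "transpose c d \<circ> transpose a b = cyc3 d b a" by (simp add: cyc3_def transpose_commute)
      then show ?thesis using three[of d b a] 3 cd ab by simp
    next
      case 4
      then have "transpose c d \<circ> transpose a b = cyc3 c a b" by (simp add: cyc3_def)
      then show ?thesis using three[of c a b] 4 cd ab by simp
    next
      case 5
      then have "transpose c d \<circ> transpose a b = cyc3 c b a" by (simp add: cyc3_def transpose_commute)
      then show ?thesis using three[of c b a] 5 cd ab by simp
    next
      case 6
      then have "transpose c d \<circ> transpose a b = cyc3 c d a \<circ> cyc3 d a b"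
        by (simp add: cyc3_def fun_eq_iff)
      moreover have "cyc3 c d a \<in> N" "cyc3 d a b \<in> N" using three 6 cd ab by auto
      ultimately show ?thesis using perm_group_compose2[OF N] by simp
    qed
  qed
  \<comment> \<open>The induction multiplies by one transposition at a time and so passes through
    odd permutations. For those the invariant is membership after one further transposition,
    whichever it is.\<close>
  have "(evenperm p \<longrightarrow> p \<in> N) \<and>
    (\<not> evenperm p \<longrightarrow> (\<forall>c\<in>X. \<forall>d\<in>X. c \<noteq> d \<longrightarrow> transpose c d \<circ> p \<in> N))"
    using p X
  proof (induction rule: permutes_induct)
    case id
    then show ?case using perm_groupD(2)[OF N] by (simp add: id_def)
  next
    case (swap a b p)
    have perm: "permutation p" using swap X permutation_permutes by blast
    have ev: "evenperm (transpose a b \<circ> p) \<longleftrightarrow> \<not> evenperm p"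
      using swap by (simp add: evenperm_comp permutation_swap_id perm evenperm_swap)
    show ?case
    proof (cases "evenperm p")
      case True
      then have "p \<in> N" using swap by blast
      then have "transpose c d \<circ> (transpose a b \<circ> p) \<in> N" if "c \<in> X" "d \<in> X" "c \<noteq> d" for c d
        using perm_group_compose2[OF N two[OF that swap(1,2,3)]] by (simp add: comp_assoc)
      then show ?thesis using ev True by blast
    next
      case False
      then show ?thesis using swap ev by blast
    qed
  qed
  then show "evenperm p \<Longrightarrow> p \<in> N" by blast
qed

text \<open>For a group \<open>N\<close> this is an \<open>N\<close>-invariant equivalence relation,
  and a single class on \<open>X\<close> already gives every 3-cycle. The arguments on overgroups
  below therefore only have to connect points.\<close>

definition linked :: "('a \<Rightarrow> 'a) set \<Rightarrow> 'a \<Rightarrow> 'a \<Rightarrow> bool" where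
  "linked N u v \<longleftrightarrow> u = v \<or> (\<exists>w. distinct [u, v, w] \<and> cyc3 u v w \<in> N)"

lemma linkedI: "distinct [u, v, w] \<Longrightarrow> cyc3 u v w \<in> N \<Longrightarrow> linked N u v"
  unfolding linked_def by blast

lemma cyc3_flip:
  assumes N: "perm_group X N" and d: "distinct [u, v, w]" and c: "cyc3 u v w \<in> N"
  shows "cyc3 u w v \<in> N"
  using perm_groupD(4)[OF N c] cyc3_inv[OF d] by simp

lemma linked_sym:
  assumes N: "perm_group X N" and l: "linked N u v"
  shows "linked N v u"
proof (cases "u = v")
  case True
  then show ?thesis by (simp add: linked_def)
next
  case False
  then obtain w where w: "distinct [u, v, w]" "cyc3 u v w \<in> N" using l unfolding linked_def by blast
  have "cyc3 u w v = cyc3 v u w" using w(1) cyc3_rotate[of v u w] by auto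
  then show ?thesis using cyc3_flip[OF N w] w(1) linkedI[of v u w] by auto
qed

text \<open>If the two 3-cycles share only \<open>v\<close>, conjugating the first by the second
  replaces \<open>v\<close> by \<open>z\<close>. Otherwise one of the cycles already contains both
  \<open>u\<close> and \<open>z\<close>, and it or its inverse links them.\<close>

lemma linked_trans:
  assumes N: "perm_group X N" and uv: "linked N u v" and vz: "linked N v z"
  shows "linked N u z"
proof (cases "u = v \<or> v = z \<or> u = z")
  case True
  then show ?thesis using uv vz by (auto simp: linked_def)
next
  case False
  obtain w where w: "distinct [u, v, w]" "cyc3 u v w \<in> N" using uv False unfolding linked_def by blast
  obtain t where t: "distinct [v, z, t]" "cyc3 v z t \<in> N" using vz False unfolding linked_def by blast
  consider "w = z" | "t = u" | "w \<noteq> z" "t \<noteq> u" by blast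
  then show ?thesis
  proof cases
    case 1
    then show ?thesis using cyc3_flip[OF N w] w(1) by (auto intro: linkedI[of u z v])
  next
    case 2
    have "cyc3 u v z = cyc3 v z u" using t(1) 2 by (intro cyc3_rotate) auto
    then have "cyc3 u z v \<in> N" using cyc3_flip[OF N, of u v z] t 2 by auto
    then show ?thesis using False linkedI[of u z v] by auto
  next
    case 3
    let ?h = "cyc3 v z t"
    have h: "?h u = u" "?h v = z" using t(1) 3 False by (auto simp: cyc3_apply)
    have "cyc3 (?h u) (?h v) (?h w) \<in> N" using perm_group_cyc3_conj[OF N w(2) t(2)] .
    moreover have "distinct [?h u, ?h v, ?h w]"
      using w(1) perm_group_simps(3)[OF N t(2)] by simp
    ultimately show ?thesis using h linkedI by metis
  qed
qed

lemma linked_image: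
  assumes N: "perm_group X N" and uv: "linked N u v" and h: "h \<in> N"
  shows "linked N (h u) (h v)"
proof (cases "u = v")
  case True
  then show ?thesis by (simp add: linked_def)
next
  case False
  then obtain w where w: "distinct [u, v, w]" "cyc3 u v w \<in> N" using uv unfolding linked_def by blast
  have "distinct [h u, h v, h w]" using w(1) perm_group_simps(3)[OF N h] by simp
  then show ?thesis by (rule linkedI[OF _ perm_group_cyc3_conj[OF N w(2) h]])
qed

text \<open>A cycle \<open>u, v, s\<close> in \<open>N\<close> has the wrong third point.
  Conjugation by a cycle taking \<open>s\<close> to \<open>w\<close> corrects it, unless that cycle
  also moves \<open>u\<close> or \<open>v\<close>; then the second cycle is conjugated by the first
  or its inverse.\<close>

lemma three_cycles_if_linked:
  assumes N: "perm_group X N" and l: "\<And>x y. x \<in> X \<Longrightarrow> y \<in> X \<Longrightarrow> linked N x y"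
    and uvw: "{u, v, w} \<subseteq> X" "distinct [u, v, w]"
  shows "cyc3 u v w \<in> N"
proof -
  obtain s where s: "distinct [u, v, s]" "cyc3 u v s \<in> N"
    using l[of u v] uvw unfolding linked_def by auto
  show ?thesis
  proof (cases "s = w")
    case True
    then show ?thesis using s by simp
  next
    case False
    have "s \<in> X"
    proof (rule ccontr)
      assume "s \<notin> X"
      then have "cyc3 u v s s = s" using permutes_not_in[OF perm_groupD(1)[OF N s(2)]] by blast
      then show False using s(1) by (auto simp: cyc3_apply split: if_splits)
    qed
    then obtain r where r: "distinct [s, w, r]" "cyc3 s w r \<in> N"
      using l[of s w] uvw False unfolding linked_def by auto
    consider "r \<noteq> u" "r \<noteq> v" | "r = u" | "r = v" by blast
    then show ?thesis
    proof cases
      case 1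
      have "cyc3 s w r u = u" "cyc3 s w r v = v" "cyc3 s w r s = w"
        using 1 r(1) s(1) uvw by (auto simp: cyc3_apply)
      then show ?thesis using perm_group_cyc3_conj[OF N s(2) r(2)] by simp
    next
      case 2
      have "cyc3 u v s s = u" "cyc3 u v s w = w" "cyc3 u v s u = v"
        using False s(1) uvw by (auto simp: cyc3_apply)
      then have "cyc3 u w v \<in> N" using perm_group_cyc3_conj[OF N r(2) s(2)] 2 by simp
      then show ?thesis using cyc3_flip[OF N, of u w v] uvw by auto
    next
      case 3
      have h: "cyc3 u s v \<in> N" using cyc3_flip[OF N s] .
      have "cyc3 u s v s = v" "cyc3 u s v w = w" "cyc3 u s v v = u"
        using False s(1) uvw by (auto simp: cyc3_apply)
      then have "cyc3 v w u \<in> N" using perm_group_cyc3_conj[OF N r(2) h] 3 by simp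
      moreover have "cyc3 u v w = cyc3 v w u" using uvw(2) by (rule cyc3_rotate)
      ultimately show ?thesis by simp
    qed
  qed
qed

lemma linked_if_three_cycles:
  assumes "finite Z" "3 \<le> card Z"
    and "\<And>x y z. {x, y, z} \<subseteq> Z \<Longrightarrow> distinct [x, y, z] \<Longrightarrow> cyc3 x y z \<in> N"
    and "u \<in> Z" "v \<in> Z"
  shows "linked N u v"
proof (cases "u = v")
  case True
  then show ?thesis by (simp add: linked_def)
next
  case False
  have "card {u, v} < card Z" using assms(2) False by simp
  then obtain w where "w \<in> Z" "w \<notin> {u, v}"
    by (metis assms(1) card_mono finite.emptyI finite.insertI not_less subsetI)
  then show ?thesis using assms(3)[of u v w] assms(4,5) False by (auto intro: linkedI[of u v w])
qed

section \<open>Groups that move the pair a, b\<close>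

lemma image_complement_moves:
  assumes n: "n permutes X" and X: "finite X" and P: "P \<subseteq> X" and ne: "n ` P \<noteq> P"
  shows "\<exists>z\<in>X - P. n z \<in> P"
proof (rule ccontr)
  assume c: "\<not> ?thesis"
  have "P \<subseteq> n ` P"
  proof
    fix y assume y: "y \<in> P"
    then have "y \<in> n ` X" using P permutes_image[OF n] by auto
    then obtain z where "z \<in> X" "y = n z" by blast
    then show "y \<in> n ` P" using c y by blast
  qed
  moreover have "card (n ` P) = card P"
    using permutes_inj[OF n] by (metis card_image inj_on_subset subset_UNIV)
  ultimately show False using ne P X by (metis card_subset_eq finite_imageI finite_subset)
qed

lemma exists_outside_preimage:
  assumes n: "inj n" and Z: "finite Z" "3 \<le> card Z"
  shows "\<exists>z\<in>Z. n z \<noteq> a \<and> n z \<noteq> b"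
proof (rule ccontr)
  assume "\<not> ?thesis"
  then have "n ` Z \<subseteq> {a, b}" by blast
  then have "card (n ` Z) \<le> card {a, b}" by (intro card_mono) auto
  moreover have "card (n ` Z) = card Z" using n by (metis card_image inj_on_subset subset_UNIV)
  moreover have "card {a, b} \<le> 2" by (simp add: card_insert_if)
  ultimately show False using Z by simp
qed

text \<open>The points off \<open>a\<close> and \<open>b\<close> form one class. Some of them go
  into {a, b} under \<open>n\<close> and others do not, so one of \<open>a\<close>, \<open>b\<close>
  is linked to the class; \<open>e\<close> passes the link on to the other.\<close>

lemma three_cycles_if_moves_pair:
  assumes N: "perm_group X N" and X: "finite X" "5 \<le> card X" and ab: "a \<in> X" "b \<in> X" "a \<noteq> b"
    and three: "\<And>x y z. {x, y, z} \<subseteq> X - {a, b} \<Longrightarrow> distinct [x, y, z] \<Longrightarrow> cyc3 x y z \<in> N"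
    and e: "e \<in> N" "e a = b" "e b = a"
    and n: "n \<in> N" "n ` {a, b} \<noteq> {a, b}"
    and uvw: "{u, v, w} \<subseteq> X" "distinct [u, v, w]"
  shows "cyc3 u v w \<in> N"
proof -
  let ?Z = "X - {a, b}"
  have cZ: "3 \<le> card ?Z" using ab X by (simp add: card_Diff_subset)
  have lZ: "linked N x y" if "x \<in> ?Z" "y \<in> ?Z" for x y
    using linked_if_three_cycles[of ?Z N x y] X cZ three that by blast
  have nX: "n permutes X" using perm_groupD(1)[OF N n(1)] .
  obtain z where z: "z \<in> ?Z" "n z \<in> {a, b}"
    using image_complement_moves[OF nX X(1) _ n(2)] ab by blast
  obtain z' where z': "z' \<in> ?Z" "n z' \<noteq> a" "n z' \<noteq> b"
    using exists_outside_preimage[OF permutes_inj[OF nX] _ cZ, of a b] X by blast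
  have "linked N (n z) (n z')" using linked_image[OF N lZ[OF z(1) z'(1)] n(1)] .
  moreover have nz': "n z' \<in> ?Z" using z' perm_group_simps(4)[OF N n(1), of z'] by auto
  ultimately obtain c where c: "c \<in> {a, b}" "linked N c (n z')" using z by blast
  have ez: "e (n z') \<in> ?Z"
    using nz' e perm_group_simps(4)[OF N e(1), of "n z'"] perm_group_simps(3)[OF N e(1), of "n z'" a]
      perm_group_simps(3)[OF N e(1), of "n z'" b] by auto
  have "linked N (e c) (e (n z'))" using linked_image[OF N c(2) e(1)] .
  then have base: "linked N x (n z')" if "x \<in> {a, b}" for x
    using that c e lZ[OF ez nz'] linked_trans[OF N] by auto
  have all: "linked N x (n z')" if "x \<in> X" for x
    using that base lZ[OF _ nz'] by blast
  show ?thesis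
    by (rule three_cycles_if_linked[OF N linked_trans[OF N all linked_sym[OF N all]] uvw])
qed

text \<open>Now 3-cycles are given only inside the halves \<open>C\<close> and \<open>D\<close>. As
  \<open>n\<close> links one of \<open>a\<close>, \<open>b\<close> to one half, \<open>e\<close>
  carries the link to the other point and \<open>s\<close> carries it to the other half. Below, the
  lemma is applied to the part stabilizer itself.\<close>

lemma three_cycles_if_moves_pair':
  assumes N: "perm_group X N" and X: "finite X" and ab: "a \<in> X" "b \<in> X" "a \<noteq> b"
    and XCD: "X - {a, b} = C \<union> D" "3 \<le> card C" "3 \<le> card D"
    and threeC: "\<And>x y z. {x, y, z} \<subseteq> C \<Longrightarrow> distinct [x, y, z] \<Longrightarrow> cyc3 x y z \<in> N"
    and threeD: "\<And>x y z. {x, y, z} \<subseteq> D \<Longrightarrow> distinct [x, y, z] \<Longrightarrow> cyc3 x y z \<in> N"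
    and e: "e \<in> N" "e a = b" "e b = a" "e ` C = C" "e ` D = D"
    and s: "s \<in> N" "s ` {a, b} = {a, b}" "s ` C = D" "s ` D = C"
    and n: "n \<in> N" "n ` {a, b} \<noteq> {a, b}"
    and uvw: "{u, v, w} \<subseteq> X" "distinct [u, v, w]"
  shows "cyc3 u v w \<in> N"
proof -
  have fin: "finite C" "finite D" using XCD(1) X by (metis finite_Diff finite_Un)+
  have lC: "linked N x y" if "x \<in> C" "y \<in> C" for x y
    using linked_if_three_cycles[OF fin(1) XCD(2) threeC that] by blast
  have lD: "linked N x y" if "x \<in> D" "y \<in> D" for x y
    using linked_if_three_cycles[OF fin(2) XCD(3) threeD that] by blast
  have nX: "n permutes X" using perm_groupD(1)[OF N n(1)] .
  obtain z where z: "z \<in> C \<union> D" "n z \<in> {a, b}"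
    using image_complement_moves[OF nX X(1) _ n(2)] ab XCD(1) by blast
  have "\<exists>z'\<in>C \<union> D. linked N z z' \<and> n z' \<in> C \<union> D"
  proof -
    have "\<exists>z'\<in>C \<union> D. linked N z z' \<and> n z' \<noteq> a \<and> n z' \<noteq> b"
      using z(1) exists_outside_preimage[OF permutes_inj[OF nX] fin(1) XCD(2), of a b]
        exists_outside_preimage[OF permutes_inj[OF nX] fin(2) XCD(3), of a b] lC lD by blast
    then show ?thesis using XCD(1) perm_group_simps(4)[OF N n(1)] by blast
  qed
  then obtain z' where z': "linked N z z'" "n z' \<in> C \<union> D" by blast
  have "linked N (n z) (n z')" using linked_image[OF N z'(1) n(1)] .
  then obtain c y where c: "c \<in> {a, b}" "y \<in> C \<union> D" "linked N c y" using z z' by blast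
  have aby: "\<exists>y'\<in>E. linked N x y'"
    if cE: "c \<in> {a, b}" "y \<in> E" "linked N c y" "e ` E = E" "x \<in> {a, b}" for c y x E
  proof (cases "x = c")
    case True
    then show ?thesis using cE by blast
  next
    case False
    then have "x = e c" using cE(1,5) e by auto
    then show ?thesis using linked_image[OF N cE(3) e(1)] cE(2,4) by blast
  qed
  have abC: "\<exists>y\<in>C. linked N x y" and abD: "\<exists>y\<in>D. linked N x y" if x: "x \<in> {a, b}" for x
  proof -
    obtain c1 y1 where 1: "c1 \<in> {a, b}" "y1 \<in> C" "linked N c1 y1"
    proof (cases "y \<in> C")
      case True
      then show ?thesis using c that by blast
    next
      case False
      then have "s y \<in> C" using c s by blast
      moreover have "s c \<in> {a, b}" using c s by blast
      ultimately show ?thesis using that linked_image[OF N c(3) s(1)] by blast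
    qed
    have "s y1 \<in> D" "s c1 \<in> {a, b}" using 1 s by blast+
    then show "\<exists>y\<in>D. linked N x y"
      using aby[OF _ _ linked_image[OF N 1(3) s(1)] e(5) x] by blast
    show "\<exists>y\<in>C. linked N x y" using aby[OF 1 e(4) x] .
  qed
  have all: "linked N x a" if x: "x \<in> X" for x
  proof -
    obtain y1 y2 where y: "y1 \<in> C" "linked N a y1" "y2 \<in> D" "linked N a y2"
      using abC abD by blast
    obtain y3 where y3: "y3 \<in> C" "linked N b y3" using abC by blast
    consider "x = a" | "x = b" | "x \<in> C" | "x \<in> D" using x XCD(1) by blast
    then show ?thesis
    proof cases
      case 1
      then show ?thesis by (simp add: linked_def)
    next
      case 2
      then show ?thesis using linked_trans[OF N linked_trans[OF N y3(2) lC[OF y3(1) y(1)]] linked_sym[OF N y(2)]] by simp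
    next
      case 3
      then show ?thesis using linked_trans[OF N lC[OF _ y(1)] linked_sym[OF N y(2)]] by simp
    next
      case 4
      then show ?thesis using linked_trans[OF N lD[OF _ y(3)] linked_sym[OF N y(4)]] by simp
    qed
  qed
  show ?thesis
    by (rule three_cycles_if_linked[OF N linked_trans[OF N all linked_sym[OF N all]] uvw])
qed

text \<open>Two double transpositions with a common second factor multiply to a 3-cycle, and five
  points leave room for that factor.\<close>

lemma three_cycles_if_dtrs:
  assumes N: "perm_group X N" and X: "finite X" "5 \<le> card X"
    and d: "\<And>u v w x. {u, v, w, x} \<subseteq> X \<Longrightarrow> distinct [u, v, w, x] \<Longrightarrow> dtr u v w x \<in> N"
    and uvw: "{u, v, w} \<subseteq> X" "distinct [u, v, w]"
  shows "cyc3 u v w \<in> N"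
proof -
  have "card {u, v, w} = 3" using uvw(2) by simp
  then have "2 \<le> card (X - {u, v, w})" using X uvw(1) by (simp add: card_Diff_subset)
  then obtain T where "T \<subseteq> X - {u, v, w}" "card T = 2" using obtain_subset_with_card_n by metis
  then obtain e f where ef: "e \<in> X - {u, v, w}" "f \<in> X - {u, v, w}" "e \<noteq> f"
    by (auto simp: card_2_iff)
  have "dtr u v e f \<in> N" "dtr v w e f \<in> N" using d[of u v e f] d[of v w e f] uvw ef by auto
  then have "dtr u v e f \<circ> dtr v w e f \<in> N" by (rule perm_group_compose2[OF N])
  moreover have "dtr u v e f \<circ> dtr v w e f = cyc3 u v w"
    using uvw(2) ef by (intro ext) (auto simp: dtr_def cyc3_def transpose_def)
  ultimately show ?thesis by simp
qed

text \<open>The partition is kept with a labelling of its points, so that choices without loss of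
  generality become relabellings.\<close>

definition three_pairs :: "'a set \<Rightarrow> 'a set set \<Rightarrow> 'a \<Rightarrow> 'a \<Rightarrow> 'a \<Rightarrow> 'a \<Rightarrow> 'a \<Rightarrow> 'a \<Rightarrow> bool" where
  "three_pairs X \<C> x x' y y' z z' \<longleftrightarrow> distinct [x, x', y, y', z, z'] \<and> X = {x, x', y, y', z, z'} \<and>
     \<C> = {{x, x'}, {y, y'}, {z, z'}}"

lemma three_pairs_sym:
  assumes "three_pairs X \<C> x x' y y' z z'"
  shows "three_pairs X \<C> x' x y y' z z'" "three_pairs X \<C> y y' x x' z z'"
    "three_pairs X \<C> x x' z z' y y'"
  using assms unfolding three_pairs_def by auto

lemma three_pairs_first:
  assumes "three_pairs X \<C> x x' y y' z z'" and "w \<in> X"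
  shows "\<exists>w' u u' v v'. three_pairs X \<C> w w' u u' v v'"
proof -
  have "w = x \<or> w = x' \<or> w = y \<or> w = y' \<or> w = z \<or> w = z'"
    using assms unfolding three_pairs_def by auto
  then show ?thesis using assms(1) three_pairs_sym by metis
qed

lemma three_pairs_second:
  assumes "three_pairs X \<C> x x' y y' z z'" and "w \<in> X" "w \<noteq> x" "w \<noteq> x'"
  shows "\<exists>w' u u'. three_pairs X \<C> x x' w w' u u'"
proof -
  have "w = y \<or> w = y' \<or> w = z \<or> w = z'"
    using assms unfolding three_pairs_def by auto
  then show ?thesis using assms(1) three_pairs_sym by metis
qed

text \<open>Four points have only three double transpositions, one for each partner of
  \<open>c\<close>; the symmetries of \<open>dtr\<close> move \<open>c\<close> to the first
  place.\<close>

lemma dtr_on_four: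
  assumes d: "distinct [c, c', d, d']" and p: "{p1, p2, p3, p4} = {c, c', d, d'}" "distinct [p1, p2, p3, p4]"
  shows "dtr p1 p2 p3 p4 \<in> {dtr c c' d d', dtr c d c' d', dtr c d' c' d}"
proof -
  have *: "dtr c a1 a2 a3 \<in> {dtr c c' d d', dtr c d c' d', dtr c d' c' d}"
    if "{c, a1, a2, a3} = {p1, p2, p3, p4}" "distinct [c, a1, a2, a3]" for a1 a2 a3
  proof -
    have "{a1, a2, a3} = {c, a1, a2, a3} - {c}" using that(2) by auto
    also have "\<dots> = {c, c', d, d'} - {c}" by (simp only: that(1) p(1))
    also have "\<dots> = {c', d, d'}" using d by auto
    finally have "{a1, a2, a3} = {c', d, d'}" .
    then have "a1 \<in> {c', d, d'}" "a2 \<in> {c', d, d'}" "a3 \<in> {c', d, d'}" by blast+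
    moreover have "a1 \<noteq> a2" "a1 \<noteq> a3" "a2 \<noteq> a3" using that(2) by simp_all
    ultimately consider "a1 = c'" "a2 = d" "a3 = d'" | "a1 = c'" "a2 = d'" "a3 = d"
      | "a1 = d" "a2 = c'" "a3 = d'" | "a1 = d" "a2 = d'" "a3 = c'"
      | "a1 = d'" "a2 = c'" "a3 = d" | "a1 = d'" "a2 = d" "a3 = c'" by blast
    then show ?thesis
      by cases (simp_all add: dtr_sym(2)[of _ _ d' d] dtr_sym(2)[of _ _ d' c'] dtr_sym(2)[of _ _ d c'])
  qed
  have "c \<in> {p1, p2, p3, p4}" unfolding p(1) by simp
  then consider "p1 = c" | "p2 = c" | "p3 = c" | "p4 = c" by blast
  then show ?thesis
  proof cases
    case 1
    then show ?thesis using *[of p2 p3 p4] p(2) by simp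
  next
    case 2
    then show ?thesis using *[of p1 p3 p4] p(2) dtr_sym(1)[of c p1 p3 p4] by (auto simp: insert_commute)
  next
    case 3
    then show ?thesis using *[of p4 p1 p2] p(2) dtr_sym(3)[of p1 p2 p3 p4] by (auto simp: insert_commute)
  next
    case 4
    then show ?thesis
      using *[of p3 p1 p2] p(2) dtr_sym(3)[of p1 p2 p3 p4] dtr_sym(1)[of c p3 p1 p2]
      by (auto simp: insert_commute)
  qed
qed

lemma dtr_preserves_three_pairs:
  assumes t: "three_pairs X \<C> x x' y y' z z'"
    and u: "{u, v, w, s} = {y, y', z, z'}" "distinct [u, v, w, s]"
  shows "(`) (dtr u v w s) ` \<C> = \<C>"
proof -
  have C: "\<C> = {{x, x'}, {y, y'}, {z, z'}}" and d: "distinct [x, x', y, y', z, z']"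
    using t by (simp_all add: three_pairs_def)
  have d': "distinct [z', z, y', y, x', x]" using d by auto
  have four: "distinct [y, y', z, z']" using d by simp
  have im: "(`) p ` \<C> = {{p x, p x'}, {p y, p y'}, {p z, p z'}}" for p by (simp add: C)
  from dtr_on_four[OF four u] consider "dtr u v w s = dtr y y' z z'"
    | "dtr u v w s = dtr y z y' z'" | "dtr u v w s = dtr y z' y' z" by blast
  then show ?thesis
    unfolding im unfolding C using d d' by cases (simp_all add: dtr_apply insert_commute)
qed

text \<open>Some pair {q, q'} has an image {x, y} that is not a pair; let \<open>x'\<close> and
  \<open>y'\<close> be the partners. Conjugating by \<open>n\<close> a double transposition off {q,
  q'} gives \<open>dtr x' y' z z'\<close> in \<open>N\<close>. Its products with block-preserving
  double transpositions are 3-cycles, and these link all points.\<close>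

lemma three_cycles_if_moves_three_pairs:
  assumes N: "perm_group X N" and t: "three_pairs X \<C> a a' b b' c c'"
    and ev: "\<And>p. p permutes X \<Longrightarrow> evenperm p \<Longrightarrow> (`) p ` \<C> = \<C> \<Longrightarrow> p \<in> N"
    and n: "n \<in> N" "(`) n ` \<C> \<noteq> \<C>"
    and uvw: "{u, v, w} \<subseteq> X" "distinct [u, v, w]"
  shows "cyc3 u v w \<in> N"
proof -
  have nX: "n permutes X" using perm_groupD(1)[OF N n(1)] .
  have finC: "finite \<C>" using t by (simp add: three_pairs_def)
  have inj: "inj_on ((`) n) \<C>"
    using permutes_inj[OF nX] by (intro inj_onI) (simp add: inj_image_eq_iff)
  have "\<exists>P\<in>\<C>. n ` P \<notin> \<C>"
    using n(2) endo_inj_surj[OF finC _ inj] by blast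
  then obtain P where P: "P \<in> \<C>" "n ` P \<notin> \<C>" by blast
  have "\<exists>q q' r r' s s'. three_pairs X \<C> q q' r r' s s' \<and> P = {q, q'}"
  proof -
    have "P = {a, a'} \<or> P = {b, b'} \<or> P = {c, c'}" using P t by (auto simp: three_pairs_def)
    then show ?thesis using t three_pairs_sym[OF t] three_pairs_sym(3)[OF t]
        three_pairs_sym(2)[OF three_pairs_sym(3)[OF t]] by blast
  qed
  then obtain q q' r r' s s' where q: "three_pairs X \<C> q q' r r' s s'" "P = {q, q'}" by blast
  define x where "x = n q"
  define y where "y = n q'"
  have qX: "q \<in> X" "q' \<in> X" "q \<noteq> q'" using q by (auto simp: three_pairs_def)
  then have xy: "x \<in> X" "y \<in> X" "x \<noteq> y"
    using perm_group_simps(3,4)[OF N n(1)] by (auto simp: x_def y_def)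
  have xyC: "{x, y} \<notin> \<C>" using P(2) q(2) by (simp add: x_def y_def)
  obtain x' u1 u2 u3 u4 where "three_pairs X \<C> x x' u1 u2 u3 u4"
    using three_pairs_first[OF t xy(1)] by blast
  moreover from this have "y \<noteq> x'" using xyC by (auto simp: three_pairs_def)
  ultimately obtain y' z z' where T: "three_pairs X \<C> x x' y y' z z'"
    using three_pairs_second xy by metis
  have d: "distinct [x, x', y, y', z, z']" and XT: "X = {x, x', y, y', z, z'}"
    using T by (simp_all add: three_pairs_def)
  have evd: "dtr p1 p2 p3 p4 \<in> N"
    if "three_pairs X \<C> g g' h h' i i'" "{p1, p2, p3, p4} = {h, h', i, i'}" "distinct [p1, p2, p3, p4]"
    for g g' h h' i i' p1 p2 p3 p4
  proof (rule ev)
    have "{p1, p2, p3, p4} \<subseteq> X" using that(1,2) unfolding three_pairs_def by blast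
    then show "dtr p1 p2 p3 p4 permutes X" by (rule dtr_permutes)
    show "evenperm (dtr p1 p2 p3 p4)" using that(3) by (simp add: evenperm_dtr)
    show "(`) (dtr p1 p2 p3 p4) ` \<C> = \<C>" using dtr_preserves_three_pairs[OF that] .
  qed
  \<comment> \<open>The preimages of \<open>x'\<close>, \<open>y'\<close>, \<open>z\<close>,
    \<open>z'\<close> are the four points off {q, q'}, on which every double transposition preserves
    \<open>\<C>\<close>.\<close>
  have cross: "dtr x' y' z z' \<in> N"
  proof -
    let ?m = "inv' n"
    have m: "?m \<in> N" using perm_groupD(4)[OF N n(1)] .
    have e: "?m x = q" "?m y = q'" using perm_group_simps(2)[OF N n(1)] by (simp_all add: x_def y_def)
    have inj: "inj ?m" using perm_groupD(1)[OF N m] permutes_inj by blast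
    have "?m ` X = X" using perm_groupD(1)[OF N m] permutes_image by blast
    moreover have "?m ` X = {q, q'} \<union> {?m x', ?m y', ?m z, ?m z'}" unfolding XT using e by auto
    moreover have "X = {q, q'} \<union> {r, r', s, s'}" using q by (auto simp: three_pairs_def)
    ultimately have "{q, q'} \<union> {?m x', ?m y', ?m z, ?m z'} = {q, q'} \<union> {r, r', s, s'}" by simp
    moreover have "{q, q'} \<inter> {?m x', ?m y', ?m z, ?m z'} = {}"
      unfolding e[symmetric] using d inj by (auto simp: inj_eq)
    moreover have "{q, q'} \<inter> {r, r', s, s'} = {}" using q by (auto simp: three_pairs_def)
    ultimately have "{?m x', ?m y', ?m z, ?m z'} = {r, r', s, s'}" by blast
    moreover have "distinct [?m x', ?m y', ?m z, ?m z']" using d inj by (simp add: inj_eq)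
    ultimately have "dtr (?m x') (?m y') (?m z) (?m z') \<in> N" by (rule evd[OF q(1)])
    from perm_group_dtr_conj[OF N this n(1)] show ?thesis
      using perm_group_simps(1)[OF N n(1)] by simp
  qed
  have "dtr x' y' z z' \<circ> dtr y y' z z' \<in> N" "dtr x' y' z z' \<circ> dtr x x' z z' \<in> N"
    using evd[OF T, of y y' z z'] evd[OF three_pairs_sym(2)[OF T], of x x' z z'] d
      perm_group_compose2[OF N cross] by auto
  moreover have "dtr x' y' z z' \<circ> dtr y y' z z' = cyc3 x' y' y"
    "dtr x' y' z z' \<circ> dtr x x' z z' = cyc3 y' x' x"
    using d by (auto simp: dtr_def cyc3_def transpose_def fun_eq_iff)
  ultimately have c: "cyc3 x' y' y \<in> N" "cyc3 y' x' x \<in> N" by simp_all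
  have l1: "linked N x' y'" using linkedI[OF _ c(1)] d by auto
  have l2: "linked N y' y"
    using linkedI[of y' y x'] c(1) d cyc3_rotate[of x' y' y] by auto
  have l3: "linked N x' x"
    using linkedI[of x' x y'] c(2) d cyc3_rotate[of y' x' x] by auto
  have l4: "linked N x' y" using linked_trans[OF N l1 l2] .
  \<comment> \<open>This element exchanges the pairs of \<open>y\<close> and \<open>z\<close> and
    fixes \<open>x'\<close>, so it extends the class of \<open>x'\<close> to \<open>z\<close> and
    \<open>z'\<close>.\<close>
  let ?e = "dtr y z y' z'"
  have e: "?e \<in> N" using evd[OF T, of y z y' z'] d by (auto simp: insert_commute)
  have "?e x' = x'" "?e y = z" "?e y' = z'" using d by (auto simp: dtr_apply)
  then have "linked N x' z" "linked N x' z'"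
    using linked_image[OF N l4 e] linked_image[OF N l1 e] by simp_all
  then have all: "linked N x' p" if "p \<in> X" for p
    using that l1 l3 l4 unfolding XT by (auto simp: linked_def)
  show ?thesis
    by (rule three_cycles_if_linked[OF N linked_trans[OF N linked_sym[OF N all] all] uvw])
qed


text \<open>The argument order alternates between the pairs, so that this 4-cycle exchanges {c, c'}
  and {d, d'}. It is odd and fixes all other points, as \<open>odd_M\<close> below requires.\<close>

definition cyc4 :: "'a \<Rightarrow> 'a \<Rightarrow> 'a \<Rightarrow> 'a \<Rightarrow> 'a \<Rightarrow> 'a" where
  "cyc4 c d c' d' = transpose c d \<circ> dtr d c' c' d'"

lemma cyc4_apply:
  assumes "distinct [c, d, c', d']"
  shows "cyc4 c d c' d' c = d" "cyc4 c d c' d' d = c'" "cyc4 c d c' d' c' = d'" "cyc4 c d c' d' d' = c"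
    "p \<notin> {c, d, c', d'} \<Longrightarrow> cyc4 c d c' d' p = p"
  using assms by (auto simp: cyc4_def dtr_def transpose_def)

lemma cyc4_permutes: "{c, d, c', d'} \<subseteq> X \<Longrightarrow> cyc4 c d c' d' permutes X"
  unfolding cyc4_def by (intro permutes_compose dtr_permutes permutes_swap_id) auto

lemma odd_cyc4: "distinct [c, d, c', d'] \<Longrightarrow> \<not> evenperm (cyc4 c d c' d')"
  by (simp add: cyc4_def dtr_def evenperm_comp permutation_swap_id permutation_compose evenperm_swap)

text \<open>Here the two sets exchanged by the odd elements have only two points each, so no 3-cycle
  lies inside them.\<close>

locale six_points =
  fixes X :: "'a set" and a b c c' d d' :: 'a and M :: "('a \<Rightarrow> 'a) set"
  assumes X_def: "X = {a, b, c, c', d, d'}" and dist: "distinct [a, b, c, c', d, d']"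
    and M: "perm_group X M"
    and even_M: "\<And>p. \<lbrakk>p permutes X; evenperm p; p ` {c, c'} = {c, c'}; p ` {d, d'} = {d, d'};
      p ` {a, b} = {a, b}\<rbrakk> \<Longrightarrow> p \<in> M"
    and odd_M: "\<And>p. \<lbrakk>p permutes X; \<not> evenperm p; p ` {c, c'} = {d, d'}; p ` {d, d'} = {c, c'};
      p ` {a, b} = {a, b}\<rbrakk> \<Longrightarrow> p \<in> M"
begin

lemma finite_X: "finite X" by (simp add: X_def)

lemma card_X: "card X = 6" using dist by (simp add: X_def)

lemmas M_simps = perm_group_simps[OF M]

definition "q = cyc4 c d c' d'"

lemma dist4: "distinct [c, d, c', d']" "distinct [c, c', d, d']" using dist by auto

lemma q_apply: "q c = d" "q d = c'" "q c' = d'" "q d' = c" "q a = a" "q b = b"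
  unfolding q_def using dist by (simp_all add: cyc4_apply[OF dist4(1)])

lemma q_M: "q \<in> M"
proof (rule odd_M)
  show "q permutes X" unfolding q_def X_def by (rule cyc4_permutes) auto
  show "\<not> evenperm q" unfolding q_def by (rule odd_cyc4[OF dist4(1)])
qed (auto simp: q_apply)

lemma dtr_M: "dtr c c' d d' \<in> M" "dtr a b c c' \<in> M"
proof -
  show "dtr c c' d d' \<in> M"
    by (rule even_M[OF dtr_permutes evenperm_dtr]) (use dist in \<open>auto simp: X_def dtr_apply\<close>)
  show "dtr a b c c' \<in> M"
    by (rule even_M[OF dtr_permutes evenperm_dtr]) (use dist in \<open>auto simp: X_def dtr_apply\<close>)
qed

lemma v_apply: "dtr a b c c' a = b" "dtr a b c c' b = a" "dtr a b c c' c = c'" "dtr a b c c' c' = c"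
  "dtr a b c c' d = d" "dtr a b c c' d' = d'"
  using dist by (auto simp: dtr_apply)

text \<open>The powers of \<open>q\<close> permute the points off {a, b} transitively, and
  \<open>m1\<close> joins them to {a, b}, so \<open>M\<close> is transitive on \<open>X\<close>. If
  the stabilizer of \<open>a\<close> moves \<open>b\<close>, then it is transitive on all points
  other than \<open>a\<close>. If not, the images of {a, b} under \<open>M\<close> are blocks, and
  they turn out to be just the three pairs, which \<open>m2\<close> does not preserve.\<close>

lemma pair_transitive_or_imprimitive:
  assumes m1: "m1 \<in> M" "m1 ` {a, b} \<noteq> {a, b}"
    and m2: "m2 \<in> M" "(`) m2 ` {{a, b}, {c, c'}, {d, d'}} \<noteq> {{a, b}, {c, c'}, {d, d'}}"
    and xy: "x \<in> X" "y \<in> X" "x \<noteq> y"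
  shows "\<exists>m\<in>M. m a = x \<and> m b = y"
proof -
  let ?v = "dtr a b c c'"
  have comp: "f \<circ> g \<in> M" if "f \<in> M" "g \<in> M" for f g using perm_group_compose2[OF M that] .
  have "\<exists>z\<in>X - {a, b}. m1 z \<in> {a, b}"
    using image_complement_moves[OF perm_groupD(1)[OF M m1(1)] finite_X _ m1(2)] by (auto simp: X_def)
  then obtain z where z: "z \<in> X - {a, b}" "m1 z \<in> {a, b}" by blast
  have Z: "X - {a, b} = {c, c', d, d'}" using dist by (auto simp: X_def)
  have orbZ: "\<exists>m\<in>M. m a = a \<and> m b = b \<and> m w = w'" if w: "w \<in> {c, c', d, d'}" "w' \<in> {c, c', d, d'}" for w w'
  proof -
    have 1: "\<exists>m\<in>M. m a = a \<and> m b = b \<and> m c = w" if "w \<in> {c, c', d, d'}" for w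
    proof -
      consider "w = c" | "w = d" | "w = c'" | "w = d'" using \<open>w \<in> {c, c', d, d'}\<close> by blast
      then show ?thesis
      proof cases
        case 1
        show ?thesis using perm_groupD(2)[OF M] 1 by (intro bexI[of _ id]) simp_all
      next
        case 2
        show ?thesis using q_M q_apply 2 by (intro bexI[of _ q]) simp_all
      next
        case 3
        show ?thesis using comp[OF q_M q_M] q_apply 3 by (intro bexI[of _ "q \<circ> q"]) simp_all
      next
        case 4
        show ?thesis using comp[OF q_M comp[OF q_M q_M]] q_apply 4
          by (intro bexI[of _ "q \<circ> (q \<circ> q)"]) simp_all
      qed
    qed
    obtain g where g: "g \<in> M" "g a = a" "g b = b" "g c = w" using 1[OF w(1)] by blast
    obtain h where h: "h \<in> M" "h a = a" "h b = b" "h c = w'" using 1[OF w(2)] by blast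
    have "inv' g a = a" "inv' g b = b" "inv' g w = c"
      using M_simps(2)[OF g(1), of a] M_simps(2)[OF g(1), of b] M_simps(2)[OF g(1), of c] g by simp_all
    then show ?thesis using comp[OF h(1) perm_groupD(4)[OF M g(1)]] h
      by (intro bexI[of _ "h \<circ> inv' g"]) simp_all
  qed
  have orbita: "\<exists>m\<in>M. m a = w" if w: "w \<in> X" for w
  proof -
    have ab: "\<exists>m\<in>M. m a = p" if "p \<in> {a, b}" for p
      using that perm_groupD(2)[OF M] dtr_M(2) v_apply(1) by (metis id_apply insertE singletonD)
    show ?thesis
    proof (cases "w \<in> {a, b}")
      case True
      then show ?thesis by (rule ab)
    next
      case False
      obtain g where g: "g \<in> M" "g a = m1 z" using ab[OF z(2)] by blast
      have i: "inv' m1 (g a) = z" using M_simps(2)[OF m1(1), of z] g(2) by simp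
      obtain h where h: "h \<in> M" "h z = w" using orbZ[of z w] z(1) False w Z by blast
      have "h \<circ> (inv' m1 \<circ> g) \<in> M" using comp[OF h(1) comp[OF perm_groupD(4)[OF M m1(1)] g(1)]] .
      then show ?thesis using i h(2) by (intro bexI[of _ "h \<circ> (inv' m1 \<circ> g)"]) simp_all
    qed
  qed
  show ?thesis
  proof (cases "\<exists>m\<in>M. m a = a \<and> m b \<noteq> b")
    case True
    then obtain m where m: "m \<in> M" "m a = a" "m b \<noteq> b" by blast
    obtain g where g: "g \<in> M" "g a = x" using orbita[OF xy(1)] by blast
    let ?w = "inv' g y"
    have gw: "g ?w = y" using M_simps(1)[OF g(1)] .
    have wa: "?w \<noteq> a" using gw g(2) xy(3) by auto
    have wX: "?w \<in> X" using M_simps(5)[OF g(1)] xy(2) by blast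
    show ?thesis
    proof (cases "?w = b")
      case True
      then show ?thesis using g gw by auto
    next
      case False
      have "m b \<noteq> a" using m(2) M_simps(3)[OF m(1), of b a] dist by auto
      moreover have "m b \<in> X" using M_simps(4)[OF m(1), of b] by (simp add: X_def)
      ultimately have "m b \<in> {c, c', d, d'}" using m(3) Z by blast
      moreover have "?w \<in> {c, c', d, d'}" using False wa wX Z by blast
      ultimately obtain h where h: "h \<in> M" "h a = a" "h (m b) = ?w" using orbZ by blast
      have "g \<circ> (h \<circ> m) \<in> M" using comp[OF g(1) comp[OF h(1) m(1)]] .
      then show ?thesis using g gw h m by (intro bexI[of _ "g \<circ> (h \<circ> m)"]) simp_all
    qed
  next
    case False
    then have fixb: "m b = b" if "m \<in> M" "m a = a" for m using that by blast
    have 1: "g b = h b" if "g \<in> M" "h \<in> M" "g a = h a" for g h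
    proof -
      have "(inv' h \<circ> g) a = a" using M_simps(2)[OF that(2), of a] that(3) by simp
      then have "inv' h (g b) = b" using fixb[OF comp[OF perm_groupD(4)[OF M that(2)] that(1)]] by simp
      then show ?thesis using M_simps(1)[OF that(2), of "g b"] by simp
    qed
    have 2: "g b = h a" if "g \<in> M" "h \<in> M" "g a = h b" for g h
      using 1[OF that(1) comp[OF that(2) dtr_M(2)]] that(3) by (simp add: v_apply)
    have 3: "g a = h a" if "g \<in> M" "h \<in> M" "g b = h b" for g h
      using 1[OF comp[OF that(1) dtr_M(2)] comp[OF that(2) dtr_M(2)]] that(3) by (simp add: v_apply)
    have share: "g ` {a, b} = h ` {a, b}"
      if gh: "g \<in> M" "h \<in> M" and p: "p \<in> g ` {a, b}" "p \<in> h ` {a, b}" for g h p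
    proof -
      consider "g a = h a" | "g a = h b" | "g b = h a" | "g b = h b" using p by auto
      then show ?thesis
      proof cases
        case 1
        then show ?thesis using \<open>g a = h a\<close> \<open>\<And>h g. _ \<Longrightarrow> _ \<Longrightarrow> g a = h a \<Longrightarrow> g b = h b\<close>[OF gh] by simp
      next
        case 2
        then show ?thesis using \<open>\<And>h g. _ \<Longrightarrow> _ \<Longrightarrow> g a = h b \<Longrightarrow> g b = h a\<close>[OF gh] by auto
      next
        case 3
        then show ?thesis using \<open>\<And>h g. _ \<Longrightarrow> _ \<Longrightarrow> g a = h b \<Longrightarrow> g b = h a\<close>[OF gh(2,1)] by auto
      next
        case 4
        then show ?thesis using \<open>\<And>h g. _ \<Longrightarrow> _ \<Longrightarrow> g b = h b \<Longrightarrow> g a = h a\<close>[OF gh] by simp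
      qed
    qed
    have idM: "id \<in> M" by (rule perm_groupD(2)[OF M])
    obtain g where g: "g \<in> M" "g a = c" using orbita[of c] by (auto simp: X_def)
    have gb: "g b = c'"
    proof -
      have "g b \<noteq> c" using g(2) M_simps(3)[OF g(1), of b a] dist by auto
      moreover have "g b \<in> X" using M_simps(4)[OF g(1), of b] by (simp add: X_def)
      moreover have "g b \<notin> {a, b}"
      proof
        assume "g b \<in> {a, b}"
        then have "g ` {a, b} = id ` {a, b}" using share[OF g(1) idM, of "g b"] by simp
        then have "g a \<in> id ` {a, b}" by blast
        then show False using g(2) dist by auto
      qed
      \<comment> \<open>\<open>dtr a b c c'\<close> fixes \<open>d\<close> and \<open>d'\<close> but
        moves \<open>c = g a\<close>, so no block contains \<open>c\<close> together with one of
        them.\<close>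
      moreover have "g b \<notin> {d, d'}"
      proof
        assume "g b \<in> {d, d'}"
        then have "(dtr a b c c' \<circ> g) b = g b" using v_apply by auto
        then have "(dtr a b c c' \<circ> g) a = g a" using 3[OF comp[OF dtr_M(2) g(1)] g(1)] by simp
        then show False using g(2) v_apply dist by simp
      qed
      ultimately show ?thesis by (auto simp: X_def)
    qed
    have Pc: "g ` {a, b} = {c, c'}" using g gb by simp
    have Pd: "(q \<circ> g) ` {a, b} = {d, d'}" using g gb q_apply by simp
    have Pa: "id ` {a, b} = {a, b}" by simp
    let ?\<C> = "{{a, b}, {c, c'}, {d, d'}}"
    have P: "m ` {a, b} \<in> ?\<C>" if m: "m \<in> M" for m
    proof -
      have "m a \<in> X" using M_simps(4)[OF m, of a] by (simp add: X_def)
      then have "m a \<in> id ` {a, b} \<or> m a \<in> g ` {a, b} \<or> m a \<in> (q \<circ> g) ` {a, b}"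
        unfolding Pa Pc Pd by (simp add: X_def)
      moreover have ma: "m a \<in> m ` {a, b}" by simp
      ultimately consider "m ` {a, b} = id ` {a, b}" | "m ` {a, b} = g ` {a, b}"
        | "m ` {a, b} = (q \<circ> g) ` {a, b}"
        using share[OF m idM ma] share[OF m g(1) ma] share[OF m comp[OF q_M g(1)] ma] by argo
      then show ?thesis unfolding Pa Pc Pd by cases simp_all
    qed
    have "(m2 \<circ> g) ` {a, b} = m2 ` {c, c'}" "(m2 \<circ> (q \<circ> g)) ` {a, b} = m2 ` {d, d'}"
      using g gb q_apply by simp_all
    then have "m2 ` {a, b} \<in> ?\<C>" "m2 ` {c, c'} \<in> ?\<C>" "m2 ` {d, d'} \<in> ?\<C>"
      using P[OF m2(1)] P[OF comp[OF m2(1) g(1)]] P[OF comp[OF m2(1) comp[OF q_M g(1)]]]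
      by (simp_all only:)
    then have "(`) m2 ` ?\<C> \<subseteq> ?\<C>" by simp
    moreover have "inj_on ((`) m2) ?\<C>"
      using permutes_inj[OF perm_groupD(1)[OF M m2(1)]] by (intro inj_onI) (simp only: inj_image_eq_iff)
    ultimately have "(`) m2 ` ?\<C> = ?\<C>" by (intro endo_inj_surj) simp_all
    then show ?thesis using m2(2) by blast
  qed
qed

text \<open>As \<open>q\<close> is odd and fixes \<open>a\<close> and \<open>b\<close>, already the
  even elements of \<open>M\<close> are transitive on ordered pairs. One of them corrects
  \<open>n\<close> to an element \<open>n2\<close> of \<open>N\<close> outside \<open>M\<close> that
  fixes \<open>a\<close> and \<open>b\<close>. It produces all double transpositions on the other
  four points, and transitivity on pairs spreads these over \<open>X\<close>.\<close>

lemma three_cycles_if_pair_transitive: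
  assumes trans: "\<And>x y. x \<in> X \<Longrightarrow> y \<in> X \<Longrightarrow> x \<noteq> y \<Longrightarrow> \<exists>m\<in>M. m a = x \<and> m b = y"
    and N: "perm_group X N" and MN: "\<And>p. p \<in> M \<Longrightarrow> evenperm p \<Longrightarrow> p \<in> N"
    and ev: "\<And>p. p \<in> N \<Longrightarrow> evenperm p" and n: "n \<in> N" "n \<notin> M"
    and uvw: "{u, v, w} \<subseteq> X" "distinct [u, v, w]"
  shows "cyc3 u v w \<in> N"
proof -
  have perm: "permutation p" if "p permutes X" for p using that finite_X permutation_permutes by blast
  have trans': "\<exists>m\<in>N. m \<in> M \<and> m a = x \<and> m b = y" if xy: "x \<in> X" "y \<in> X" "x \<noteq> y" for x y
  proof -
    obtain m where m: "m \<in> M" "m a = x" "m b = y" using trans[OF xy] by blast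
    show ?thesis
    proof (cases "evenperm m")
      case True
      then show ?thesis using m MN by blast
    next
      case False
      have "evenperm (m \<circ> q) = (evenperm m = evenperm q)"
        using perm perm_groupD(1)[OF M] m(1) q_M by (intro evenperm_comp) blast+
      then have "evenperm (m \<circ> q)" using False odd_cyc4[OF dist4(1)] by (simp add: q_def)
      moreover have mq: "m \<circ> q \<in> M" using perm_group_compose2[OF M m(1) q_M] .
      ultimately have "m \<circ> q \<in> N" using MN by blast
      then show ?thesis using mq m q_apply by (intro bexI[of _ "m \<circ> q"]) simp_all
    qed
  qed
  have aX: "a \<in> X" "b \<in> X" "a \<noteq> b" using dist by (auto simp: X_def)
  have v1: "dtr c c' d d' \<in> N" "dtr a b c c' \<in> N"
    using MN[OF dtr_M(1)] MN[OF dtr_M(2)] dist by (simp_all add: evenperm_dtr)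
  obtain m where m: "m \<in> N" "m \<in> M" "m a = n a" "m b = n b"
    using trans'[of "n a" "n b"] perm_group_simps(3,4)[OF N n(1)] aX by metis
  define n2 where "n2 = inv' m \<circ> n"
  have n2N: "n2 \<in> N" unfolding n2_def
    by (rule perm_group_compose2[OF N perm_groupD(4)[OF N m(1)] n(1)])
  have n2a: "n2 a = a" "n2 b = b"
    using M_simps(2)[OF m(2), of a] M_simps(2)[OF m(2), of b] m(3,4) by (simp_all add: n2_def)
  have n2M: "n2 \<notin> M"
  proof
    assume "n2 \<in> M"
    then have "m \<circ> n2 \<in> M" by (rule perm_group_compose2[OF M m(2)])
    moreover have "m \<circ> n2 = n" using M_simps(1)[OF m(2)] by (simp add: n2_def fun_eq_iff)
    ultimately show False using n(2) by simp
  qed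
  have n2p: "n2 permutes X" using perm_groupD(1)[OF N n2N] .
  have inj: "n2 x = n2 y \<longleftrightarrow> x = y" for x y using perm_group_simps(3)[OF N n2N] .
  have Z: "X - {a, b} = {c, c', d, d'}" using dist by (auto simp: X_def)
  have imZ: "{n2 c, n2 c', n2 d, n2 d'} = {c, c', d, d'}"
  proof -
    have "n2 ` (X - {a, b}) = n2 ` X - n2 ` {a, b}"
      using permutes_inj[OF n2p] by (rule image_set_diff)
    also have "\<dots> = X - {a, b}" using permutes_image[OF n2p] n2a by simp
    finally show ?thesis unfolding Z by simp
  qed
  have dn: "distinct [n2 c, n2 c', n2 d, n2 d']" using dist4 by (simp add: inj)
  have four: "dtr c d c' d' \<in> N \<and> dtr c d' c' d \<in> N"
  proof -
    have prod: "dtr c d c' d' \<circ> dtr c c' d d' = dtr c d' c' d"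
      "dtr c d' c' d \<circ> dtr c c' d d' = dtr c d c' d'"
      using dist4(2) by (auto simp: dtr_def transpose_def fun_eq_iff)
    have either: ?thesis if "dtr c d c' d' \<in> N \<or> dtr c d' c' d \<in> N"
      using that
    proof
      assume "dtr c d c' d' \<in> N"
      then show ?thesis using perm_group_compose2[OF N _ v1(1), of "dtr c d c' d'"] prod by simp
    next
      assume "dtr c d' c' d \<in> N"
      then show ?thesis using perm_group_compose2[OF N _ v1(1), of "dtr c d' c' d"] prod by simp
    qed
    have conj: "dtr (n2 c) (n2 c') (n2 d) (n2 d') \<in> N"
      by (rule perm_group_dtr_conj[OF N v1(1) n2N])
    moreover have "dtr (n2 c) (n2 c') (n2 d) (n2 d') \<in> {dtr c c' d d', dtr c d c' d', dtr c d' c' d}"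
      by (rule dtr_on_four[OF dist4(2) imZ dn])
    \<comment> \<open>Now \<open>n2\<close> commutes with \<open>dtr c c' d d'\<close>, so on the
      four points it lies in a dihedral group of order 8. If it keeps both pairs it is in
      \<open>M\<close>, being even; the two 4-cycles are in \<open>M\<close> as well. The remaining
      two elements are double transpositions of the kind sought.\<close>
    moreover have ?thesis if eq: "dtr (n2 c) (n2 c') (n2 d) (n2 d') = dtr c c' d d'"
    proof -
      have ap: "dtr c c' d d' (n2 c) = n2 c'" "dtr c c' d d' (n2 d) = n2 d'"
        unfolding eq[symmetric] using dn by (auto simp: dtr_apply)
      have cc: "n2 c \<in> {c, c', d, d'}" "n2 d \<in> {c, c', d, d'}" using imZ by blast+
      have vv: "dtr c c' d d' c = c'" "dtr c c' d d' c' = c" "dtr c c' d d' d = d'" "dtr c c' d d' d' = d"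
        using dist4(2) by (auto simp: dtr_apply)
      have nab: "n2 ` {a, b} = {a, b}" using n2a by simp
      have n2_out: "n2 p = p" if "p \<notin> {c, c', d, d'}" for p
        using that n2a permutes_not_in[OF n2p, of p] Z by blast
      show ?thesis
      proof (cases "n2 c \<in> {c, c'}")
        case True
        then have nc: "n2 ` {c, c'} = {c, c'}" using ap vv by auto
        have "n2 d \<notin> {n2 c, n2 c'}" using dn by auto
        then have "n2 d \<in> {d, d'}" using cc(2) nc by auto
        then have "n2 ` {d, d'} = {d, d'}" using ap vv by auto
        then have "n2 \<in> M" using even_M[OF n2p ev[OF n2N] nc _ nab] by blast
        then show ?thesis using n2M by blast
      next
        case False
        then have nc: "n2 c \<in> {d, d'}" using cc by blast
        then have nc': "{n2 c, n2 c'} = {d, d'}" using ap(1) vv by auto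
        have nd: "n2 d \<in> {c, c'}"
        proof -
          have "n2 d \<notin> {n2 c, n2 c'}" using dn by auto
          then show ?thesis using cc(2) unfolding nc' by blast
        qed
        have eqI: "n2 = f" if "f c = n2 c" "f c' = n2 c'" "f d = n2 d" "f d' = n2 d'"
          "\<And>p. p \<notin> {c, c', d, d'} \<Longrightarrow> f p = p" for f
        proof
          fix p
          show "n2 p = f p" using that n2_out[of p] by (cases "p \<in> {c, c', d, d'}") auto
        qed
        consider "n2 c = d" "n2 d = c" | "n2 c = d" "n2 d = c'" | "n2 c = d'" "n2 d = c" | "n2 c = d'" "n2 d = c'"
          using nc nd by blast
        then show ?thesis
        proof cases
          case 1
          then have "n2 c' = d'" "n2 d' = c'" using ap vv by simp_all
          then have "n2 = dtr c d c' d'" using 1 dist4(1) by (intro eqI) (auto simp: dtr_apply)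
          then show ?thesis using either n2N by simp
        next
          case 2
          then have "n2 c' = d'" "n2 d' = c" using ap vv by simp_all
          then have "n2 = q" using 2 q_apply cyc4_apply(5)[OF dist4(1)] by (intro eqI) (auto simp: q_def)
          then show ?thesis using n2M q_M by simp
        next
          case 3
          then have "n2 c' = d" "n2 d' = c'" using ap vv by simp_all
          then have "n2 = dtr c c' d d' \<circ> q"
            using 3 q_apply cyc4_apply(5)[OF dist4(1)] vv dist4(2)
            by (intro eqI) (auto simp: q_def dtr_apply)
          then show ?thesis using n2M perm_group_compose2[OF M dtr_M(1) q_M] by simp
        next
          case 4
          then have "n2 c' = d" "n2 d' = c" using ap vv by simp_all
          then have "n2 = dtr c d' c' d" using 4 dist4(1) by (intro eqI) (auto simp: dtr_apply)
          then show ?thesis using either n2N by simp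
        qed
      qed
    qed
    ultimately show ?thesis using either by auto
  qed
  have five: "dtr p1 p2 p3 p4 \<in> N" if "{p1, p2, p3, p4} = {c, c', d, d'}" "distinct [p1, p2, p3, p4]"
    for p1 p2 p3 p4
    using dtr_on_four[OF dist4(2) that] four v1(1) by auto
  have all: "dtr p1 p2 p3 p4 \<in> N" if P: "{p1, p2, p3, p4} \<subseteq> X" "distinct [p1, p2, p3, p4]"
    for p1 p2 p3 p4
  proof -
    have "card (X - {p1, p2, p3, p4}) = 2" using P card_X by (simp add: card_Diff_subset)
    then obtain x y where xy: "X - {p1, p2, p3, p4} = {x, y}" "x \<noteq> y" by (auto simp: card_2_iff)
    then obtain h where h: "h \<in> N" "h a = x" "h b = y" using trans'[of x y] by blast
    let ?g = "inv' h"
    have g: "?g permutes X" using perm_groupD(1)[OF N perm_groupD(4)[OF N h(1)]] .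
    have gxy: "?g x = a" "?g y = b"
      using perm_group_simps(2)[OF N h(1), of a] perm_group_simps(2)[OF N h(1), of b] h by simp_all
    have "?g ` {p1, p2, p3, p4} = ?g ` (X - {x, y})" using P(1) xy(1) by (metis double_diff subset_refl)
    also have "\<dots> = ?g ` X - ?g ` {x, y}" using permutes_inj[OF g] by (rule image_set_diff)
    also have "\<dots> = {c, c', d, d'}" using permutes_image[OF g] gxy Z by simp
    finally have "{?g p1, ?g p2, ?g p3, ?g p4} = {c, c', d, d'}" by simp
    moreover have "distinct [?g p1, ?g p2, ?g p3, ?g p4]"
      using P(2) perm_group_simps(3)[OF N perm_groupD(4)[OF N h(1)]] by simp
    ultimately have "dtr (?g p1) (?g p2) (?g p3) (?g p4) \<in> N" by (rule five)
    from perm_group_dtr_conj[OF N this h(1)] show ?thesis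
      using perm_group_simps(1)[OF N h(1)] by simp
  qed
  show ?thesis
    by (rule three_cycles_if_dtrs[OF N finite_X _ all uvw]) (simp_all add: card_X)
qed

end

section \<open>Maximal subgroups and primitive actions\<close>

lemma perm_group_Sym: "perm_group X {p. p permutes X}"
  by (rule perm_groupI) (auto intro: permutes_id permutes_compose permutes_inv)

lemma perm_group_even: "finite X \<Longrightarrow> perm_group X {p. p permutes X \<and> evenperm p}"
proof -
  assume X: "finite X"
  have perm: "permutation p" if "p permutes X" for p using that X permutation_permutes by blast
  have "perm_group X {p \<in> {p. p permutes X}. evenperm p}"
    by (rule perm_group_stab[OF perm_group_Sym]) (auto simp: evenperm_comp evenperm_inv perm)
  then show ?thesis by simp
qed

lemma perm_group_family_stabilizer: "perm_group X {p. p permutes X \<and> (`) p ` \<C> = \<C>}"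
proof -
  have "perm_group X {p \<in> {p. p permutes X}. (`) p ` \<C> = \<C>}"
  proof (rule perm_group_stab[OF perm_group_Sym])
    show "(`) (inv' g) ` \<C> = \<C>" if "g \<in> {p. p permutes X}" "(`) g ` \<C> = \<C>" for g
    proof -
      have "inv' g ` (g ` S) = S" for S using permutes_inj[of g X] that(1) by (simp add: image_inv_f_f)
      then have "(`) (inv' g) ` ((`) g ` \<C>) = \<C>" by (simp add: image_image)
      then show ?thesis using that(2) by simp
    qed
    show "(`) (g \<circ> h) ` \<C> = \<C>" if "(`) g ` \<C> = \<C>" "(`) h ` \<C> = \<C>" for g h :: "'a \<Rightarrow> 'a"
    proof -
      have "(`) (g \<circ> h) ` \<C> = (`) g ` ((`) h ` \<C>)" by (simp add: image_image image_comp[symmetric])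
      then show ?thesis using that by simp
    qed
  qed simp
  then show ?thesis by simp
qed

lemma perm_group_set_stabilizer: "perm_group X {p. p permutes X \<and> p ` S = S}"
  using perm_group_family_stabilizer[of X "{S}"] by simp

lemma exists_swap:
  assumes "finite C" "finite D" "card C = card D" "C \<inter> D = {}"
  shows "\<exists>s. s permutes (C \<union> D) \<and> s ` C = D \<and> s ` D = C"
proof -
  obtain f where f: "bij_betw f C D" using finite_same_card_bij assms by blast
  let ?g = "inv_into C f"
  define s where "s p = (if p \<in> C then f p else if p \<in> D then ?g p else p)" for p
  have g: "bij_betw ?g D C" using f by (rule bij_betw_inv_into)
  have sC: "s p \<in> D" if "p \<in> C" for p using f that by (auto simp: s_def bij_betw_def)
  have sD: "s p \<in> C" if "p \<in> D" for p
    using g that assms(4) by (auto simp: s_def bij_betw_def)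
  have ss: "s (s p) = p" for p
  proof -
    consider "p \<in> C" | "p \<in> D" | "p \<notin> C \<union> D" by blast
    then show ?thesis
    proof cases
      case 1
      have "f p \<in> D" "f p \<notin> C" using sC[OF 1] 1 assms(4) by (auto simp: s_def)
      then show ?thesis using 1 bij_betw_inv_into_left[OF f 1] by (simp add: s_def)
    next
      case 2
      have "p \<notin> C" using 2 assms(4) by auto
      then have "?g p \<in> C" using sD[OF 2] 2 by (simp add: s_def)
      then show ?thesis using 2 \<open>p \<notin> C\<close> bij_betw_inv_into_right[OF f 2] by (simp add: s_def)
    next
      case 3
      then show ?thesis by (simp add: s_def)
    qed
  qed
  have "bij s" using ss by (metis bijI' )
  then have "s permutes (C \<union> D)" unfolding permutes_def bij_iff by (auto simp: s_def)
  moreover have "D \<subseteq> s ` C"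
  proof
    fix p assume "p \<in> D"
    then show "p \<in> s ` C" using sD ss by (metis imageI)
  qed
  moreover have "C \<subseteq> s ` D"
  proof
    fix p assume "p \<in> C"
    then show "p \<in> s ` D" using sC ss by (metis imageI)
  qed
  ultimately show ?thesis using sC sD by blast
qed

text \<open>In substance \<open>N\<close> is the whole alternating group, so the even part of
  \<open>M\<close> is maximal there. Maximality of \<open>M\<close> serves to identify it: if
  \<open>M\<close> preserves the pair {a, b}, or the three pairs, it is the full stabilizer of that
  structure, and then \<open>n\<close>, lying outside \<open>M\<close>, must break the
  structure.\<close>

lemma three_cycles_in_overgroup:
  assumes fin: "finite X" and X: "X = C \<union> D \<union> {a, b}" "C \<inter> D = {}" "a \<notin> C \<union> D" "b \<notin> C \<union> D" "a \<noteq> b"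
    and card: "card C = card D" "2 \<le> card C"
    and M: "perm_group X M"
    and even_M: "\<And>p. \<lbrakk>p permutes X; evenperm p; p ` C = C; p ` D = D; p ` {a, b} = {a, b}\<rbrakk> \<Longrightarrow> p \<in> M"
    and odd_M: "\<And>p. \<lbrakk>p permutes X; \<not> evenperm p; p ` C = D; p ` D = C; p ` {a, b} = {a, b}\<rbrakk> \<Longrightarrow> p \<in> M"
    and maximal: "\<And>K. perm_group X K \<Longrightarrow> M \<subseteq> K \<Longrightarrow> K = M \<or> K = {p. p permutes X}"
    and proper: "M \<noteq> {p. p permutes X}"
    and N: "perm_group X N" and MN: "\<And>p. p \<in> M \<Longrightarrow> evenperm p \<Longrightarrow> p \<in> N"
    and ev: "\<And>p. p \<in> N \<Longrightarrow> evenperm p" and n: "n \<in> N" "n \<notin> M"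
    and uvw: "{u, v, w} \<subseteq> X" "distinct [u, v, w]"
  shows "cyc3 u v w \<in> N"
proof -
  have finC: "finite C" "finite D" using fin X by simp_all
  have abX: "a \<in> X" "b \<in> X" using X by auto
  have Xab: "X - {a, b} = C \<union> D" using X by auto
  have cardX: "6 \<le> card X"
  proof -
    have "card X = card (C \<union> D) + card {a, b}" unfolding X(1)
      using finC X by (intro card_Un_disjoint) auto
    also have "card (C \<union> D) = card C + card D" using finC X by (intro card_Un_disjoint)
    finally show ?thesis using card X(5) by simp
  qed
  have perm: "permutation p" if "p permutes X" for p using that fin permutation_permutes by blast
  have nX: "n permutes X" by (rule perm_groupD(1)[OF N n(1)])
  obtain z1 z2 where z: "z1 \<in> C" "z2 \<in> C" "z1 \<noteq> z2"
  proof -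
    obtain T where "T \<subseteq> C" "card T = 2" using obtain_subset_with_card_n[OF card(2)] by metis
    then show ?thesis using that by (auto simp: card_2_iff)
  qed
  let ?e = "dtr a b z1 z2"
  have zd: "distinct [a, b, z1, z2]" using z X by auto
  have e_ap: "?e a = b" "?e b = a" using zd by (auto simp: dtr_apply)
  have eX: "?e permutes X" "evenperm ?e" using z X zd by (auto intro!: dtr_permutes simp: evenperm_dtr)
  have eC: "?e ` C = C"
  proof (rule endo_inj_surj[OF finC(1)])
    show "?e ` C \<subseteq> C" using zd z X by (auto simp: dtr_apply)
    show "inj_on ?e C" using permutes_inj[OF eX(1)] inj_on_subset by blast
  qed
  have eD: "?e ` D = D"
  proof -
    have "?e p = p" if "p \<in> D" for p using that zd z X by (auto simp: dtr_apply)
    then show ?thesis by simp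
  qed
  have eM: "?e \<in> M" using e_ap by (intro even_M[OF eX eC eD]) auto
  show ?thesis
  proof (cases "\<exists>m\<in>M. m ` {a, b} \<noteq> {a, b}")
    case False
    let ?K = "{p. p permutes X \<and> p ` {a, b} = {a, b}}"
    have "M \<subseteq> ?K" using False perm_groupD(1)[OF M] by blast
    moreover have "transpose a z1 permutes X" "transpose a z1 ` {a, b} \<noteq> {a, b}"
      using z X by (auto intro!: permutes_swap_id simp: transpose_def)
    ultimately have MK: "M = ?K" using maximal[OF perm_group_set_stabilizer[of X "{a, b}"]] by blast
    show ?thesis
    proof (rule three_cycles_if_moves_pair[OF N fin _ abX X(5) _ MN[OF eM eX(2)] e_ap n(1) _ uvw])
      show "n ` {a, b} \<noteq> {a, b}" using n(2) nX unfolding MK by blast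
      show "cyc3 x y z \<in> N" if xyz: "{x, y, z} \<subseteq> X - {a, b}" "distinct [x, y, z]" for x y z
      proof (rule MN)
        have "cyc3 x y z a = a" "cyc3 x y z b = b" using xyz by (auto simp: cyc3_apply)
        then show "cyc3 x y z \<in> M" unfolding MK using xyz by (auto intro: cyc3_permutes)
        show "evenperm (cyc3 x y z)" using xyz(2) by (rule evenperm_cyc3)
      qed
    qed (use cardX in simp)
  next
    case True
    then obtain m where m: "m \<in> M" "m ` {a, b} \<noteq> {a, b}" by blast
    show ?thesis
    proof (cases "3 \<le> card C")
      case True
      have three: "cyc3 x y z \<in> M" if xyz: "{x, y, z} \<subseteq> E" "distinct [x, y, z]" "E = C \<or> E = D" for x y z E
      proof (rule even_M)
        let ?c = "cyc3 x y z"
        show cX: "?c permutes X" using xyz(1,3) X(1) by (intro cyc3_permutes) blast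
        show "evenperm ?c" using xyz(2) by (rule evenperm_cyc3)
        have out: "?c p = p" if "p \<notin> E" for p using that xyz(1,2) by (auto simp: cyc3_apply)
        have "?c permutes E" using xyz(1) by (rule cyc3_permutes)
        then have E: "?c ` E = E" by (rule permutes_image)
        have other: "?c ` S = S" if "S \<inter> E = {}" for S
        proof -
          have "\<forall>p\<in>S. ?c p = p" using that out by blast
          then show ?thesis by simp
        qed
        show "?c ` C = C" "?c ` D = D" "?c ` {a, b} = {a, b}"
          using xyz(3) E other[of C] other[of D] other[of "{a, b}"] X(2-4) Int_commute[of D C] by blast+
      qed
      obtain s0 where s0: "s0 permutes (C \<union> D)" "s0 ` C = D" "s0 ` D = C"
        using exists_swap[OF finC card(1) X(2)] by blast
      have s0X: "s0 permutes X" using permutes_subset[OF s0(1), of X] X(1) by blast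
      have s0ab: "s0 a = a" "s0 b = b" using permutes_not_in[OF s0(1)] X by auto
      \<comment> \<open>\<open>odd_M\<close> accepts only odd permutations; an even exchange of
        \<open>C\<close> and \<open>D\<close> is corrected by the transposition of \<open>a\<close>
        and \<open>b\<close>.\<close>
      obtain s where s: "s permutes X" "\<not> evenperm s" "s ` C = D" "s ` D = C" "s ` {a, b} = {a, b}"
      proof (cases "evenperm s0")
        case False
        then show ?thesis using that[OF s0X False s0(2,3)] s0ab by simp
      next
        case True
        let ?s = "transpose a b \<circ> s0"
        have tC: "transpose a b ` S = S" if "S \<subseteq> C \<union> D" for S
        proof -
          have "\<forall>p\<in>S. transpose a b p = p" using that X by (auto simp: transpose_def)
          then show ?thesis by simp
        qed
        have "?s permutes X" using s0X abX by (intro permutes_compose permutes_swap_id)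
        moreover have "\<not> evenperm ?s"
          using True X(5) by (simp add: evenperm_comp permutation_swap_id perm[OF s0X] evenperm_swap)
        moreover have "?s ` C = D" "?s ` D = C"
          using s0(2,3) tC[of C] tC[of D] by (simp_all only: image_comp[symmetric] Un_upper1 Un_upper2)
        moreover have "?s ` {a, b} = {a, b}" using s0ab by auto
        ultimately show ?thesis by (rule that)
      qed
      have sM: "s \<in> M" by (rule odd_M[OF s])
      \<comment> \<open>All 3-cycles and the odd element \<open>s\<close> make \<open>M\<close> the
        symmetric group. So with three points in \<open>C\<close>, a proper \<open>M\<close> cannot
        move {a, b}.\<close>
      have cM: "cyc3 x y z \<in> M" if "{x, y, z} \<subseteq> X" "distinct [x, y, z]" for x y z
        by (rule three_cycles_if_moves_pair'[OF M fin abX X(5) Xab True _ _ _ eM e_ap eC eD sM s(5,3,4) m that])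
          (use True card three in auto)
      have evM: "p \<in> M" if "p permutes X" "evenperm p" for p
        using evenperm_mem_if_three_cycles[OF M fin cM that] by blast
      have "p \<in> M" if p: "p permutes X" for p
      proof (cases "evenperm p")
        case False
        have i: "inv' s permutes X" using permutes_inv[OF s(1)] .
        have "evenperm (p \<circ> inv' s)"
          using False s(2) by (simp add: evenperm_comp perm[OF p] perm[OF i] evenperm_inv perm[OF s(1)])
        then have "p \<circ> inv' s \<in> M" using evM[OF permutes_compose[OF i p]] by blast
        then have "p \<circ> inv' s \<circ> s \<in> M" by (rule perm_group_compose2[OF M _ sM])
        then show ?thesis using permutes_inv_o(2)[OF s(1)] by (simp add: comp_assoc)
      qed (use evM p in blast)
      then have "M = {p. p permutes X}" using perm_groupD(1)[OF M] by blast
      then show ?thesis using proper by blast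
    next
      case False
      then have "card C = 2" "card D = 2" using card by simp_all
      then obtain c c' d d' where CD: "C = {c, c'}" "c \<noteq> c'" "D = {d, d'}" "d \<noteq> d'"
        by (auto simp: card_2_iff)
      interpret six_points X a b c c' d d' M
      proof
        show "X = {a, b, c, c', d, d'}" unfolding X(1) CD by auto
        show "distinct [a, b, c, c', d, d']" using X CD by auto
        show "perm_group X M" by (rule M)
        show "p \<in> M" if "p permutes X" "evenperm p" "p ` {c, c'} = {c, c'}" "p ` {d, d'} = {d, d'}"
          "p ` {a, b} = {a, b}" for p
          using even_M[unfolded CD(1,3), OF that] .
        show "p \<in> M" if "p permutes X" "\<not> evenperm p" "p ` {c, c'} = {d, d'}" "p ` {d, d'} = {c, c'}"
          "p ` {a, b} = {a, b}" for p
          using odd_M[unfolded CD(1,3), OF that] .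
      qed
      let ?\<C> = "{{a, b}, {c, c'}, {d, d'}}"
      define pres where "pres p \<longleftrightarrow> (`) p ` ?\<C> = ?\<C>" for p
      show ?thesis
      proof (cases "\<exists>m2\<in>M. \<not> pres m2")
        case True
        then obtain m2 where "m2 \<in> M" "\<not> pres m2" by blast
        then have m2: "m2 \<in> M" "(`) m2 ` ?\<C> \<noteq> ?\<C>" by (simp_all only: pres_def not_False_eq_True)
        have tr: "\<exists>m\<in>M. m a = x \<and> m b = y" if "x \<in> X" "y \<in> X" "x \<noteq> y" for x y
          by (rule pair_transitive_or_imprimitive[OF m m2 that])
        show ?thesis
          by (rule three_cycles_if_pair_transitive[OF tr N MN ev n uvw])
      next
        case False
        let ?K = "{p. p permutes X \<and> pres p}"
        have "M \<subseteq> ?K" using False perm_groupD(1)[OF M] by blast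
        moreover have "transpose a c permutes X" using X CD by (auto intro!: permutes_swap_id)
        moreover have "\<not> pres (transpose a c)"
        proof
          assume "pres (transpose a c)"
          moreover have "transpose a c ` {a, b} = {b, c}" using dist by auto
          moreover have "transpose a c ` {a, b} \<in> (`) (transpose a c) ` ?\<C>" by (intro imageI) simp
          ultimately have "{b, c} \<in> ?\<C>" by (simp only: pres_def)
          then show False using dist by (auto simp: doubleton_eq_iff)
        qed
        ultimately have MK: "M = ?K"
          using maximal[OF perm_group_family_stabilizer[of X ?\<C>, folded pres_def]] by blast
        have t: "three_pairs X ?\<C> a b c c' d d'"
          unfolding three_pairs_def using dist X_def by blast
        show ?thesis
        proof (rule three_cycles_if_moves_three_pairs[OF N t _ n(1) _ uvw])
          show "p \<in> N" if "p permutes X" "evenperm p" "(`) p ` ?\<C> = ?\<C>" for p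
          proof (rule MN)
            show "p \<in> M" unfolding MK using that(1,3) by (simp only: mem_Collect_eq pres_def)
          qed (rule that(2))
          show "(`) n ` ?\<C> \<noteq> ?\<C>" using n(2) nX unfolding MK mem_Collect_eq pres_def by blast
        qed
      qed
    qed
  qed
qed

section \<open>Block systems and stabilizers\<close>

lemma partition_on_trivialI:
  assumes R: "partition_on E R" and block: "\<And>B p. \<lbrakk>B \<in> R; p \<in> B; B \<noteq> E\<rbrakk> \<Longrightarrow> B = {p}"
  shows "R = {E} \<or> R = (\<lambda>x. {x}) ` E"
proof -
  have eq: "A = B" if "A \<in> R" "B \<in> R" "x \<in> A" "x \<in> B" for A B x
    using R that unfolding partition_on_def disjoint_def by blast
  have ne: "\<exists>x\<in>B. x \<in> E" if "B \<in> R" for B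
  proof -
    have "B \<noteq> {}" "B \<subseteq> E" using R that by (auto simp: partition_on_def)
    then show ?thesis by blast
  qed
  show ?thesis
  proof (cases "E \<in> R")
    case True
    have "R = {E}"
    proof
      show "R \<subseteq> {E}"
      proof
        fix B assume B: "B \<in> R"
        obtain x where "x \<in> B" "x \<in> E" using ne[OF B] by blast
        then show "B \<in> {E}" using eq[OF B True] by blast
      qed
    qed (use True in blast)
    then show ?thesis by blast
  next
    case False
    have sing: "B = {p}" if "B \<in> R" "p \<in> B" for B p using block[OF that] False that(1) by blast
    have "R = (\<lambda>x. {x}) ` E"
    proof
      show "R \<subseteq> (\<lambda>x. {x}) ` E"
      proof
        fix B assume B: "B \<in> R"
        obtain x where x: "x \<in> B" "x \<in> E" using ne[OF B] by blast
        then show "B \<in> (\<lambda>x. {x}) ` E" using sing[OF B x(1)] by blast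
      qed
      show "(\<lambda>x. {x}) ` E \<subseteq> R"
      proof
        fix B assume "B \<in> (\<lambda>x. {x}) ` E"
        then obtain x where x: "x \<in> E" "B = {x}" by blast
        have "x \<in> \<Union>R" using R x(1) by (simp add: partition_on_def)
        then obtain A where "A \<in> R" "x \<in> A" by blast
        then show "B \<in> R" using sing[of A x] x(2) by simp
      qed
    qed
    then show ?thesis by blast
  qed
qed

text \<open>The action stays abstract because on parts it will not be the natural one: odd
  permutations will act through their product with complementation.\<close>

locale perm_action =
  fixes X :: "'a set" and E :: "'p set" and act :: "('a \<Rightarrow> 'a) \<Rightarrow> 'p \<Rightarrow> 'p"
  assumes act_closed: "\<lbrakk>\<sigma> permutes X; p \<in> E\<rbrakk> \<Longrightarrow> act \<sigma> p \<in> E"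
    and act_id: "p \<in> E \<Longrightarrow> act id p = p"
    and act_comp: "\<lbrakk>\<sigma> permutes X; \<rho> permutes X; p \<in> E\<rbrakk> \<Longrightarrow> act (\<sigma> \<circ> \<rho>) p = act \<sigma> (act \<rho> p)"
begin

lemma act_inv: "\<sigma> permutes X \<Longrightarrow> p \<in> E \<Longrightarrow> act (inv' \<sigma>) (act \<sigma> p) = p"
  using act_comp[OF permutes_inv, of \<sigma> \<sigma> p] by (simp add: permutes_inv_o act_id)

lemma perm_group_stabilizer:
  assumes "p \<in> E"
  shows "perm_group X {\<sigma>. \<sigma> permutes X \<and> act \<sigma> p = p}"
proof -
  have "perm_group X {\<sigma> \<in> {\<sigma>. \<sigma> permutes X}. act \<sigma> p = p}"
    by (rule perm_group_stab[OF perm_group_Sym])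
      (use assms act_id act_comp act_inv in \<open>auto, metis\<close>)
  then show ?thesis by simp
qed

text \<open>The orbit of \<open>p\<close> under a group \<open>K\<close> above its stabilizer is a
  block, and its translates form an invariant partition. If the block is \<open>E\<close>, then
  \<open>K\<close> is everything, since \<open>K\<close> contains the stabilizer; if it is a single
  point, \<open>K\<close> is the stabilizer.\<close>

lemma stabilizer_maximal:
  assumes p: "p \<in> E"
    and trans: "\<And>q. q \<in> E \<Longrightarrow> \<exists>\<sigma>. \<sigma> permutes X \<and> act \<sigma> p = q"
    and prim: "\<And>R. partition_on E R \<Longrightarrow> (\<And>\<sigma> B. \<sigma> permutes X \<Longrightarrow> B \<in> R \<Longrightarrow> act \<sigma> ` B \<in> R) \<Longrightarrow>
      R = {E} \<or> R = (\<lambda>x. {x}) ` E"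
    and K: "perm_group X K" and MK: "{\<sigma>. \<sigma> permutes X \<and> act \<sigma> p = p} \<subseteq> K"
  shows "K = {\<sigma>. \<sigma> permutes X \<and> act \<sigma> p = p} \<or> K = {\<sigma>. \<sigma> permutes X}"
proof -
  let ?B = "(\<lambda>\<kappa>. act \<kappa> p) ` K"
  let ?R = "{act \<sigma> ` ?B | \<sigma>. \<sigma> permutes X}"
  have KX: "\<kappa> permutes X" if "\<kappa> \<in> K" for \<kappa> using perm_groupD(1)[OF K that] .
  have BE: "?B \<subseteq> E" using act_closed KX p by blast
  have pB: "p \<in> ?B" using perm_groupD(2)[OF K] act_id[OF p] by force
  have key: "\<sigma> \<in> K" if "\<kappa> \<in> K" "\<sigma> permutes X" "act \<sigma> p = act \<kappa> p" for \<sigma> \<kappa>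
  proof -
    have "act (inv' \<kappa> \<circ> \<sigma>) p = p"
      using act_comp[OF permutes_inv[OF KX[OF that(1)]] that(2) p] act_inv[OF KX[OF that(1)] p] that(3)
      by simp
    then have "inv' \<kappa> \<circ> \<sigma> \<in> K"
      using MK permutes_compose[OF that(2) permutes_inv[OF KX[OF that(1)]]] by blast
    then have "\<kappa> \<circ> (inv' \<kappa> \<circ> \<sigma>) \<in> K" by (rule perm_group_compose2[OF K that(1)])
    moreover have "\<kappa> \<circ> (inv' \<kappa> \<circ> \<sigma>) = \<sigma>"
      using permutes_inv_o(1)[OF KX[OF that(1)]] by (simp add: o_assoc)
    ultimately show ?thesis by simp
  qed
  have sub: "act \<sigma> ` ?B \<subseteq> act \<rho> ` ?B"
    if s: "\<sigma> permutes X" and r: "\<rho> permutes X" and x: "x \<in> act \<sigma> ` ?B" "x \<in> act \<rho> ` ?B" for \<sigma> \<rho> x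
  proof -
    obtain \<kappa> \<mu> where k: "\<kappa> \<in> K" "\<mu> \<in> K" "act \<sigma> (act \<kappa> p) = act \<rho> (act \<mu> p)" using x by auto
    have ir: "inv' \<rho> permutes X" using permutes_inv[OF r] .
    have c1: "inv' \<rho> \<circ> (\<sigma> \<circ> \<kappa>) permutes X"
      by (intro permutes_compose ir s KX k)
    have "act (inv' \<rho> \<circ> (\<sigma> \<circ> \<kappa>)) p = act \<mu> p"
      using act_comp[OF ir permutes_compose[OF KX[OF k(1)] s] p] act_comp[OF s KX[OF k(1)] p] k(3)
        act_inv[OF r act_closed[OF KX[OF k(2)] p]] by simp
    then have "inv' \<rho> \<circ> (\<sigma> \<circ> \<kappa>) \<in> K" by (rule key[OF k(2) c1])
    then have "inv' \<rho> \<circ> (\<sigma> \<circ> \<kappa>) \<circ> inv' \<kappa> \<in> K"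
      by (rule perm_group_compose2[OF K _ perm_groupD(4)[OF K k(1)]])
    moreover have "inv' \<rho> \<circ> (\<sigma> \<circ> \<kappa>) \<circ> inv' \<kappa> = inv' \<rho> \<circ> \<sigma>"
      using permutes_inv_o(1)[OF KX[OF k(1)]] by (simp add: comp_assoc)
    ultimately have g: "inv' \<rho> \<circ> \<sigma> \<in> K" by simp
    show ?thesis
    proof
      fix y assume "y \<in> act \<sigma> ` ?B"
      then obtain \<nu> where nu: "\<nu> \<in> K" "y = act \<sigma> (act \<nu> p)" by auto
      let ?t = "inv' \<rho> \<circ> \<sigma> \<circ> \<nu>"
      have t: "?t \<in> K" by (rule perm_group_compose2[OF K g nu(1)])
      have "act \<rho> (act ?t p) = act (\<rho> \<circ> ?t) p" using act_comp[OF r KX[OF t] p] by simp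
      also have "\<rho> \<circ> ?t = \<sigma> \<circ> \<nu>" using permutes_inv_o(1)[OF r] by (simp add: o_assoc)
      also have "act (\<sigma> \<circ> \<nu>) p = y" using act_comp[OF s KX[OF nu(1)] p] nu(2) by simp
      finally have "act \<rho> (act ?t p) = y" .
      moreover have "act \<rho> (act ?t p) \<in> act \<rho> ` ?B" using t by (intro imageI)
      ultimately show "y \<in> act \<rho> ` ?B" by simp
    qed
  qed
  have "partition_on E ?R"
  proof (rule partition_onI)
    show "\<Union>?R = E"
    proof
      show "\<Union>?R \<subseteq> E" using BE act_closed by blast
      show "E \<subseteq> \<Union>?R"
      proof
        fix q assume "q \<in> E"
        then obtain \<sigma> where "\<sigma> permutes X" "act \<sigma> p = q" using trans by blast
        then show "q \<in> \<Union>?R" using pB by blast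
      qed
    qed
    show "disjnt A B" if "A \<in> ?R" "B \<in> ?R" "A \<noteq> B" for A B
    proof (rule ccontr)
      assume "\<not> disjnt A B"
      then obtain x where "x \<in> A" "x \<in> B" by (auto simp: disjnt_def)
      then show False using that sub by blast
    qed
    show "{} \<notin> ?R" using pB by auto
  qed
  moreover have "act \<tau> ` B \<in> ?R" if t: "\<tau> permutes X" and B: "B \<in> ?R" for \<tau> B
  proof -
    obtain \<sigma> where s: "\<sigma> permutes X" "B = act \<sigma> ` ?B" using B by blast
    have "act \<tau> ` B = act (\<tau> \<circ> \<sigma>) ` ?B"
      unfolding s(2) image_image[of "act \<tau>"] using act_comp[OF t s(1)] BE by (intro image_cong) auto
    then show ?thesis using permutes_compose[OF s(1) t] by blast
  qed
  ultimately have cases: "?R = {E} \<or> ?R = (\<lambda>x. {x}) ` E" by (rule prim)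
  have BR: "?B \<in> ?R"
  proof -
    have "act id ` ?B = ?B" using BE act_id by force
    then show ?thesis using permutes_id by blast
  qed
  show ?thesis
    using cases
  proof
    assume R: "?R = {E}"
    have 1: "?B = E" using BR unfolding R by simp
    have "\<sigma> \<in> K" if "\<sigma> permutes X" for \<sigma>
    proof -
      have "act \<sigma> p \<in> ?B" using act_closed[OF that p] 1 by simp
      then obtain \<kappa> where "\<kappa> \<in> K" "act \<sigma> p = act \<kappa> p" by blast
      then show ?thesis using key that by blast
    qed
    then show ?thesis using KX by blast
  next
    assume R: "?R = (\<lambda>x. {x}) ` E"
    have "?B \<in> (\<lambda>x. {x}) ` E" using BR unfolding R .
    then obtain x where x: "?B = {x}" by (rule imageE)
    have "act \<kappa> p = p" if "\<kappa> \<in> K" for \<kappa>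
    proof -
      have "act \<kappa> p \<in> ?B" using that by (rule imageI)
      then show ?thesis using pB unfolding x by simp
    qed
    then show ?thesis using MK KX by blast
  qed
qed

text \<open>The trace that an edge in the part \<open>p\<close> leaves in the action.
  \<open>C\<close> will have \<open>k - 1\<close> points, so the bound 2 stands for
  \<open>k \<ge> 3\<close>.\<close>

definition edge_config :: "'a set \<Rightarrow> 'a set \<Rightarrow> 'a \<Rightarrow> 'a \<Rightarrow> 'p \<Rightarrow> bool" where
  "edge_config C D a b p \<longleftrightarrow> X = C \<union> D \<union> {a, b} \<and> C \<inter> D = {} \<and> a \<notin> C \<union> D \<and> b \<notin> C \<union> D \<and>
     a \<noteq> b \<and> card C = card D \<and> 2 \<le> card C \<and>
     (\<forall>\<sigma>. \<sigma> permutes X \<longrightarrow> evenperm \<sigma> \<longrightarrow> \<sigma> ` C = C \<longrightarrow> \<sigma> ` D = D \<longrightarrow>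
        \<sigma> ` {a, b} = {a, b} \<longrightarrow> act \<sigma> p = p) \<and>
     (\<forall>\<sigma>. \<sigma> permutes X \<longrightarrow> \<not> evenperm \<sigma> \<longrightarrow> \<sigma> ` C = D \<longrightarrow> \<sigma> ` D = C \<longrightarrow>
        \<sigma> ` {a, b} = {a, b} \<longrightarrow> act \<sigma> p = p)"

text \<open>For a block \<open>B\<close> through \<open>p\<close>, let \<open>?N\<close> be its
  stabilizer in the alternating group. It contains the even part of the stabilizer \<open>?M\<close>
  of \<open>p\<close>. If \<open>?N\<close> lies in \<open>?M\<close>, then \<open>B\<close> is a
  point; otherwise \<open>?N\<close> contains all 3-cycles and \<open>B\<close> is
  everything.\<close>

lemma even_primitive:
  assumes X: "finite X"
    and trans: "\<And>p q. p \<in> E \<Longrightarrow> q \<in> E \<Longrightarrow> \<exists>\<sigma>. \<sigma> permutes X \<and> evenperm \<sigma> \<and> act \<sigma> p = q"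
    and prim: "\<And>R. partition_on E R \<Longrightarrow> (\<And>\<sigma> B. \<sigma> permutes X \<Longrightarrow> B \<in> R \<Longrightarrow> act \<sigma> ` B \<in> R) \<Longrightarrow>
      R = {E} \<or> R = (\<lambda>x. {x}) ` E"
    and two: "p0 \<in> E" "p1 \<in> E" "p0 \<noteq> p1"
    and config: "\<And>p. p \<in> E \<Longrightarrow> \<exists>C D a b. edge_config C D a b p"
    and R: "partition_on E R"
    and inv: "\<And>\<sigma> B. \<sigma> permutes X \<Longrightarrow> evenperm \<sigma> \<Longrightarrow> B \<in> R \<Longrightarrow> act \<sigma> ` B \<in> R"
  shows "R = {E} \<or> R = (\<lambda>x. {x}) ` E"
proof -
  have eq: "A = B" if "A \<in> R" "B \<in> R" "x \<in> A" "x \<in> B" for A B x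
    using R that unfolding partition_on_def disjoint_def by blast
  have block: "B = E \<or> (\<forall>q\<in>B. q = p)" if B: "B \<in> R" and pB: "p \<in> B" for B p
  proof -
    have BE: "B \<subseteq> E" using R B unfolding partition_on_def by blast
    have p: "p \<in> E" using BE pB by blast
    let ?M = "{\<sigma>. \<sigma> permutes X \<and> act \<sigma> p = p}"
    let ?N = "{\<sigma>. \<sigma> permutes X \<and> evenperm \<sigma> \<and> act \<sigma> ` B = B}"
    obtain C D a b where c: "edge_config C D a b p" using config[OF p] by blast
    have cfg: "X = C \<union> D \<union> {a, b}" "C \<inter> D = {}" "a \<notin> C \<union> D" "b \<notin> C \<union> D"
      "a \<noteq> b" "card C = card D" "2 \<le> card C"
      using c unfolding edge_config_def by - (elim conjE, assumption)+
    have cfg1: "\<sigma> \<in> ?M"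
      if "\<sigma> permutes X" "evenperm \<sigma>" "\<sigma> ` C = C" "\<sigma> ` D = D" "\<sigma> ` {a, b} = {a, b}" for \<sigma>
      using c that unfolding edge_config_def by simp
    have cfg2: "\<sigma> \<in> ?M"
      if "\<sigma> permutes X" "\<not> evenperm \<sigma>" "\<sigma> ` C = D" "\<sigma> ` D = C" "\<sigma> ` {a, b} = {a, b}" for \<sigma>
      using c that unfolding edge_config_def by simp
    have trans': "\<exists>\<sigma>. \<sigma> permutes X \<and> act \<sigma> p = q" if "q \<in> E" for q using trans[OF p that] by blast
    have maximal: "K = ?M \<or> K = {\<sigma>. \<sigma> permutes X}" if "perm_group X K" "?M \<subseteq> K" for K
      by (rule stabilizer_maximal[OF p trans' prim that])
    have proper: "?M \<noteq> {\<sigma>. \<sigma> permutes X}"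
    proof
      assume "?M = {\<sigma>. \<sigma> permutes X}"
      then have "q = p" if "q \<in> E" for q using trans'[OF that] by blast
      then show False using two by blast
    qed
    have inN: "\<sigma> \<in> ?N" if s: "\<sigma> permutes X" "evenperm \<sigma>" "x \<in> B" "act \<sigma> x \<in> B" for \<sigma> x
    proof -
      have "act \<sigma> x \<in> act \<sigma> ` B" using s(3) by (rule imageI)
      then have "act \<sigma> ` B = B" using eq[OF inv[OF s(1,2) B] B _ s(4)] by blast
      then show ?thesis using s by blast
    qed
    have N: "perm_group X ?N"
    proof -
      have "perm_group X {\<sigma> \<in> {\<sigma>. \<sigma> permutes X \<and> evenperm \<sigma>}. act \<sigma> ` B = B}"
      proof (rule perm_group_stab[OF perm_group_even[OF X]])
        show "act id ` B = B" using BE act_id by force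
        show "act (g \<circ> h) ` B = B"
          if g: "g \<in> {\<sigma>. \<sigma> permutes X \<and> evenperm \<sigma>}" "act g ` B = B"
            and h: "h \<in> {\<sigma>. \<sigma> permutes X \<and> evenperm \<sigma>}" "act h ` B = B" for g h
        proof -
          have "act (g \<circ> h) ` B = act g ` (act h ` B)"
            unfolding image_image[of "act g"] using g h BE act_comp by (intro image_cong) auto
          then show ?thesis using g h by simp
        qed
        show "act (inv' g) ` B = B"
          if g: "g \<in> {\<sigma>. \<sigma> permutes X \<and> evenperm \<sigma>}" "act g ` B = B" for g
        proof -
          have "act (inv' g) ` (act g ` B) = B"
          proof -
            have "\<forall>x\<in>B. act (inv' g) (act g x) = x" using g BE act_inv by blast
            then show ?thesis unfolding image_image by simp
          qed
          then show ?thesis using g by simp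
        qed
      qed
      then show ?thesis by (simp add: conj_assoc)
    qed
    show ?thesis
    proof (cases "?N \<subseteq> ?M")
      case True
      have "q = p" if q: "q \<in> B" for q
      proof -
        obtain \<sigma> where s: "\<sigma> permutes X" "evenperm \<sigma>" "act \<sigma> p = q" using trans[OF p] BE q by blast
        then have "\<sigma> \<in> ?N" using inN[OF s(1,2) pB] q by blast
        then have "\<sigma> \<in> ?M" using True by blast
        then show ?thesis using s(3) by simp
      qed
      then show ?thesis by blast
    next
      case False
      then obtain n where n: "n \<in> ?N" "n \<notin> ?M" by blast
      have MN: "\<sigma> \<in> ?N" if "\<sigma> \<in> ?M" "evenperm \<sigma>" for \<sigma>
        using inN[of \<sigma> p] that pB by simp
      have evN: "evenperm \<sigma>" if "\<sigma> \<in> ?N" for \<sigma> using that by blast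
      have cyc: "cyc3 u v w \<in> ?N" if "{u, v, w} \<subseteq> X" "distinct [u, v, w]" for u v w
        by (rule three_cycles_in_overgroup[OF X cfg perm_group_stabilizer[OF p] cfg1 cfg2 maximal proper
              N MN evN n that])
      have "q \<in> B" if q: "q \<in> E" for q
      proof -
        obtain \<sigma> where s: "\<sigma> permutes X" "evenperm \<sigma>" "act \<sigma> p = q" using trans[OF p q] by blast
        have "\<sigma> \<in> ?N" by (rule evenperm_mem_if_three_cycles[OF N X cyc s(1,2)])
        then have "act \<sigma> p \<in> B" using pB by blast
        then show ?thesis using s(3) by simp
      qed
      then show ?thesis using BE by blast
    qed
  qed
  show ?thesis
    by (rule partition_on_trivialI[OF R]) (use block in blast)
qed

end

section \<open>Automorphisms of J(2k,k)\<close>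

text \<open>The neighbours of a vertex \<open>A\<close> form the rook's graph on \<open>A \<times> (X - A)\<close>. An isomorphism of rook's
  graphs that maps two points of one line to a line of the same direction preserves all directions.\<close>

lemma rook_product_form:
  fixes p :: "'a \<Rightarrow> 'b \<Rightarrow> 'c" and q :: "'a \<Rightarrow> 'b \<Rightarrow> 'd"
  assumes rook: "\<And>a a' b b'. \<lbrakk>a \<in> S; a' \<in> S; b \<in> T; b' \<in> T\<rbrakk> \<Longrightarrow>
      ((a = a') \<noteq> (b = b')) = ((p a b = p a' b') \<noteq> (q a b = q a' b'))"
    and inj: "\<And>a a' b b'. \<lbrakk>a \<in> S; a' \<in> S; b \<in> T; b' \<in> T; p a b = p a' b'; q a b = q a' b'\<rbrakk> \<Longrightarrow>
      a = a' \<and> b = b'"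
    and base: "a0 \<in> S" "b0 \<in> T" "b1 \<in> T" "b1 \<noteq> b0" "p a0 b1 = p a0 b0"
    and ab: "a \<in> S" "b \<in> T"
  shows "p a b = p a b0 \<and> q a b = q a0 b \<and> q a b0 = q a0 b0 \<and> p a0 b = p a0 b0"
proof -
  \<comment> \<open>The points \<open>b0\<close>, \<open>b1\<close>, \<open>b\<close> of the line at
    \<open>a0\<close> have pairwise collinear images. If the image of \<open>b\<close> left the line
    of the other two, it would share its \<open>q\<close> with both of them, and those two images
    would coincide.\<close>
  have 1: "p a0 b = p a0 b0" if "b \<in> T" for b
  proof (rule ccontr)
    assume ne: "p a0 b \<noteq> p a0 b0"
    then have "b \<noteq> b0" "b \<noteq> b1" using base(5) by auto
    then have "q a0 b = q a0 b0" "q a0 b = q a0 b1"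
      using rook[OF base(1,1) that base(2)] rook[OF base(1,1) that base(3)] ne base(5) by auto
    then show False using inj[OF base(1,1) base(3,2) base(5)] base(4) by simp
  qed
  have 2: "q a b0 = q a0 b0" if "a \<in> S" for a
  proof (rule ccontr)
    assume ne: "q a b0 \<noteq> q a0 b0"
    then have a: "a \<noteq> a0" by auto
    then have p: "p a b0 = p a0 b1"
      using rook[OF that base(1) base(2,2)] ne base(5) by simp
    then have "q a b0 = q a0 b1"
      using rook[OF that base(1) base(2,3)] a base(4) by auto
    then show False using inj[OF that base(1) base(2,3) p] a by simp
  qed
  have "p a b = p a b0 \<and> q a b = q a0 b"
  proof (cases "a = a0 \<or> b = b0")
    case True
    then show ?thesis using 1[OF ab(2)] 2[OF ab(1)] by auto
  next
    case False
    have "p a b \<noteq> p a0 b0" "q a b \<noteq> q a0 b0"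
      using rook[OF ab(1) base(1) ab(2) base(2)] inj[OF ab(1) base(1) ab(2) base(2)] False by auto
    then show ?thesis
      using rook[OF ab(1) base(1) ab(2,2)] rook[OF ab(1,1) ab(2) base(2)] False
        1[OF ab(2)] 2[OF ab(1)] by auto
  qed
  then show ?thesis using 1[OF ab(2)] 2[OF ab(1)] by blast
qed

locale halved_johnson =
  fixes X :: "'a set" and k :: nat
  assumes finite_X: "finite X" and card_X: "card X = 2 * k" and k_ge_2: "k \<ge> 2"
begin

definition "V = {A. A \<subseteq> X \<and> card A = k}"

definition "adj A B \<longleftrightarrow> A \<in> V \<and> B \<in> V \<and> Suc (card (A \<inter> B)) = k"

text \<open>The pair \<open>a\<close>, \<open>b\<close> serves as rook coordinates of a neighbour of
  \<open>A\<close>.\<close>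

definition nb :: "'a set \<Rightarrow> 'a \<Rightarrow> 'a \<Rightarrow> 'a set" where
  "nb A a b = insert b (A - {a})"

definition "aut f \<longleftrightarrow> bij_betw f V V \<and> (\<forall>A\<in>V. \<forall>B\<in>V. adj A B \<longleftrightarrow> adj (f A) (f B))"

lemma V_D: "A \<in> V \<Longrightarrow> A \<subseteq> X" "A \<in> V \<Longrightarrow> card A = k" "A \<in> V \<Longrightarrow> finite A"
  using finite_X finite_subset by (auto simp: V_def)

lemma card_outside: "A \<in> V \<Longrightarrow> card (X - A) = k"
  using V_D finite_X card_X by (simp add: card_Diff_subset)

lemma complement_V: "A \<in> V \<Longrightarrow> X - A \<in> V"
  using card_outside by (auto simp: V_def)

lemma nb_V:
  assumes "A \<in> V" "a \<in> A" "b \<in> X - A"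
  shows "nb A a b \<in> V"
proof -
  have "card (nb A a b) = Suc (card (A - {a}))"
    using assms(3) V_D(3)[OF assms(1)] by (simp add: nb_def)
  also have "\<dots> = card A" using V_D(3)[OF assms(1)] assms(2) by (rule card.remove[symmetric])
  finally show ?thesis using assms V_D(1,2)[OF assms(1)] by (auto simp: V_def nb_def)
qed

lemma card_diff:
  assumes "A \<in> V" "a \<in> A" shows "card (A - {a}) = k - 1"
  using V_D[OF assms(1)] assms(2) by simp

lemma card_diff2:
  assumes "A \<in> V" "a \<in> A" "c \<in> A" "a \<noteq> c" shows "card (A - {a, c}) = k - 2"
  using V_D[OF assms(1)] assms by (simp add: card_Diff_subset)

lemma adj_sym: "adj A B \<Longrightarrow> adj B A"
  by (simp add: adj_def Int_commute)

lemma adj_neq: "adj A B \<Longrightarrow> A \<noteq> B"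
  using V_D(2)[of A] by (auto simp: adj_def)

lemma adj_nb:
  assumes "A \<in> V" "a \<in> A" "b \<in> X - A"
  shows "adj A (nb A a b)"
proof -
  have "A \<inter> nb A a b = A - {a}" using assms by (auto simp: nb_def)
  then show ?thesis
    using nb_V[OF assms] assms card_diff[OF assms(1,2)] k_ge_2 by (simp add: adj_def)
qed

lemma adj_imp_nb:
  assumes "adj A B"
  shows "\<exists>a\<in>A. \<exists>b\<in>X - A. B = nb A a b"
proof -
  have AB: "A \<in> V" "B \<in> V" and c: "Suc (card (A \<inter> B)) = k" using assms by (auto simp: adj_def)
  have "card (A - B) = 1" "card (B - A) = 1"
    using V_D(2,3) AB c card_Diff_subset_Int[of A B] card_Diff_subset_Int[of B A]
    by (simp_all add: Int_commute)
  then obtain a b where ab: "A - B = {a}" "B - A = {b}" by (meson card_1_singletonE)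
  then have "B = nb A a b" "a \<in> A" "b \<in> X - A" using V_D(1) AB by (auto simp: nb_def)
  then show ?thesis by blast
qed

lemma nb_inj:
  assumes "a \<in> A" "a' \<in> A" "b \<notin> A" "b' \<notin> A" "nb A a b = nb A a' b'"
  shows "a = a' \<and> b = b'"
  using assms by (auto simp: nb_def)

lemma adj_nb_nb:
  assumes A: "A \<in> V" and a: "a \<in> A" "a' \<in> A" and b: "b \<in> X - A" "b' \<in> X - A"
  shows "adj (nb A a b) (nb A a' b') \<longleftrightarrow> (a = a') \<noteq> (b = b')"
proof -
  let ?I = "nb A a b \<inter> nb A a' b'"
  have adj: "adj (nb A a b) (nb A a' b') \<longleftrightarrow> Suc (card ?I) = k"
    using nb_V[OF A] a b by (simp add: adj_def)
  have finA: "finite A" using V_D(3)[OF A] .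
  consider "a = a'" "b = b'" | "a = a'" "b \<noteq> b'" | "a \<noteq> a'" "b = b'" | "a \<noteq> a'" "b \<noteq> b'" by blast
  then show ?thesis
  proof cases
    case 1
    then have "card ?I = k" using V_D(2)[OF nb_V[OF A a(1) b(1)]] by simp
    then show ?thesis using 1 adj by simp
  next
    case 2
    then have "?I = A - {a}" using a b by (auto simp: nb_def)
    then show ?thesis using 2 adj card_diff[OF A a(1)] k_ge_2 by simp
  next
    case 3
    then have "?I = insert b (A - {a, a'})" using a b by (auto simp: nb_def)
    then have "card ?I = Suc (k - 2)" using 3 b finA card_diff2[OF A a] by simp
    then show ?thesis using 3 adj k_ge_2 by simp
  next
    case 4
    then have "?I = A - {a, a'}" using a b by (auto simp: nb_def)
    then have "card ?I = k - 2" using 4 card_diff2[OF A a] by simp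
    then show ?thesis using 4 adj k_ge_2 by simp
  qed
qed

text \<open>Two vertices at distance two are determined by each other and the four common neighbours
  listed. Counting intersections shows that \<open>D\<close> contains both or neither of
  \<open>b\<close>, \<open>e\<close>, and both or neither of \<open>a\<close>, \<open>c\<close>. All
  four points would be too many, none too few, and the other two cases are the two answers.\<close>

lemma common_neighbours:
  assumes A: "A \<in> V" and a: "a \<in> A" "c \<in> A" "a \<noteq> c" and b: "b \<in> X - A" "e \<in> X - A" "b \<noteq> e"
    and D: "adj D (nb A a b)" "adj D (nb A a e)" "adj D (nb A c b)" "adj D (nb A c e)"
  shows "D = A \<or> D = A - {a, c} \<union> {b, e}"
proof -
  let ?M = "A - {a, c}"
  have DV: "D \<in> V" using D by (simp add: adj_def)
  have fin: "finite D" "finite ?M" "card D = k" using V_D DV A by auto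
  have cM: "card ?M = k - 2" using card_diff2[OF A a] .
  have card2: "card (D \<inter> (insert x (insert y ?M))) =
      card (D \<inter> ?M) + (if x \<in> D then 1 else 0) + (if y \<in> D then 1 else 0)"
    if "x \<notin> ?M" "y \<notin> ?M" "x \<noteq> y" for x y
    using that fin by (simp add: Int_insert_right)
  have nb: "nb A a b = insert b (insert c ?M)" "nb A a e = insert e (insert c ?M)"
    "nb A c b = insert b (insert a ?M)" "nb A c e = insert e (insert a ?M)"
    using a b by (auto simp: nb_def)
  let ?m = "card (D \<inter> ?M)"
  have eqs: "Suc (?m + (if b \<in> D then 1 else 0) + (if c \<in> D then 1 else 0)) = k"
    "Suc (?m + (if e \<in> D then 1 else 0) + (if c \<in> D then 1 else 0)) = k"
    "Suc (?m + (if b \<in> D then 1 else 0) + (if a \<in> D then 1 else 0)) = k"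
  proof -
    have "b \<notin> ?M" "c \<notin> ?M" "e \<notin> ?M" "a \<notin> ?M" "b \<noteq> c" "e \<noteq> c" "b \<noteq> a" using a b by auto
    note c2 = card2[of b c] card2[of e c] card2[of b a] and this
    moreover have "Suc (card (D \<inter> insert b (insert c ?M))) = k"
      "Suc (card (D \<inter> insert e (insert c ?M))) = k" "Suc (card (D \<inter> insert b (insert a ?M))) = k"
      using D unfolding adj_def nb by blast+
    ultimately show "Suc (?m + (if b \<in> D then 1 else 0) + (if c \<in> D then 1 else 0)) = k"
      "Suc (?m + (if e \<in> D then 1 else 0) + (if c \<in> D then 1 else 0)) = k"
      "Suc (?m + (if b \<in> D then 1 else 0) + (if a \<in> D then 1 else 0)) = k"
      by (simp_all only: not_False_eq_True simp_thms)
  qed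
  then have iff: "b \<in> D \<longleftrightarrow> e \<in> D" "a \<in> D \<longleftrightarrow> c \<in> D" by (auto split: if_splits)
  have mle: "?m \<le> k - 2" using cM fin by (metis card_mono Int_lower2)
  have sub: "?M \<subseteq> D" if "?m = k - 2"
  proof -
    have "D \<inter> ?M = ?M" using fin(2) cM that by (intro card_subset_eq) auto
    then show ?thesis by blast
  qed
  consider "b \<in> D" "c \<in> D" | "b \<in> D" "c \<notin> D" | "b \<notin> D" "c \<in> D" | "b \<notin> D" "c \<notin> D" by blast
  then show ?thesis
  proof cases
    case 1
    then have m: "?m + 3 = k" using eqs by simp
    have "D \<inter> ?M \<union> {a, b, c, e} \<subseteq> D" using 1 iff by auto
    then have "card (D \<inter> ?M \<union> {a, b, c, e}) \<le> k" using fin card_mono by metis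
    moreover have "card (D \<inter> ?M \<union> {a, b, c, e}) = ?m + card {a, b, c, e}"
      using a b fin by (intro card_Un_disjoint) auto
    moreover have "card {a, b, c, e} = 4"
    proof -
      have "distinct [a, b, c, e]" using a b by auto
      from distinct_card[OF this] show ?thesis by simp
    qed
    ultimately show ?thesis using m by simp
  next
    case 2
    then have "?M \<union> {b, e} \<subseteq> D" using eqs sub iff by auto
    moreover have "card (?M \<union> {b, e}) = card ?M + card {b, e}"
      using b fin by (intro card_Un_disjoint) auto
    then have "card (?M \<union> {b, e}) = card D" using cM b k_ge_2 fin by simp
    ultimately show ?thesis using fin card_subset_eq by blast
  next
    case 3
    then have "A \<subseteq> D" using eqs sub iff by auto
    then show ?thesis using fin V_D(2)[OF A] card_subset_eq by metis
  next
    case 4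
    then show ?thesis using eqs mle k_ge_2 by simp
  qed
qed

lemma aut_V: "aut f \<Longrightarrow> A \<in> V \<Longrightarrow> f A \<in> V"
  by (auto simp: aut_def bij_betw_def)

lemma aut_adj: "aut f \<Longrightarrow> A \<in> V \<Longrightarrow> B \<in> V \<Longrightarrow> adj (f A) (f B) \<longleftrightarrow> adj A B"
  by (simp add: aut_def)

lemma aut_inj: "aut f \<Longrightarrow> A \<in> V \<Longrightarrow> B \<in> V \<Longrightarrow> f A = f B \<Longrightarrow> A = B"
  by (auto simp: aut_def bij_betw_def dest: inj_onD)

text \<open>Only a \<open>D\<close> at distance two from \<open>A\<close> needs work. Its four
  common neighbours with \<open>A\<close> are fixed, so \<open>f D\<close> is \<open>A\<close> or
  \<open>D\<close>, and \<open>A\<close> is already the image of itself.\<close>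

lemma aut_fixing_neighbourhood_step:
  assumes f: "aut f" and A: "A \<in> V" "f A = A" "\<And>B. adj A B \<Longrightarrow> f B = B"
    and AB: "adj A B" and BD: "adj B D"
  shows "f D = D"
proof -
  obtain a b where ab: "a \<in> A" "b \<in> X - A" "B = nb A a b" using adj_imp_nb[OF AB] by blast
  obtain c e where ce: "c \<in> B" "e \<in> X - B" "D = nb B c e" using adj_imp_nb[OF BD] by blast
  have V: "B \<in> V" "D \<in> V" using AB BD by (auto simp: adj_def)
  show ?thesis
  proof (cases "D = A \<or> adj A D")
    case True
    then show ?thesis using A by blast
  next
    case False
    have "c \<noteq> b"
    proof
      assume "c = b"
      then have D: "D = insert e (A - {a})" using ab ce by (auto simp: nb_def)
      show False
      proof (cases "e = a")
        case True
        then show False using D False ab by auto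
      next
        case ne: False
        then have "e \<in> X - A" using ce ab by (auto simp: nb_def)
        then show False using adj_nb[OF A(1) ab(1), of e] D False by (simp add: nb_def)
      qed
    qed
    then have c: "c \<in> A" "c \<noteq> a" using ce ab by (auto simp: nb_def)
    have "e \<noteq> a"
    proof
      assume "e = a"
      then have "D = nb A c b" using ab ce c by (auto simp: nb_def)
      then show False using adj_nb[OF A(1) c(1) ab(2)] False by simp
    qed
    then have e: "e \<in> X - A" "e \<noteq> b" using ce ab c by (auto simp: nb_def)
    have D: "D = A - {a, c} \<union> {b, e}" using ab ce c e by (auto simp: nb_def)
    have D': "D = nb (nb A a b) c e" "D = nb (nb A a e) c b" "D = nb (nb A c b) a e" "D = nb (nb A c e) a b"
      using ab c e D by (auto simp: nb_def)
    have cond: "c \<in> nb A a b" "c \<in> nb A a e" "a \<in> nb A c b" "a \<in> nb A c e"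
      "e \<in> X - nb A a b" "b \<in> X - nb A a e" "e \<in> X - nb A c b" "b \<in> X - nb A c e"
      using ab c e by (auto simp: nb_def)
    have nV: "nb A a b \<in> V" "nb A a e \<in> V" "nb A c b \<in> V" "nb A c e \<in> V"
      using nb_V[OF A(1)] ab c e by auto
    have fixd: "f (nb A a b) = nb A a b" "f (nb A a e) = nb A a e" "f (nb A c b) = nb A c b"
      "f (nb A c e) = nb A c e"
      using A(3) adj_nb[OF A(1)] ab c e by auto
    have ad: "adj D (nb A a b)" "adj D (nb A a e)" "adj D (nb A c b)" "adj D (nb A c e)"
      using adj_sym[OF adj_nb[OF nV(1) cond(1,5)]] adj_sym[OF adj_nb[OF nV(2) cond(2,6)]]
        adj_sym[OF adj_nb[OF nV(3) cond(3,7)]] adj_sym[OF adj_nb[OF nV(4) cond(4,8)]]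
      unfolding D'[symmetric] by simp_all
    have "adj (f D) (nb A a b)" "adj (f D) (nb A a e)" "adj (f D) (nb A c b)" "adj (f D) (nb A c e)"
      using ad aut_adj[OF f V(2) nV(1)] aut_adj[OF f V(2) nV(2)] aut_adj[OF f V(2) nV(3)]
        aut_adj[OF f V(2) nV(4)] unfolding fixd by simp_all
    then have "f D = A \<or> f D = D"
      unfolding D using common_neighbours[OF A(1) ab(1) c(1) c(2)[symmetric] ab(2) e(1) e(2)[symmetric]] by blast
    moreover have "f D \<noteq> A" using aut_inj[OF f V(2) A(1)] A(2) False by auto
    ultimately show ?thesis by blast
  qed
qed

text \<open>The base vertex walks towards \<open>B\<close>: one exchange step reduces
  \<open>card (A - B)\<close>, and the new vertex again has a fixed neighbourhood.\<close>

lemma aut_rigid: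
  assumes f: "aut f" and A: "A \<in> V" "f A = A" "\<And>B. adj A B \<Longrightarrow> f B = B" and B: "B \<in> V"
  shows "f B = B"
  using A
proof (induction "card (A - B)" arbitrary: A rule: less_induct)
  case less
  show ?case
  proof (cases "A = B")
    case True
    then show ?thesis using less.prems by simp
  next
    case False
    have "A - B \<noteq> {}" "B - A \<noteq> {}"
      using False V_D[OF less.prems(1)] V_D[OF B] card_subset_eq by (metis Diff_eq_empty_iff)+
    then obtain a b where ab: "a \<in> A - B" "b \<in> B - A" by blast
    have b: "b \<in> X - A" using ab V_D(1)[OF B] by blast
    let ?A = "nb A a b"
    have adj: "adj A ?A" using adj_nb[OF less.prems(1) _ b] ab by blast
    have "?A - B = (A - B) - {a}" using ab by (auto simp: nb_def)
    then have "card (?A - B) < card (A - B)"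
      using ab V_D(3)[OF less.prems(1)] by (metis card_Diff1_less finite_Diff)
    moreover have "?A \<in> V" "f ?A = ?A" using adj less.prems(3) by (auto simp: adj_def)
    moreover have "f D = D" if "adj ?A D" for D
      by (rule aut_fixing_neighbourhood_step[OF f less.prems adj that])
    ultimately show ?thesis by (rule less.hyps)
  qed
qed

section \<open>Permutations and complementation as automorphisms\<close>

lemma perm_image_V: "\<sigma> permutes X \<Longrightarrow> A \<in> V \<Longrightarrow> \<sigma> ` A \<in> V"
  using permutes_image[of \<sigma> X] permutes_inj[of \<sigma> X]
  by (auto simp: V_def card_image inj_on_subset dest: image_mono[of A X \<sigma>])

lemma adj_image:
  assumes "\<sigma> permutes X" "A \<in> V" "B \<in> V"
  shows "adj (\<sigma> ` A) (\<sigma> ` B) \<longleftrightarrow> adj A B"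
proof -
  have "\<sigma> ` A \<inter> \<sigma> ` B = \<sigma> ` (A \<inter> B)" using permutes_inj[OF assms(1)] by (simp add: image_Int)
  moreover have "card (\<sigma> ` (A \<inter> B)) = card (A \<inter> B)"
    using permutes_inj[OF assms(1)] by (metis card_image inj_on_subset subset_UNIV)
  ultimately show ?thesis using assms perm_image_V by (simp add: adj_def)
qed

lemma adj_complement:
  assumes "A \<in> V" "B \<in> V"
  shows "adj (X - A) (X - B) \<longleftrightarrow> adj A B"
proof -
  have "card (A \<union> B) + card (A \<inter> B) = 2 * k"
    using card_Un_Int[of A B] V_D[OF assms(1)] V_D[OF assms(2)] by simp
  moreover have "card (X - (A \<union> B)) = 2 * k - card (A \<union> B)"
    using V_D[OF assms(1)] V_D[OF assms(2)] card_X by (intro card_Diff_subset[THEN trans]) auto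
  moreover have "(X - A) \<inter> (X - B) = X - (A \<union> B)" by blast
  ultimately have "card ((X - A) \<inter> (X - B)) = card (A \<inter> B)" by simp
  then show ?thesis using assms complement_V by (simp add: adj_def)
qed

lemma finite_V: "finite V"
  using finite_X by (simp add: V_def)

lemma aut_image_comp:
  assumes f: "aut f" and s: "\<sigma> permutes X"
  shows "aut (\<lambda>A. \<sigma> ` f A)"
proof -
  have "inj_on (\<lambda>A. \<sigma> ` f A) V"
    using aut_inj[OF f] permutes_inj[OF s] by (intro inj_onI) (simp add: inj_image_eq_iff)
  moreover have "(\<lambda>A. \<sigma> ` f A) ` V \<subseteq> V" using aut_V[OF f] perm_image_V[OF s] by blast
  ultimately have "bij_betw (\<lambda>A. \<sigma> ` f A) V V"
    using finite_V by (simp add: bij_betw_def endo_inj_surj)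
  then show ?thesis using aut_V[OF f] aut_adj[OF f] adj_image[OF s] by (simp add: aut_def)
qed

lemma aut_complement_comp:
  assumes f: "aut f"
  shows "aut (\<lambda>A. X - f A)"
proof -
  have "inj_on (\<lambda>A. X - f A) V"
  proof (rule inj_onI)
    fix A B assume AB: "A \<in> V" "B \<in> V" "X - f A = X - f B"
    then have "f A = f B" using V_D(1)[OF aut_V[OF f AB(1)]] V_D(1)[OF aut_V[OF f AB(2)]] by blast
    then show "A = B" using aut_inj[OF f] AB by blast
  qed
  moreover have "(\<lambda>A. X - f A) ` V \<subseteq> V" using aut_V[OF f] complement_V by blast
  ultimately have "bij_betw (\<lambda>A. X - f A) V V"
    using finite_V by (simp add: bij_betw_def endo_inj_surj)
  then show ?thesis using aut_V[OF f] aut_adj[OF f] adj_complement by (simp add: aut_def)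
qed

lemma image_nb: "inj \<sigma> \<Longrightarrow> \<sigma> ` nb A a b = nb (\<sigma> ` A) (\<sigma> a) (\<sigma> b)"
  by (simp add: nb_def image_set_diff)

lemma glue_permutes:
  assumes A: "A \<in> V" and B: "B \<in> V"
    and \<alpha>: "\<And>x. x \<in> A \<Longrightarrow> \<alpha> x \<in> B" "inj_on \<alpha> A"
    and \<beta>: "\<And>x. x \<in> X - A \<Longrightarrow> \<beta> x \<in> X - B" "inj_on \<beta> (X - A)"
  shows "\<exists>\<sigma>. \<sigma> permutes X \<and> (\<forall>x\<in>A. \<sigma> x = \<alpha> x) \<and> (\<forall>x\<in>X - A. \<sigma> x = \<beta> x) \<and> \<sigma> ` A = B"
proof -
  define \<sigma> where "\<sigma> x = (if x \<in> A then \<alpha> x else if x \<in> X then \<beta> x else x)" for x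
  have sA: "\<sigma> x = \<alpha> x" if "x \<in> A" for x using that by (simp add: \<sigma>_def)
  have sB: "\<sigma> x = \<beta> x" if "x \<in> X - A" for x using that by (simp add: \<sigma>_def)
  have X: "X = A \<union> (X - A)" using V_D(1)[OF A] by blast
  have "inj_on \<sigma> (A \<union> (X - A))"
  proof (subst inj_on_Un, intro conjI)
    show "inj_on \<sigma> A" by (rule inj_on_cong[THEN iffD2, OF sA \<alpha>(2)])
    show "inj_on \<sigma> (X - A)" by (rule inj_on_cong[THEN iffD2, OF sB \<beta>(2)])
    show "\<sigma> ` (A - (X - A)) \<inter> \<sigma> ` (X - A - A) = {}" using sA sB \<alpha>(1) \<beta>(1) by fastforce
  qed
  then have "inj_on \<sigma> X" using X by simp
  moreover have "\<sigma> x \<in> X" if "x \<in> X" for x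
    using that sA sB \<alpha>(1) \<beta>(1) V_D(1)[OF B] by (cases "x \<in> A") auto
  ultimately have "\<sigma> permutes X"
    using V_D(1)[OF A] finite_X by (intro inj_imp_permutes) (auto simp: \<sigma>_def)
  moreover have "\<sigma> ` A = B"
  proof (rule card_subset_eq)
    show "\<sigma> ` A \<subseteq> B" using sA \<alpha>(1) by auto
    have "card (\<sigma> ` A) = card (\<alpha> ` A)" using sA by (metis image_cong)
    then show "card (\<sigma> ` A) = card B" using \<alpha>(2) V_D(2)[OF A] V_D(2)[OF B] by (simp add: card_image)
  qed (use V_D[OF B] in simp)
  ultimately show ?thesis using sA sB by blast
qed

text \<open>On neighbours, \<open>f\<close> is an isomorphism of rook's graphs. The points
  \<open>b0\<close> and \<open>b1\<close> on the line at \<open>a0\<close> test whether it keeps the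
  two directions, as a permutation of the points does, or exchanges them, as complementation
  does.\<close>

lemma aut_neighbourhood:
  assumes f: "aut f" and A: "A \<in> V"
  shows "\<exists>\<sigma>. \<sigma> permutes X \<and>
    ((\<forall>B. B = A \<or> adj A B \<longrightarrow> f B = \<sigma> ` B) \<or> (\<forall>B. B = A \<or> adj A B \<longrightarrow> f B = X - \<sigma> ` B))"
proof -
  let ?B = "f A"
  have BV: "?B \<in> V" using aut_V[OF f A] .
  have "\<forall>a b. \<exists>p q. a \<in> A \<longrightarrow> b \<in> X - A \<longrightarrow> p \<in> ?B \<and> q \<in> X - ?B \<and> f (nb A a b) = nb ?B p q"
  proof (intro allI)
    fix a b
    show "\<exists>p q. a \<in> A \<longrightarrow> b \<in> X - A \<longrightarrow> p \<in> ?B \<and> q \<in> X - ?B \<and> f (nb A a b) = nb ?B p q"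
    proof (cases "a \<in> A \<and> b \<in> X - A")
      case True
      then have "adj ?B (f (nb A a b))"
        using aut_adj[OF f A nb_V[OF A]] adj_nb[OF A] by blast
      from adj_imp_nb[OF this] show ?thesis by blast
    qed blast
  qed
  then obtain p q where pq: "\<And>a b. a \<in> A \<Longrightarrow> b \<in> X - A \<Longrightarrow>
      p a b \<in> ?B \<and> q a b \<in> X - ?B \<and> f (nb A a b) = nb ?B (p a b) (q a b)"
    by metis
  have rook: "((a = a') \<noteq> (b = b')) = ((p a b = p a' b') \<noteq> (q a b = q a' b'))"
    if "a \<in> A" "a' \<in> A" "b \<in> X - A" "b' \<in> X - A" for a a' b b'
  proof -
    have "adj (nb A a b) (nb A a' b') \<longleftrightarrow> adj (f (nb A a b)) (f (nb A a' b'))"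
      using aut_adj[OF f nb_V[OF A that(1,3)] nb_V[OF A that(2,4)]] by simp
    moreover have "f (nb A a b) = nb ?B (p a b) (q a b)" "f (nb A a' b') = nb ?B (p a' b') (q a' b')"
      using pq that by blast+
    moreover have "p a b \<in> ?B" "p a' b' \<in> ?B" "q a b \<in> X - ?B" "q a' b' \<in> X - ?B"
      using pq that by blast+
    ultimately show ?thesis using adj_nb_nb[OF A that] adj_nb_nb[OF BV] by simp
  qed
  have inj: "a = a' \<and> b = b'"
    if "a \<in> A" "a' \<in> A" "b \<in> X - A" "b' \<in> X - A" "p a b = p a' b'" "q a b = q a' b'" for a a' b b'
  proof -
    have "f (nb A a b) = f (nb A a' b')" using pq[OF that(1,3)] pq[OF that(2,4)] that(5,6) by simp
    then have "nb A a b = nb A a' b'"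
      using aut_inj[OF f nb_V[OF A that(1,3)] nb_V[OF A that(2,4)]] by simp
    then show ?thesis using nb_inj that by blast
  qed
  have "A \<noteq> {}" using V_D(2)[OF A] k_ge_2 by auto
  then obtain a0 where a0: "a0 \<in> A" by blast
  obtain b0 b1 where b: "b0 \<in> X - A" "b1 \<in> X - A" "b1 \<noteq> b0"
  proof -
    have "2 \<le> card (X - A)" using card_outside[OF A] k_ge_2 by simp
    then obtain T where "T \<subseteq> X - A" "card T = 2" using obtain_subset_with_card_n by metis
    then show ?thesis using that by (auto simp: card_2_iff)
  qed
  show ?thesis
  proof (cases "p a0 b1 = p a0 b0")
    case True
    have form: "p a b = p a b0 \<and> q a b = q a0 b \<and> q a b0 = q a0 b0 \<and> p a0 b = p a0 b0"
      if "a \<in> A" "b \<in> X - A" for a b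
      by (rule rook_product_form[where S = A and T = "X - A", OF rook inj a0 b(1-3) True that])
    have "inj_on (\<lambda>a. p a b0) A"
    proof (rule inj_onI)
      fix x y assume xy: "x \<in> A" "y \<in> A" "p x b0 = p y b0"
      then show "x = y" using inj[OF xy(1,2) b(1,1) xy(3)] form[OF xy(1) b(1)] form[OF xy(2) b(1)] by simp
    qed
    moreover have "inj_on (q a0) (X - A)"
    proof (rule inj_onI)
      fix x y assume xy: "x \<in> X - A" "y \<in> X - A" "q a0 x = q a0 y"
      then show "x = y" using inj[OF a0 a0 xy(1,2) _ xy(3)] form[OF a0 xy(1)] form[OF a0 xy(2)] by simp
    qed
    ultimately obtain \<sigma> where s: "\<sigma> permutes X" "\<And>x. x \<in> A \<Longrightarrow> \<sigma> x = p x b0"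
      "\<And>x. x \<in> X - A \<Longrightarrow> \<sigma> x = q a0 x" "\<sigma> ` A = ?B"
      using glue_permutes[OF A BV, of "\<lambda>a. p a b0" "q a0"] pq a0 b by blast
    have "f B = \<sigma> ` B" if "B = A \<or> adj A B" for B
      using that
    proof
      assume "adj A B"
      then obtain a b where ab: "a \<in> A" "b \<in> X - A" "B = nb A a b" using adj_imp_nb by blast
      have "f B = nb ?B (p a b0) (q a0 b)" using pq[OF ab(1,2)] form[OF ab(1,2)] ab(3) by simp
      also have "\<dots> = \<sigma> ` B"
        using image_nb[OF permutes_inj[OF s(1)], of A a b] s(2)[OF ab(1)] s(3)[OF ab(2)] s(4) ab(3) by simp
      finally show ?thesis .
    qed (use s(4) in simp)
    then show ?thesis using s(1) by blast
  next
    case False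
    then have eq: "q a0 b1 = q a0 b0" using rook[OF a0 a0 b(2,1)] b(3) by auto
    have form: "q a b = q a b0 \<and> p a b = p a0 b \<and> p a b0 = p a0 b0 \<and> q a0 b = q a0 b0"
      if "a \<in> A" "b \<in> X - A" for a b
    proof (rule rook_product_form[where S = A and T = "X - A" and p = q and q = p, OF _ _ a0 b(1-3) eq that])
      show "((a = a') \<noteq> (b = b')) = ((q a b = q a' b') \<noteq> (p a b = p a' b'))"
        if "a \<in> A" "a' \<in> A" "b \<in> X - A" "b' \<in> X - A" for a a' b b'
        using rook[OF that] by argo
      show "a = a' \<and> b = b'"
        if "a \<in> A" "a' \<in> A" "b \<in> X - A" "b' \<in> X - A" "q a b = q a' b'" "p a b = p a' b'" for a a' b b'
        by (rule inj[OF that(1-4,6,5)])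
    qed
    have cc: "X - (X - ?B) = ?B" using V_D(1)[OF BV] by blast
    have i1: "inj_on (\<lambda>a. q a b0) A"
    proof (rule inj_onI)
      fix x y assume xy: "x \<in> A" "y \<in> A" "q x b0 = q y b0"
      then show "x = y" using inj[OF xy(1,2) b(1,1) _ xy(3)] form[OF xy(1) b(1)] form[OF xy(2) b(1)] by simp
    qed
    have i2: "inj_on (p a0) (X - A)"
    proof (rule inj_onI)
      fix x y assume xy: "x \<in> X - A" "y \<in> X - A" "p a0 x = p a0 y"
      then show "x = y" using inj[OF a0 a0 xy(1,2,3)] form[OF a0 xy(1)] form[OF a0 xy(2)] by simp
    qed
    have i3: "q x b0 \<in> X - ?B" if "x \<in> A" for x using pq[OF that b(1)] by blast
    have i4: "p a0 x \<in> X - (X - ?B)" if "x \<in> X - A" for x unfolding cc using pq[OF a0 that] by blast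
    obtain \<sigma> where s: "\<sigma> permutes X" "\<And>x. x \<in> A \<Longrightarrow> \<sigma> x = q x b0"
      "\<And>x. x \<in> X - A \<Longrightarrow> \<sigma> x = p a0 x" "\<sigma> ` A = X - ?B"
      using glue_permutes[OF A complement_V[OF BV] i3 i1 i4 i2] by metis
    have "f B = X - \<sigma> ` B" if "B = A \<or> adj A B" for B
      using that
    proof
      assume "adj A B"
      then obtain a b where ab: "a \<in> A" "b \<in> X - A" "B = nb A a b" using adj_imp_nb by blast
      have "f B = nb ?B (p a0 b) (q a b0)" using pq[OF ab(1,2)] form[OF ab(1,2)] ab(3) by simp
      \<comment> \<open>Replacing \<open>p\<close> by \<open>q\<close> in a set is replacing
        \<open>q\<close> by \<open>p\<close> in its complement.\<close>
      also have "\<dots> = X - nb (X - ?B) (q a b0) (p a0 b)"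
        using pq[OF ab(1) b(1)] pq[OF a0 ab(2)] V_D(1)[OF BV] by (auto simp: nb_def)
      also have "\<dots> = X - \<sigma> ` B"
        using image_nb[OF permutes_inj[OF s(1)], of A a b] s(2)[OF ab(1)] s(3)[OF ab(2)] s(4) ab(3) by simp
      finally show ?thesis .
    qed (use s(4) cc in simp)
    then show ?thesis using s(1) by blast
  qed
qed

text \<open>Undoing the permutation, and the complementation if it occurs, leaves an automorphism
  fixing one vertex and its neighbours, to which rigidity applies.\<close>

theorem automorphism_form:
  assumes f: "aut f"
  shows "\<exists>\<sigma>. \<sigma> permutes X \<and> ((\<forall>B\<in>V. f B = \<sigma> ` B) \<or> (\<forall>B\<in>V. f B = X - \<sigma> ` B))"
proof -
  obtain A where A: "A \<subseteq> X" "card A = k" using obtain_subset_with_card_n[of k X] card_X by auto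
  then have AV: "A \<in> V" by (simp add: V_def)
  obtain \<sigma> where s: "\<sigma> permutes X"
    and or: "(\<forall>B. B = A \<or> adj A B \<longrightarrow> f B = \<sigma> ` B) \<or> (\<forall>B. B = A \<or> adj A B \<longrightarrow> f B = X - \<sigma> ` B)"
    using aut_neighbourhood[OF f AV] by blast
  have i: "inv' \<sigma> permutes X" using permutes_inv[OF s] .
  have ims: "inv' \<sigma> ` \<sigma> ` B = B" for B using permutes_inj[OF s] by (simp add: image_inv_f_f)
  have si: "\<sigma> ` inv' \<sigma> ` B = B" for B using permutes_surj[OF s] by (simp add: image_f_inv_f)
  have bV: "B \<in> V" if "B = A \<or> adj A B" for B using that AV by (auto simp: adj_def)
  from or show ?thesis
  proof
    assume 1: "\<forall>B. B = A \<or> adj A B \<longrightarrow> f B = \<sigma> ` B"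
    have "inv' \<sigma> ` f B = B" if "B \<in> V" for B
      by (rule aut_rigid[OF aut_image_comp[OF f i] AV _ _ that]) (use 1 ims in auto)
    then have "f B = \<sigma> ` B" if "B \<in> V" for B using si[of "f B"] that by simp
    then show ?thesis using s by blast
  next
    assume 2: "\<forall>B. B = A \<or> adj A B \<longrightarrow> f B = X - \<sigma> ` B"
    have c: "X - (X - B) = B" if "B \<in> V" for B using V_D(1)[OF that] by blast
    have 3: "inv' \<sigma> ` (X - f B) = B" if "B = A \<or> adj A B" for B
    proof -
      have "f B = X - \<sigma> ` B" using 2 that by blast
      then show ?thesis using c[OF perm_image_V[OF s bV[OF that]]] ims by simp
    qed
    have "inv' \<sigma> ` (X - f B) = B" if "B \<in> V" for B
      by (rule aut_rigid[OF aut_image_comp[OF aut_complement_comp[OF f] i] AV _ _ that]) (use 3 in auto)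
    then have "X - f B = \<sigma> ` B" if "B \<in> V" for B using si[of "X - f B"] that by simp
    then have "f B = X - \<sigma> ` B" if "B \<in> V" for B using c[OF aut_V[OF f that]] that by metis
    then show ?thesis using s by blast
  qed
qed

end

section \<open>Decompositions of J(2k,k)\<close>

locale johnson_decomposition =
  fixes k :: nat and G :: "(nat set \<Rightarrow> nat set) set" and \<P> :: "nat set set set set"
  assumes k2: "k \<ge> 2"
    and subgroup_G: "subgroup G (aut_group (johnson (2 * k) k))"
    and arc_H: "arc_transitive (johnson (2 * k) k) (G \<inter> johnson_sym (2 * k) k)"
    and prim_G: "primitive_decomposition (johnson (2 * k) k) G \<P>"
begin

abbreviation "\<Gamma> \<equiv> johnson (2 * k) k"
abbreviation "S \<equiv> johnson_sym (2 * k) k"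
definition "X = {1..2 * k}"

sublocale halved_johnson X k
  using k2 by unfold_locales (auto simp: X_def)

lemma V_eq: "johnson_verts (2 * k) k = V"
  unfolding johnson_verts_def V_def by (simp add: X_def)

lemma verts_eq: "verts \<Gamma> = V"
  by (simp add: johnson_def V_eq)

lemma edges_eq: "edges \<Gamma> = {{A, B} | A B. adj A B}"
  by (simp add: johnson_def V_eq adj_def)

lemma edge_iff: "{A, B} \<in> edges \<Gamma> \<longleftrightarrow> adj A B"
  unfolding edges_eq using adj_sym by (auto simp: doubleton_eq_iff)

lemma edges_D:
  assumes "e \<in> edges \<Gamma>"
  shows "\<exists>A B. e = {A, B} \<and> adj A B"
  using assms unfolding edges_eq by blast

lemma arcs_eq: "arcs \<Gamma> = {(A, B). adj A B}"
  using adj_neq by (auto simp: arcs_def verts_eq edge_iff) (auto simp: adj_def)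

text \<open>\<open>cohat id\<close> is the automorphism \<open>\<tau>\<close>, and \<open>cohat \<sigma>\<close> is its product with \<open>hat \<sigma>\<close>.\<close>

definition "hat \<sigma> = (\<lambda>A\<in>V. \<sigma> ` A)"

definition "cohat \<sigma> = (\<lambda>A\<in>V. X - \<sigma> ` A)"

lemma S_eq: "S = {hat \<sigma> | \<sigma>. \<sigma> permutes X}"
  by (simp add: johnson_sym_def hat_def V_eq X_def)

lemma G_Bij: "g \<in> G \<Longrightarrow> g \<in> Bij V"
  using subgroup.subset[OF subgroup_G] by (auto simp: aut_group_def automorphisms_def verts_eq)

lemma G_aut: "g \<in> G \<Longrightarrow> aut g"
proof -
  assume g: "g \<in> G"
  then have "g \<in> automorphisms \<Gamma>"
    using subgroup.subset[OF subgroup_G] by (auto simp: aut_group_def)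
  then show "aut g" by (simp add: automorphisms_def aut_def Bij_def verts_eq edge_iff)
qed

lemma hat_apply: "A \<in> V \<Longrightarrow> hat \<sigma> A = \<sigma> ` A" by (simp add: hat_def)

lemma cohat_apply: "A \<in> V \<Longrightarrow> cohat \<sigma> A = X - \<sigma> ` A" by (simp add: cohat_def)

lemma G_form:
  assumes g: "g \<in> G"
  shows "\<exists>\<sigma>. \<sigma> permutes X \<and> (g = hat \<sigma> \<or> g = cohat \<sigma>)"
proof -
  have ext: "g \<in> extensional V" using G_Bij[OF g] by (simp add: Bij_def)
  obtain \<sigma> where s: "\<sigma> permutes X" "(\<forall>B\<in>V. g B = \<sigma> ` B) \<or> (\<forall>B\<in>V. g B = X - \<sigma> ` B)"
    using automorphism_form[OF G_aut[OF g]] by blast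
  have "g = hat \<sigma>" if "\<forall>B\<in>V. g B = \<sigma> ` B"
    using that by (intro extensionalityI[OF ext]) (auto simp: hat_def)
  moreover have "g = cohat \<sigma>" if "\<forall>B\<in>V. g B = X - \<sigma> ` B"
    using that by (intro extensionalityI[OF ext]) (auto simp: cohat_def)
  ultimately show ?thesis using s by blast
qed

lemma G_compose:
  assumes "g \<in> G" "h \<in> G" shows "compose V g h \<in> G"
  using subgroup.m_closed[OF subgroup_G assms] assms G_Bij
  by (simp add: aut_group_def BijGroup_def verts_eq)

lemma G_one: "(\<lambda>A\<in>V. A) \<in> G"
  using subgroup.one_closed[OF subgroup_G] by (simp add: aut_group_def BijGroup_def verts_eq)

lemma hat_id: "hat id = (\<lambda>A\<in>V. A)"
  by (simp add: hat_def)

lemma compose_hat: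
  assumes s: "\<sigma> permutes X" and r: "\<rho> permutes X"
  shows "compose V (hat \<sigma>) (hat \<rho>) = hat (\<sigma> \<circ> \<rho>)"
    "compose V (cohat \<sigma>) (hat \<rho>) = cohat (\<sigma> \<circ> \<rho>)"
    "compose V (hat \<sigma>) (cohat \<rho>) = cohat (\<sigma> \<circ> \<rho>)"
    "compose V (cohat \<sigma>) (cohat \<rho>) = hat (\<sigma> \<circ> \<rho>)"
proof -
  have cs: "\<sigma> ` (X - \<rho> ` A) = X - \<sigma> ` \<rho> ` A" for A
    using permutes_image[OF s] permutes_inj[OF s] by (simp add: image_set_diff)
  have cc: "X - (X - \<sigma> ` \<rho> ` A) = \<sigma> ` \<rho> ` A" if "A \<in> V" for A
    using V_D(1)[OF perm_image_V[OF s perm_image_V[OF r that]]] by blast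
  note V = perm_image_V[OF r] complement_V[OF perm_image_V[OF r]]
  show "compose V (hat \<sigma>) (hat \<rho>) = hat (\<sigma> \<circ> \<rho>)"
    by (rule ext) (simp add: compose_def hat_def V image_comp)
  show "compose V (cohat \<sigma>) (hat \<rho>) = cohat (\<sigma> \<circ> \<rho>)"
    by (rule ext) (simp add: compose_def hat_def cohat_def V image_comp)
  show "compose V (hat \<sigma>) (cohat \<rho>) = cohat (\<sigma> \<circ> \<rho>)"
    by (rule ext) (simp add: compose_def hat_def cohat_def V cs, simp add: image_comp)
  show "compose V (cohat \<sigma>) (cohat \<rho>) = hat (\<sigma> \<circ> \<rho>)"
    by (rule ext) (simp add: compose_def hat_def cohat_def V cs cc, simp add: image_comp)
qed

lemma prim_G_D:
  shows "decomposition \<Gamma> \<P>" "preserves_decomposition G \<P>"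
    "transitive_action (aut_subgroup \<Gamma> G) \<P> (part_action \<P>)"
    "\<And>R. partition_on \<P> R \<Longrightarrow> (\<And>g B. g \<in> G \<Longrightarrow> B \<in> R \<Longrightarrow> part_action \<P> g ` B \<in> R) \<Longrightarrow>
      R = {\<P>} \<or> R = (\<lambda>x. {x}) ` \<P>"
  using prim_G
  by (auto simp: primitive_decomposition_def transitive_decomposition_def primitive_action_def aut_subgroup_def)

lemma G_group: "group (aut_subgroup \<Gamma> G)"
  using transitive_action.axioms(1)[OF prim_G_D(3)] group_action.group_hom group_hom.axioms(1) by blast

lemma hat_inverse:
  assumes s: "\<sigma> permutes X" and g: "hat \<sigma> \<in> G"
  shows "hat (inv' \<sigma>) \<in> G"
proof -
  have "\<exists>h\<in>G. h \<otimes>\<^bsub>aut_subgroup \<Gamma> G\<^esub> hat \<sigma> = \<one>\<^bsub>aut_subgroup \<Gamma> G\<^esub>"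
    using group.l_inv_ex[OF G_group, of "hat \<sigma>"] g by (simp add: aut_subgroup_def)
  then obtain h where h: "h \<in> G" "compose V h (hat \<sigma>) = (\<lambda>A\<in>V. A)"
    using g G_Bij by (auto simp: aut_subgroup_def aut_group_def BijGroup_def verts_eq)
  have i: "inv' \<sigma> permutes X" using permutes_inv[OF s] .
  have "h = hat (inv' \<sigma>)"
  proof (rule extensionalityI)
    show "h \<in> extensional V" using G_Bij[OF h(1)] by (simp add: Bij_def)
    show "hat (inv' \<sigma>) \<in> extensional V" by (simp add: hat_def)
    fix A assume A: "A \<in> V"
    have B: "inv' \<sigma> ` A \<in> V" using perm_image_V[OF i A] .
    have "compose V h (hat \<sigma>) (inv' \<sigma> ` A) = inv' \<sigma> ` A" using h(2) B by simp
    moreover have "\<sigma> ` inv' \<sigma> ` A = A" using permutes_surj[OF s] by (simp add: image_f_inv_f)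
    ultimately show "h A = hat (inv' \<sigma>) A" using A B by (simp add: compose_def hat_def)
  qed
  then show ?thesis using h(1) by simp
qed

definition "Hs = {\<sigma>. \<sigma> permutes X \<and> hat \<sigma> \<in> G}"

lemma H_eq: "G \<inter> S = hat ` Hs"
  unfolding S_eq Hs_def by blast

lemma perm_group_Hs: "perm_group X Hs"
proof (rule perm_groupI)
  show "g permutes X" if "g \<in> Hs" for g using that by (simp add: Hs_def)
  show "id \<in> Hs" using G_one permutes_id by (simp add: Hs_def hat_id)
  show "g \<circ> h \<in> Hs" if "g \<in> Hs" "h \<in> Hs" for g h
    using that G_compose[of "hat g" "hat h"] compose_hat(1)[of g h] permutes_compose[of h X g]
    by (simp add: Hs_def)
  show "inv' g \<in> Hs" if "g \<in> Hs" for g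
    using that hat_inverse[of g] permutes_inv[of g X] by (simp add: Hs_def)
qed

lemma H_arc:
  assumes "adj A B" "adj A' B'"
  shows "\<exists>\<sigma>\<in>Hs. \<sigma> ` A = A' \<and> \<sigma> ` B = B'"
proof -
  have AV: "A \<in> V" "B \<in> V" using assms by (auto simp: adj_def)
  have tr: "transitive_action (aut_subgroup \<Gamma> (G \<inter> S)) (arcs \<Gamma>) (\<lambda>g. \<lambda>a\<in>arcs \<Gamma>. map_prod g g a)"
    using arc_H by (simp add: arc_transitive_def)
  have "\<exists>g\<in>carrier (aut_subgroup \<Gamma> (G \<inter> S)). (\<lambda>a\<in>arcs \<Gamma>. map_prod g g a) (A, B) = (A', B')"
    by (rule transitive_action.unique_orbit[OF tr]) (use assms in \<open>simp_all add: arcs_eq\<close>)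
  then obtain g where "g \<in> G \<inter> S" "g A = A'" "g B = B'"
    using assms by (auto simp: aut_subgroup_def arcs_eq)
  moreover from this obtain \<sigma> where "\<sigma> \<in> Hs" "g = hat \<sigma>" unfolding H_eq by blast
  ultimately show ?thesis using AV by (intro bexI[of _ \<sigma>]) (simp_all add: hat_apply)
qed

lemma insert_V: "C \<subseteq> X \<Longrightarrow> card C = k - 1 \<Longrightarrow> a \<in> X - C \<Longrightarrow> insert a C \<in> V"
  using k2 finite_X finite_subset[of C X] by (auto simp: V_def)

lemma insert_adj:
  assumes "C \<subseteq> X" "card C = k - 1" "a \<in> X - C" "b \<in> X - C" "a \<noteq> b"
  shows "adj (insert a C) (insert b C)"
proof -
  have "insert a C \<inter> insert b C = C" using assms by auto
  then show ?thesis using insert_V[OF assms(1,2,3)] insert_V[OF assms(1,2,4)] assms(2) k2 by (simp add: adj_def)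
qed

sublocale arc_transitive_perms X k Hs
proof
  show "perm_group X Hs" by (rule perm_group_Hs)
  fix C C' :: "nat set" and a b a' b'
  assume C: "C \<subseteq> X" "C' \<subseteq> X" "card C = k - 1" "card C' = k - 1"
    and ab: "a \<in> X - C" "b \<in> X - C" "a \<noteq> b" "a' \<in> X - C'" "b' \<in> X - C'" "a' \<noteq> b'"
  obtain \<sigma> where s: "\<sigma> \<in> Hs" "\<sigma> ` insert a C = insert a' C'" "\<sigma> ` insert b C = insert b' C'"
    using H_arc[OF insert_adj[OF C(1,3) ab(1,2,3)] insert_adj[OF C(2,4) ab(4,5,6)]] by blast
  have inj: "inj \<sigma>" using perm_groupD(1)[OF perm_group_Hs s(1)] permutes_inj by blast
  \<comment> \<open>Only the images of the two ends are known. The set \<open>C\<close> is recovered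
    as their intersection, and the points as what remains of each end.\<close>
  have "C = insert a C \<inter> insert b C" "C' = insert a' C' \<inter> insert b' C'" using ab by auto
  then have sC: "\<sigma> ` C = C'" using image_Int[OF inj, of "insert a C" "insert b C"] s(2,3) by simp
  have "\<sigma> a \<notin> \<sigma> ` C" "\<sigma> b \<notin> \<sigma> ` C" using inj ab by (auto simp: inj_image_mem_iff)
  moreover have "\<sigma> a \<in> insert a' C'" "\<sigma> b \<in> insert b' C'" using s by blast+
  ultimately show "\<exists>h\<in>Hs. h ` C = C' \<and> h a = a' \<and> h b = b'" using s(1) sC by blast
qed (use finite_X card_X k2 in simp_all)

lemma evenperm_in_Hs: "\<sigma> permutes X \<Longrightarrow> evenperm \<sigma> \<Longrightarrow> \<sigma> \<in> Hs"
  by (rule evenperm_mem_if_three_cycles[OF perm_group_Hs finite_X all_three_cycles]) auto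

section \<open>The action on the parts\<close>

lemma part_edges:
  assumes "p \<in> \<P>" "e \<in> p"
  shows "e \<in> edges \<Gamma>" "e \<subseteq> V"
proof -
  show "e \<in> edges \<Gamma>"
    using prim_G_D(1) assms by (auto simp: decomposition_def partition_on_def)
  from edges_D[OF this] show "e \<subseteq> V" by (auto simp: adj_def)
qed

lemma part_action_apply: "p \<in> \<P> \<Longrightarrow> part_action \<P> g p = (`) g ` p"
  by (simp add: part_action_def)

lemma part_action_closed: "g \<in> G \<Longrightarrow> p \<in> \<P> \<Longrightarrow> part_action \<P> g p \<in> \<P>"
  using prim_G_D(2) by (simp add: preserves_decomposition_def)

lemma part_action_compose:
  assumes "g \<in> G" "h \<in> G" "p \<in> \<P>"
  shows "part_action \<P> (compose V g h) p = part_action \<P> g (part_action \<P> h p)"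
proof -
  have "(`) (compose V g h) ` p = (\<lambda>e. g ` h ` e) ` p"
  proof (rule image_cong[OF refl])
    fix e assume "e \<in> p"
    then have "e \<subseteq> V" using part_edges(2)[OF assms(3)] by blast
    then show "compose V g h ` e = g ` h ` e"
      unfolding image_image by (intro image_cong) (auto simp: compose_def)
  qed
  then show ?thesis
    using assms part_action_closed[OF assms(2,3)] by (simp add: part_action_apply image_image)
qed

lemma part_action_one: "p \<in> \<P> \<Longrightarrow> part_action \<P> (\<lambda>A\<in>V. A) p = p"
proof -
  assume p: "p \<in> \<P>"
  have "(`) (\<lambda>A\<in>V. A) ` p = id ` p"
  proof (rule image_cong[OF refl])
    fix e assume "e \<in> p"
    then have "e \<subseteq> V" using part_edges(2)[OF p] by blast
    then show "(\<lambda>A\<in>V. A) ` e = id e" by force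
  qed
  then show ?thesis using p by (simp add: part_action_apply)
qed

lemma parts_eq: "p \<in> \<P> \<Longrightarrow> q \<in> \<P> \<Longrightarrow> e \<in> p \<Longrightarrow> e \<in> q \<Longrightarrow> p = q"
  using prim_G_D(1) unfolding decomposition_def partition_on_def disjoint_def by blast

lemma part_nonempty: "p \<in> \<P> \<Longrightarrow> \<exists>e. e \<in> p"
  using prim_G_D(1) by (auto simp: decomposition_def partition_on_def)

lemma part_action_eqI:
  assumes "g \<in> G" "p \<in> \<P>" "q \<in> \<P>" "e \<in> p" "g ` e \<in> q"
  shows "part_action \<P> g p = q"
  using parts_eq[OF part_action_closed[OF assms(1,2)] assms(3) _ assms(5)] assms(2,4)
  by (simp add: part_action_apply)

lemma H_part_transitive:
  assumes "p \<in> \<P>" "q \<in> \<P>"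
  shows "\<exists>\<sigma>\<in>Hs. part_action \<P> (hat \<sigma>) p = q"
proof -
  obtain e f where e: "e \<in> p" "f \<in> q" using part_nonempty assms by blast
  obtain A B where AB: "e = {A, B}" "adj A B" using edges_D part_edges(1)[OF assms(1) e(1)] by blast
  obtain A' B' where AB': "f = {A', B'}" "adj A' B'" using edges_D part_edges(1)[OF assms(2) e(2)] by blast
  obtain \<sigma> where s: "\<sigma> \<in> Hs" "\<sigma> ` A = A'" "\<sigma> ` B = B'" using H_arc[OF AB(2) AB'(2)] by blast
  have "hat \<sigma> ` e = f" using AB AB' s(2,3) by (simp add: hat_apply adj_def)
  then show ?thesis
    using part_action_eqI[of "hat \<sigma>" p q e] s(1) assms e by (auto simp: Hs_def)
qed

lemma two_parts: "\<exists>p\<in>\<P>. \<exists>q\<in>\<P>. p \<noteq> q"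
  using prim_G_D(1) by (simp add: decomposition_def)

lemma H_transitive_action: "transitive_action (aut_subgroup \<Gamma> (G \<inter> S)) \<P> (part_action \<P>)"
proof (intro transitive_action.intro group_action.intro group_hom.intro)
  have "transitive_action (aut_subgroup \<Gamma> (G \<inter> S)) (arcs \<Gamma>) (\<lambda>g. \<lambda>a\<in>arcs \<Gamma>. map_prod g g a)"
    using arc_H by (simp add: arc_transitive_def)
  then show "group (aut_subgroup \<Gamma> (G \<inter> S))"
    using transitive_action.axioms(1) group_action.group_hom group_hom.axioms(1) by blast
  show "group (BijGroup \<P>)" by (rule group_BijGroup)
  have "part_action \<P> \<in> hom (aut_subgroup \<Gamma> G) (BijGroup \<P>)"
    using transitive_action.axioms(1)[OF prim_G_D(3)] group_action.group_hom group_hom.homh by blast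
  then have "part_action \<P> \<in> hom (aut_subgroup \<Gamma> (G \<inter> S)) (BijGroup \<P>)"
    by (auto simp: hom_def aut_subgroup_def)
  then show "group_hom_axioms (aut_subgroup \<Gamma> (G \<inter> S)) (BijGroup \<P>) (part_action \<P>)"
    by (rule group_hom_axioms.intro)
  show "transitive_action_axioms (aut_subgroup \<Gamma> (G \<inter> S)) \<P> (part_action \<P>)"
  proof
    fix p q assume "p \<in> \<P>" "q \<in> \<P>"
    then obtain \<sigma> where "\<sigma> \<in> Hs" "part_action \<P> (hat \<sigma>) p = q" using H_part_transitive by blast
    then show "\<exists>g\<in>carrier (aut_subgroup \<Gamma> (G \<inter> S)). part_action \<P> g p = q"
      by (auto simp: aut_subgroup_def H_eq)
  qed
qed

lemma primitive_if_complement: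
  assumes tau: "cohat id \<in> G"
    and R: "partition_on \<P> R" and inv: "\<And>g B. g \<in> G \<inter> S \<Longrightarrow> B \<in> R \<Longrightarrow> part_action \<P> g ` B \<in> R"
  shows "R = {\<P>} \<or> R = (\<lambda>x. {x}) ` \<P>"
proof -
  let ?t = "part_action \<P> (cohat id)"
  have tP: "?t p \<in> \<P>" if "p \<in> \<P>" for p using part_action_closed[OF tau that] .
  have tt: "?t (?t p) = p" if "p \<in> \<P>" for p
    using part_action_compose[OF tau tau that] compose_hat(4)[OF permutes_id permutes_id]
      part_action_one[OF that] by (simp add: hat_id)
  have comm: "part_action \<P> g (?t p) = ?t (part_action \<P> g p)" if g: "g \<in> G" and p: "p \<in> \<P>" for g p
  proof -
    obtain \<sigma> where s: "\<sigma> permutes X" "g = hat \<sigma> \<or> g = cohat \<sigma>" using G_form[OF g] by blast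
    have "compose V g (cohat id) = compose V (cohat id) g"
      using s(2) compose_hat[OF s(1) permutes_id] compose_hat[OF permutes_id s(1)] by auto
    then show ?thesis using part_action_compose[OF g tau p] part_action_compose[OF tau g p] by simp
  qed
  let ?R = "(\<lambda>p. {p, ?t p}) ` \<P>"
  have "partition_on \<P> ?R"
  proof (rule partition_onI)
    show "\<Union>?R = \<P>" using tP by blast
    show "disjnt A B" if AB: "A \<in> ?R" "B \<in> ?R" "A \<noteq> B" for A B
    proof (rule ccontr)
      assume "\<not> disjnt A B"
      then obtain x where x: "x \<in> A" "x \<in> B" by (auto simp: disjnt_def)
      have key: "C = {x, ?t x}" if C: "C \<in> ?R" "x \<in> C" for C
      proof -
        obtain p where p: "p \<in> \<P>" "C = {p, ?t p}" using C(1) by blast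
        then consider "x = p" | "x = ?t p" using C(2) by blast
        then show ?thesis using p tt[OF p(1)] by cases (simp_all add: insert_commute)
      qed
      show False using key[OF AB(1) x(1)] key[OF AB(2) x(2)] AB(3) by simp
    qed
  qed blast
  moreover have "part_action \<P> g ` B \<in> ?R" if g: "g \<in> G" and B: "B \<in> ?R" for g B
  proof -
    obtain p where "p \<in> \<P>" "B = {p, ?t p}" using B by blast
    then show ?thesis using comm[OF g] part_action_closed[OF g] by auto
  qed
  ultimately have "?R = {\<P>} \<or> ?R = (\<lambda>x. {x}) ` \<P>" by (rule prim_G_D(4))
  then show ?thesis
  proof
    \<comment> \<open>Then there are at most two parts, and every partition of so small a set is
      trivial.\<close>
    assume one: "?R = {\<P>}"
    obtain p0 where p0: "p0 \<in> \<P>" using two_parts by blast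
    have "{p0, ?t p0} \<in> {\<P>}" unfolding one[symmetric] using p0 by (rule imageI)
    then have P: "\<P> = {p0, ?t p0}" by simp
    show ?thesis
    proof (rule partition_on_trivialI[OF R])
      fix B p assume B: "B \<in> R" "p \<in> B" "B \<noteq> \<P>"
      have "B \<subseteq> {p0, ?t p0}" using R B(1) P by (auto simp: partition_on_def)
      moreover have "B \<noteq> {p0, ?t p0}" using B(3) P by simp
      ultimately show "B = {p}" using B(2) by auto
    qed
  next
    assume single: "?R = (\<lambda>x. {x}) ` \<P>"
    have fixed: "?t p = p" if "p \<in> \<P>" for p
    proof -
      have "{p, ?t p} \<in> (\<lambda>x. {x}) ` \<P>" unfolding single[symmetric] using that by (rule imageI)
      then obtain x where "{p, ?t p} = {x}" by (rule imageE)
      then show ?thesis by auto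
    qed
    show ?thesis
    proof (rule prim_G_D(4)[OF R])
      fix g B assume g: "g \<in> G" and B: "B \<in> R"
      have BP: "B \<subseteq> \<P>" using R B by (auto simp: partition_on_def)
      obtain \<sigma> where s: "\<sigma> permutes X" "g = hat \<sigma> \<or> g = cohat \<sigma>" using G_form[OF g] by blast
      show "part_action \<P> g ` B \<in> R"
      proof (cases "g \<in> S")
        case True
        then show ?thesis using inv g B by blast
      next
        case False
        then have gs: "g = cohat \<sigma>" using s S_eq by blast
        \<comment> \<open>Since \<open>cohat id\<close> fixes every part, \<open>g\<close> acts on
          the parts as this product does, and the product lies in \<open>S\<close>.\<close>
        have h: "compose V (cohat id) g = hat \<sigma>"
          using compose_hat(4)[OF permutes_id s(1)] gs by simp
        have hG: "hat \<sigma> \<in> G \<inter> S" using G_compose[OF tau g] h s(1) S_eq by auto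
        have "part_action \<P> (hat \<sigma>) p = part_action \<P> g p" if "p \<in> B" for p
          using part_action_compose[OF tau g, of p] fixed[OF part_action_closed[OF g, of p]] that BP h by auto
        then have "part_action \<P> g ` B = part_action \<P> (hat \<sigma>) ` B" by (intro image_cong) auto
        then show ?thesis using inv[OF hG B] by simp
      qed
    qed
  qed
qed

text \<open>\<open>hat \<sigma>\<close> and \<open>cohat \<sigma>\<close> cannot both lie in
  \<open>G\<close>, for then \<open>cohat id\<close> would. All even \<open>\<sigma>\<close> have
  \<open>hat \<sigma>\<close> in \<open>G\<close>, so the \<open>s1\<close> with
  \<open>cohat s1\<close> in \<open>G\<close> is odd, and multiplying by it brings in
  \<open>cohat \<sigma>\<close> for every odd \<open>\<sigma>\<close>.\<close>

lemma primitive_if_twisted: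
  assumes tau: "cohat id \<notin> G" and nS: "\<not> G \<subseteq> S"
    and R: "partition_on \<P> R" and inv: "\<And>g B. g \<in> G \<inter> S \<Longrightarrow> B \<in> R \<Longrightarrow> part_action \<P> g ` B \<in> R"
  shows "R = {\<P>} \<or> R = (\<lambda>x. {x}) ` \<P>"
proof -
  have perm: "permutation \<sigma>" if "\<sigma> permutes X" for \<sigma> using that finite_X permutation_permutes by blast
  obtain s1 where s1: "s1 permutes X" "cohat s1 \<in> G"
    using nS G_form S_eq by blast
  have hatG: "hat \<sigma> \<in> G" if "\<sigma> permutes X" "evenperm \<sigma>" for \<sigma>
    using evenperm_in_Hs[OF that] by (simp add: Hs_def)
  have contra: False if s: "\<sigma> permutes X" "cohat \<sigma> \<in> G" "hat \<sigma> \<in> G" for \<sigma>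
  proof -
    have "compose V (cohat \<sigma>) (hat (inv' \<sigma>)) \<in> G"
      using G_compose[OF s(2) hat_inverse[OF s(1,3)]] .
    then show False
      using tau compose_hat(2)[OF s(1) permutes_inv[OF s(1)]] permutes_inv_o(1)[OF s(1)] by simp
  qed
  have odd1: "\<not> evenperm s1" using contra[OF s1] hatG[OF s1(1)] by blast
  have cohatG: "cohat \<sigma> \<in> G" if s: "\<sigma> permutes X" "\<not> evenperm \<sigma>" for \<sigma>
  proof -
    have i: "inv' s1 permutes X" using permutes_inv[OF s1(1)] .
    have p: "\<sigma> \<circ> inv' s1 permutes X" using permutes_compose[OF i s(1)] .
    have "evenperm (\<sigma> \<circ> inv' s1)"
      using s(2) odd1 by (simp add: evenperm_comp perm[OF s(1)] perm[OF i] evenperm_inv perm[OF s1(1)])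
    then have "compose V (hat (\<sigma> \<circ> inv' s1)) (cohat s1) \<in> G" using G_compose[OF hatG[OF p] s1(2)] by blast
    moreover have "\<sigma> \<circ> inv' s1 \<circ> s1 = \<sigma>" using permutes_inv_o(2)[OF s1(1)] by (simp add: comp_assoc)
    ultimately show ?thesis using compose_hat(3)[OF p s1(1)] by simp
  qed
  have even_Hs: "evenperm \<sigma>" if "\<sigma> \<in> Hs" for \<sigma>
    using that contra[of \<sigma>] cohatG[of \<sigma>] by (auto simp: Hs_def)
  \<comment> \<open>On four points, a permutation that fixes 1 and exchanges 2 and 3 is a
    transposition. Arc-transitivity would put this odd element into \<open>Hs\<close>.\<close>
  have k3: "k \<ge> 3"
  proof (rule ccontr)
    assume "\<not> k \<ge> 3"
    then have k: "k = 2" using k2 by simp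
    have X4: "X = {1, 2, 3, 4}" unfolding X_def using k by auto
    have "\<exists>h\<in>Hs. h ` {1} = {1} \<and> h 2 = 3 \<and> h 3 = 2"
      by (rule arc) (simp_all add: X4, simp_all add: k)
    then obtain \<sigma> where s: "\<sigma> \<in> Hs" "\<sigma> ` {1} = {1}" "\<sigma> 2 = 3" "\<sigma> 3 = 2" by blast
    have sX: "\<sigma> permutes X" using s(1) by (simp add: Hs_def)
    have inj: "\<sigma> x = \<sigma> y \<longleftrightarrow> x = y" for x y using permutes_inj[OF sX] by (simp add: inj_eq)
    have "\<sigma> 4 \<in> {1, 2, 3, 4}" using permutes_in_image[OF sX, of 4] X4 by auto
    moreover have "\<sigma> 4 \<noteq> \<sigma> 1" "\<sigma> 4 \<noteq> \<sigma> 2" "\<sigma> 4 \<noteq> \<sigma> 3" by (simp_all add: inj)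
    ultimately have s4: "\<sigma> 4 = 4" using s by auto
    have "\<sigma> = transpose 2 3"
    proof
      fix x
      consider "x = 1" | "x = 2" | "x = 3" | "x = 4" | "x \<notin> X" using X4 by blast
      then show "\<sigma> x = transpose 2 3 x"
      proof cases
        case 5
        then have "x \<noteq> 2" "x \<noteq> 3" using X4 by auto
        then show ?thesis using permutes_not_in[OF sX 5] by simp
      qed (use s s4 in auto)
    qed
    then show False using even_Hs[OF s(1)] by (simp add: evenperm_swap)
  qed
  \<comment> \<open>\<open>\<phi>\<close> is the isomorphism from Sym(X) onto \<open>G\<close> under
    which \<open>G \<inter> S\<close> is the image of the alternating group. Thus primitivity under
    \<open>G \<inter> S\<close> is what \<open>even_primitive\<close> asserts for
    \<open>act\<close>.\<close>
  define \<phi> where "\<phi> \<sigma> = (if evenperm \<sigma> then hat \<sigma> else cohat \<sigma>)" for \<sigma>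
  have \<phi>G: "\<phi> \<sigma> \<in> G" if "\<sigma> permutes X" for \<sigma>
    using hatG[OF that] cohatG[OF that] by (simp add: \<phi>_def)
  have \<phi>_comp: "\<phi> (\<sigma> \<circ> \<rho>) = compose V (\<phi> \<sigma>) (\<phi> \<rho>)" if "\<sigma> permutes X" "\<rho> permutes X" for \<sigma> \<rho>
    using compose_hat[OF that] by (simp add: \<phi>_def evenperm_comp perm[OF that(1)] perm[OF that(2)])
  define act where "act \<sigma> p = part_action \<P> (\<phi> \<sigma>) p" for \<sigma> p
  interpret act: perm_action X \<P> act
  proof
    show "act \<sigma> p \<in> \<P>" if "\<sigma> permutes X" "p \<in> \<P>" for \<sigma> p
      unfolding act_def by (rule part_action_closed[OF \<phi>G[OF that(1)] that(2)])
    show "act id p = p" if "p \<in> \<P>" for p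
      using part_action_one[OF that] by (simp add: act_def \<phi>_def hat_id)
    show "act (\<sigma> \<circ> \<rho>) p = act \<sigma> (act \<rho> p)" if "\<sigma> permutes X" "\<rho> permutes X" "p \<in> \<P>" for \<sigma> \<rho> p
      unfolding act_def \<phi>_comp[OF that(1,2)]
      by (rule part_action_compose[OF \<phi>G[OF that(1)] \<phi>G[OF that(2)] that(3)])
  qed
  obtain p0 p1 where p01: "p0 \<in> \<P>" "p1 \<in> \<P>" "p0 \<noteq> p1" using two_parts by blast
  have G_phi: "\<exists>\<sigma>. \<sigma> permutes X \<and> g = \<phi> \<sigma>" if g: "g \<in> G" for g
  proof -
    obtain \<sigma> where s: "\<sigma> permutes X" "g = hat \<sigma> \<or> g = cohat \<sigma>" using G_form[OF g] by blast
    then have "g = \<phi> \<sigma>"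
      using g even_Hs[of \<sigma>] contra[OF s(1)] hatG[OF s(1)] by (auto simp: \<phi>_def Hs_def)
    then show ?thesis using s(1) by blast
  qed
  show ?thesis
  proof (rule act.even_primitive[OF finite_X _ _ p01 _ R])
    show "\<exists>\<sigma>. \<sigma> permutes X \<and> evenperm \<sigma> \<and> act \<sigma> p = q" if pq: "p \<in> \<P>" "q \<in> \<P>" for p q
    proof -
      obtain \<sigma> where s: "\<sigma> \<in> Hs" "part_action \<P> (hat \<sigma>) p = q" using H_part_transitive[OF pq] by blast
      then show ?thesis using even_Hs[OF s(1)] by (intro exI[of _ \<sigma>]) (simp add: act_def \<phi>_def Hs_def)
    qed
    show "R' = {\<P>} \<or> R' = (\<lambda>x. {x}) ` \<P>"
      if "partition_on \<P> R'" "\<And>\<sigma> B. \<sigma> permutes X \<Longrightarrow> B \<in> R' \<Longrightarrow> act \<sigma> ` B \<in> R'" for R'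
    proof (rule prim_G_D(4)[OF that(1)])
      fix g B assume g: "g \<in> G" and B: "B \<in> R'"
      obtain \<sigma> where s: "\<sigma> permutes X" "g = \<phi> \<sigma>" using G_phi[OF g] by blast
      have "act \<sigma> ` B \<in> R'" using that(2)[OF s(1) B] .
      then show "part_action \<P> g ` B \<in> R'" using s(2) by (simp add: act_def)
    qed
    show "act \<sigma> ` B \<in> R" if "\<sigma> permutes X" "evenperm \<sigma>" "B \<in> R" for \<sigma> B
    proof -
      have "hat \<sigma> \<in> G \<inter> S" using hatG[OF that(1,2)] that(1) S_eq by blast
      from inv[OF this that(3)] show ?thesis using that(2) by (simp add: act_def \<phi>_def)
    qed
    show "\<exists>C D a b. act.edge_config C D a b p" if p: "p \<in> \<P>" for p
    proof -
      obtain e where e: "e \<in> p" using part_nonempty[OF p] by blast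
      obtain A B where AB: "e = {A, B}" "adj A B" using edges_D part_edges(1)[OF p e] by blast
      obtain a b where ab: "a \<in> A" "b \<in> X - A" "B = nb A a b" using adj_imp_nb[OF AB(2)] by blast
      have AV: "A \<in> V" "B \<in> V" using AB by (auto simp: adj_def)
      let ?C = "A - {a}" and ?D = "X - A - {b}"
      have Ains: "A = insert a ?C" "B = insert b ?C" using ab by (auto simp: nb_def)
      have AX: "A \<subseteq> X" using V_D(1)[OF AV(1)] .
      have cC: "card ?C = k - 1" using card_diff[OF AV(1) ab(1)] .
      have cD: "card ?D = k - 1" using ab(2) card_outside[OF AV(1)] finite_X by simp
      have eq: "act \<sigma> p = p" if "\<sigma> permutes X" "\<phi> \<sigma> ` e = e" for \<sigma>
        unfolding act_def using part_action_eqI[OF \<phi>G[OF that(1)] p p e] e that(2) by simp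
      have pair: "(\<sigma> a = a \<and> \<sigma> b = b) \<or> (\<sigma> a = b \<and> \<sigma> b = a)" if "\<sigma> ` {a, b} = {a, b}" for \<sigma> :: "nat \<Rightarrow> nat"
        using that by (auto simp: doubleton_eq_iff)
      have imA: "\<sigma> ` A = insert (\<sigma> a) (\<sigma> ` ?C)" for \<sigma> :: "nat \<Rightarrow> nat" by (subst Ains(1)) (rule image_insert)
      have imB: "\<sigma> ` B = insert (\<sigma> b) (\<sigma> ` ?C)" for \<sigma> :: "nat \<Rightarrow> nat" by (subst Ains(2)) (rule image_insert)
      have even: "act \<sigma> p = p"
        if s: "\<sigma> permutes X" "evenperm \<sigma>" "\<sigma> ` ?C = ?C" "\<sigma> ` {a, b} = {a, b}" for \<sigma>
      proof (rule eq[OF s(1)])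
        have "hat \<sigma> ` e = {insert (\<sigma> a) ?C, insert (\<sigma> b) ?C}"
          unfolding AB(1) image_insert image_empty hat_apply[OF AV(1)] hat_apply[OF AV(2)]
            imA[of \<sigma>] imB[of \<sigma>] s(3) ..
        also have "\<dots> = {insert a ?C, insert b ?C}" using pair[OF s(4)] by auto
        finally show "\<phi> \<sigma> ` e = e" using s(2) Ains AB(1) by (simp add: \<phi>_def)
      qed
      \<comment> \<open>\<open>\<sigma>\<close> takes \<open>?C\<close> to \<open>?D\<close>, and
        the complement of \<open>?D\<close> with one of \<open>a\<close>, \<open>b\<close> added is
        \<open>?C\<close> with the other added. So \<open>cohat \<sigma>\<close> keeps the edge,
        possibly exchanging its ends.\<close>
      have odd: "act \<sigma> p = p"
        if s: "\<sigma> permutes X" "\<not> evenperm \<sigma>" "\<sigma> ` ?C = ?D" "\<sigma> ` {a, b} = {a, b}" for \<sigma>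
      proof (rule eq[OF s(1)])
        have c1: "X - insert a ?D = B" and c2: "X - insert b ?D = A"
          using ab AX by (auto simp: nb_def)
        have "cohat \<sigma> ` e = {X - insert (\<sigma> a) ?D, X - insert (\<sigma> b) ?D}"
          unfolding AB(1) image_insert image_empty cohat_apply[OF AV(1)] cohat_apply[OF AV(2)]
            imA[of \<sigma>] imB[of \<sigma>] s(3) ..
        also have "\<dots> = {B, A}"
          using pair[OF s(4)]
        proof
          assume "\<sigma> a = a \<and> \<sigma> b = b"
          then show ?thesis by (simp only: c1 c2)
        next
          assume "\<sigma> a = b \<and> \<sigma> b = a"
          then show ?thesis by (simp only: c1 c2 insert_commute)
        qed
        finally show "\<phi> \<sigma> ` e = e" using s(2) AB(1) by (simp add: \<phi>_def insert_commute)
      qed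
      have "act.edge_config ?C ?D a b p"
        unfolding act.edge_config_def
      proof (intro conjI allI impI)
        show "X = ?C \<union> ?D \<union> {a, b}" using ab AX by auto
        show "a \<notin> ?C \<union> ?D" "b \<notin> ?C \<union> ?D" "a \<noteq> b" "?C \<inter> ?D = {}" using ab by auto
        show "card ?C = card ?D" "2 \<le> card ?C" using cC cD k3 by simp_all
        show "act \<sigma> p = p"
          if "\<sigma> permutes X" "evenperm \<sigma>" "\<sigma> ` ?C = ?C" "\<sigma> ` ?D = ?D" "\<sigma> ` {a, b} = {a, b}" for \<sigma>
          by (rule even[OF that(1,2,3,5)])
        show "act \<sigma> p = p"
          if "\<sigma> permutes X" "\<not> evenperm \<sigma>" "\<sigma> ` ?C = ?D" "\<sigma> ` ?D = ?C" "\<sigma> ` {a, b} = {a, b}" for \<sigma>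
          by (rule odd[OF that(1,2,3,5)])
      qed
      then show ?thesis by blast
    qed
  qed
qed

theorem primitive_H: "primitive_decomposition \<Gamma> (G \<inter> S) \<P>"
proof (cases "G \<subseteq> S")
  case True
  then have "G \<inter> S = G" by blast
  then show ?thesis using prim_G by simp
next
  case False
  have "preserves_decomposition (G \<inter> S) \<P>"
    using prim_G_D(2) by (simp add: preserves_decomposition_def)
  moreover have "R = {\<P>} \<or> R = (\<lambda>x. {x}) ` \<P>"
    if "partition_on \<P> R" "\<forall>h\<in>G \<inter> S. \<forall>B\<in>R. part_action \<P> h ` B \<in> R" for R
    using primitive_if_complement[OF _ that(1)] primitive_if_twisted[OF _ False that(1)] that(2) by blast
  ultimately show ?thesis
    using prim_G_D(1) H_transitive_action
    unfolding primitive_decomposition_def transitive_decomposition_def primitive_action_def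
    by (simp add: aut_subgroup_def)
qed

end

theorem theorem3p6:
  fixes k :: nat
    and G :: "(nat set \<Rightarrow> nat set) set"
    and \<P> :: "nat set set set set"
  defines "\<Gamma> \<equiv> johnson (2 * k) k"
    and "S \<equiv> johnson_sym (2 * k) k"
  assumes "k \<ge> 2"
    and "subgroup G (aut_group \<Gamma>)"
    and "arc_transitive \<Gamma> G"
    and "arc_transitive \<Gamma> (G \<inter> S)"
    and "primitive_decomposition \<Gamma> G \<P>"
  shows "primitive_decomposition \<Gamma> (G \<inter> S) \<P>"
proof -
  interpret johnson_decomposition k G \<P>
    using assms by (intro johnson_decomposition.intro) simp_all
  show ?thesis unfolding \<Gamma>_def S_def by (rule primitive_H)
qed

end
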